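(* Let $\phi:X\to\mathcal H$ be a lower semi-frame of $\mathcal H$ such that $D(C_\phi)$ is dense in $\mathcal H$, with generalized frame operator $\mathsf T_\phi$. Let $m,k\in[0,\infty)$ with $k\ge m$. Write $\mathsf T_\phi^{-k}\phi$ for the function $x\mapsto \mathsf T_\phi^{-k}\phi_x$. Then: (i) $\mathsf T_\phi^{-k}\phi$ is a Bessel mapping of $\mathcal H(\mathsf T_\phi^m)$ if and only if $k\ge m+\frac12$; (ii) $\mathsf T_\phi^{-k}\phi$ is a lower semi-frame of $\mathcal H(\mathsf T_\phi^m)$ if and only if $m\le k\le m+\frac12$; (iii) $\mathsf T_\phi^{-k}\phi$ is a frame of $\mathcal H(\mathsf T_\phi^m)$ if and only if $\mathsf T_\phi^{-k}\phi$ is a Parseval frame of $\mathcal H(\mathsf T_\phi^m)$, if and only if $k=m+\frac12$ (that is, these three conditions are equivalent).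
   Context: $\mathcal H$ is a separable Hilbert space with inner product $\langle\cdot|\cdot\rangle$ linear in the first factor, and $(X,\mu)$ is a locally compact space with a Radon measure $\mu$. A function $\phi:X\to\mathcal H$, $x\mapsto\phi_x$, is weakly measurable if $x\mapsto\langle f|\phi_x\rangle$ is measurable for every $f\in\mathcal H$. For a Hilbert space $\mathcal K$ with inner product $\langle\cdot|\cdot\rangle_{\mathcal K}$ and a weakly measurable function $\eta:X\to\mathcal K$: $\eta$ is a Bessel mapping of $\mathcal K$ if there is $\mathsf M<\infty$ with $\int_X|\langle f|\eta_x\rangle_{\mathcal K}|^2\,d\mu(x)\le \mathsf M\|f\|_{\mathcal K}^2$ for all $f\in\mathcal K$; $\eta$ is a lower semi-frame of $\mathcal K$ if there is $\mathsf m>0$ with $\mathsf m\|f\|_{\mathcal K}^2\le\int_X|\langle f|\eta_x\rangle_{\mathcal K}|^2\,d\mu(x)$ for all $f\in\mathcal K$ (the integral may be $+\infty$); $\eta$ is a (continuous) frame of $\mathcal K$ if it satisfies both conditions; $\eta$ is a Parseval frame of $\mathcal K$ if $\int_X|\langle f|\eta_x\rangle_{\mathcal K}|^2\,d\mu(x)=\|f\|_{\mathcal K}^2$ for all $f\in\mathcal K$. The analysis operator of a weakly measurable $\phi:X\to\mathcal H$ is $C_\phi:D(C_\phi)\subseteq\mathcal H\to L^2(X,d\mu)$, with $D(C_\phi)=\{f\in\mathcal H:\int_X|\langle f|\phi_x\rangle|^2d\mu(x)<\infty\}$ and $(C_\phi f)(x)=\langle f|\phi_x\rangle$; it is closed.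 When $D(C_\phi)$ is dense in $\mathcal H$, the generalized frame operator $\mathsf T_\phi$ is the non-negative self-adjoint operator on $\mathcal H$ associated by Kato's representation theorem to the closed non-negative form $\Omega_\phi(f,g)=\int_X\langle f|\phi_x\rangle\langle\phi_x|g\rangle\,d\mu(x)$, $f,g\in D(C_\phi)$; that is, $\mathsf T_\phi=C_\phi^*C_\phi=|C_\phi|^2$, $D(\mathsf T_\phi)\subset D(C_\phi)=D(\mathsf T_\phi^{1/2})$ and $\Omega_\phi(f,g)=\langle\mathsf T_\phi f|g\rangle$ for $f\in D(\mathsf T_\phi)$, $g\in D(C_\phi)$. If $\phi$ is in addition a lower semi-frame, $\mathsf T_\phi$ is invertible with bounded everywhere defined inverse, and its powers are defined by the functional calculus. For $m\ge0$, $\mathcal H(\mathsf T_\phi^m)$ denotes the domain $D(\mathsf T_\phi^m)$ considered as a Hilbert space with inner product $\langle f|g\rangle_m=\langle\mathsf T_\phi^mf|\mathsf T_\phi^mg\rangle$. For $k\ge m$ one has $\mathsf T_\phi^{-k}\phi_x\in\mathcal H(\mathsf T_\phi^m)$ for all $x$.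
   Formalization: The equivalences (i)–(iii) are proved when φ is not a Bessel mapping of H (they fail for bounded T_φ, e.g. T_φ = 2, m = k = 0); for Bessel φ only the "if" parts of (i), (ii), k = m+1/2 ⇒ Parseval, and Parseval ⇒ frame are stated. *)

theory Defs
  imports "HOL-Analysis.Analysis"
begin

section \<open>Complex Hilbert spaces\<close>

text \<open>The distribution only has real inner product spaces. A complex Hilbert space is a complete
  real one whose real structure is induced by a complex scalar multiplication and a sesquilinear
  inner product, linear in the first argument; the norm is then \<open>sqrt (Re (cinner x x))\<close>.\<close>

class chilbert_space = real_inner + complete_space +
  fixes scaleC :: "complex \<Rightarrow> 'a \<Rightarrow> 'a" (infixr \<open>*\<^sub>C\<close> 75)
    and cinner :: "'a \<Rightarrow> 'a \<Rightarrow> complex"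
  assumes scaleC_add_right: "a *\<^sub>C (x + y) = a *\<^sub>C x + a *\<^sub>C y"
    and scaleC_add_left: "(a + b) *\<^sub>C x = a *\<^sub>C x + b *\<^sub>C x"
    and scaleC_scaleC: "a *\<^sub>C (b *\<^sub>C x) = (a * b) *\<^sub>C x"
    and scaleC_of_real: "complex_of_real r *\<^sub>C x = scaleR r x"
    and cinner_add_left: "cinner (x + y) z = cinner x z + cinner y z"
    and cinner_scaleC_left: "cinner (a *\<^sub>C x) y = a * cinner x y"
    and cinner_commute: "cinner x y = cnj (cinner y x)"
    and inner_eq_Re_cinner: "inner x y = Re (cinner x y)"

text \<open>Hilbert spaces carried by a subspace of the ambient space, with their own inner product.\<close>

record 'h hspace =
  hcarrier :: "'h set"
  hinner :: "'h \<Rightarrow> 'h \<Rightarrow> complex"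

definition ambient :: "'h::chilbert_space hspace" where
  "ambient = \<lparr>hcarrier = UNIV, hinner = cinner\<rparr>"

definition hnorm_sq :: "'h hspace \<Rightarrow> 'h \<Rightarrow> real" where
  "hnorm_sq K f = Re (hinner K f f)"

section \<open>Frame notions\<close>

definition radon_measure :: "'x::t2_space measure \<Rightarrow> bool" where
  "radon_measure \<mu> \<longleftrightarrow>
     sets \<mu> = sets borel \<and>
     (\<forall>K. compact K \<longrightarrow> emeasure \<mu> K < \<infinity>) \<and>
     (\<forall>A\<in>sets borel. emeasure \<mu> A = (INF U\<in>{U. open U \<and> A \<subseteq> U}. emeasure \<mu> U)) \<and>
     (\<forall>U. open U \<longrightarrow> emeasure \<mu> U = (SUP K\<in>{K. compact K \<and> K \<subseteq> U}. emeasure \<mu> K))"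

definition weakly_measurable :: "'x measure \<Rightarrow> 'h hspace \<Rightarrow> ('x \<Rightarrow> 'h) \<Rightarrow> bool" where
  "weakly_measurable \<mu> K \<eta> \<longleftrightarrow>
     (\<forall>x\<in>space \<mu>. \<eta> x \<in> hcarrier K) \<and>
     (\<forall>f\<in>hcarrier K. (\<lambda>x. hinner K f (\<eta> x)) \<in> borel_measurable \<mu>)"

definition frame_integral :: "'x measure \<Rightarrow> 'h hspace \<Rightarrow> ('x \<Rightarrow> 'h) \<Rightarrow> 'h \<Rightarrow> ennreal" where
  "frame_integral \<mu> K \<eta> f = (\<integral>\<^sup>+x. ennreal ((cmod (hinner K f (\<eta> x)))\<^sup>2) \<partial>\<mu>)"

definition bessel_mapping :: "'x measure \<Rightarrow> 'h hspace \<Rightarrow> ('x \<Rightarrow> 'h) \<Rightarrow> bool" where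
  "bessel_mapping \<mu> K \<eta> \<longleftrightarrow> weakly_measurable \<mu> K \<eta> \<and>
     (\<exists>M::real. \<forall>f\<in>hcarrier K. frame_integral \<mu> K \<eta> f \<le> ennreal (M * hnorm_sq K f))"

definition lower_semi_frame :: "'x measure \<Rightarrow> 'h hspace \<Rightarrow> ('x \<Rightarrow> 'h) \<Rightarrow> bool" where
  "lower_semi_frame \<mu> K \<eta> \<longleftrightarrow> weakly_measurable \<mu> K \<eta> \<and>
     (\<exists>m::real. m > 0 \<and> (\<forall>f\<in>hcarrier K. ennreal (m * hnorm_sq K f) \<le> frame_integral \<mu> K \<eta> f))"

definition cont_frame :: "'x measure \<Rightarrow> 'h hspace \<Rightarrow> ('x \<Rightarrow> 'h) \<Rightarrow> bool" where
  "cont_frame \<mu> K \<eta> \<longleftrightarrow> bessel_mapping \<mu> K \<eta> \<and> lower_semi_frame \<mu> K \<eta>"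

definition parseval_frame :: "'x measure \<Rightarrow> 'h hspace \<Rightarrow> ('x \<Rightarrow> 'h) \<Rightarrow> bool" where
  "parseval_frame \<mu> K \<eta> \<longleftrightarrow> weakly_measurable \<mu> K \<eta> \<and>
     (\<forall>f\<in>hcarrier K. frame_integral \<mu> K \<eta> f = ennreal (hnorm_sq K f))"

section \<open>The generalized frame operator\<close>

text \<open>Unbounded operators are represented by their graphs.\<close>

type_synonym 'h oper = "('h \<times> 'h) set"

definition oapply :: "'h oper \<Rightarrow> 'h \<Rightarrow> 'h" where
  "oapply T f = (THE h. (f, h) \<in> T)"

text \<open>The operator associated with a form \<open>\<Omega>\<close> on a subspace \<open>D\<close>. It is single-valued if \<open>D\<close> is
  dense; for a closed non-negative \<open>\<Omega>\<close> it is the operator of Kato's representation theorem.\<close>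

definition assoc_operator :: "'h::chilbert_space set \<Rightarrow> ('h \<Rightarrow> 'h \<Rightarrow> complex) \<Rightarrow> 'h oper" where
  "assoc_operator D \<Omega> = {(f, h). f \<in> D \<and> (\<forall>g\<in>D. \<Omega> f g = cinner h g)}"

definition analysis_domain :: "'x measure \<Rightarrow> ('x \<Rightarrow> 'h::chilbert_space) \<Rightarrow> 'h set" where
  "analysis_domain \<mu> \<phi> = {f. (\<integral>\<^sup>+x. ennreal ((cmod (cinner f (\<phi> x)))\<^sup>2) \<partial>\<mu>) < \<infinity>}"

definition frame_form :: "'x measure \<Rightarrow> ('x \<Rightarrow> 'h::chilbert_space) \<Rightarrow> 'h \<Rightarrow> 'h \<Rightarrow> complex" where
  "frame_form \<mu> \<phi> f g = (\<integral>x. cinner f (\<phi> x) * cinner (\<phi> x) g \<partial>\<mu>)"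

definition frame_operator :: "'x measure \<Rightarrow> ('x \<Rightarrow> 'h::chilbert_space) \<Rightarrow> 'h oper" where
  "frame_operator \<mu> \<phi> = assoc_operator (analysis_domain \<mu> \<phi>) (frame_form \<mu> \<phi>)"

section \<open>Functional calculus\<close>

text \<open>Linearity and boundedness of \<open>P\<close> follow from self-adjointness.\<close>

definition orth_projection :: "('h::chilbert_space \<Rightarrow> 'h) \<Rightarrow> bool" where
  "orth_projection P \<longleftrightarrow> (\<forall>f. P (P f) = P f) \<and> (\<forall>f g. cinner (P f) g = cinner f (P g))"

definition spectral_family :: "(real \<Rightarrow> 'h::chilbert_space \<Rightarrow> 'h) \<Rightarrow> bool" where
  "spectral_family E \<longleftrightarrow>
     (\<forall>t. orth_projection (E t)) \<and>
     (\<forall>s t f. s \<le> t \<longrightarrow> E s (E t f) = E s f) \<and>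
     (\<forall>s f. ((\<lambda>t. E t f) \<longlongrightarrow> E s f) (at_right s)) \<and>
     (\<forall>f. ((\<lambda>t. E t f) \<longlongrightarrow> 0) at_bot) \<and>
     (\<forall>f. ((\<lambda>t. E t f) \<longlongrightarrow> f) at_top)"

text \<open>The measure \<open>d\<langle>E\<^sub>t f | f\<rangle>\<close>.\<close>

definition spec_measure :: "(real \<Rightarrow> 'h::chilbert_space \<Rightarrow> 'h) \<Rightarrow> 'h \<Rightarrow> real measure" where
  "spec_measure E f = interval_measure (\<lambda>t. (norm (E t f))\<^sup>2)"

text \<open>\<open>\<integral> u(t) d\<langle>E\<^sub>t f | g\<rangle>\<close>, the complex measure being given by polarization.\<close>

definition spec_integral ::
  "(real \<Rightarrow> 'h::chilbert_space \<Rightarrow> 'h) \<Rightarrow> (real \<Rightarrow> real) \<Rightarrow> 'h \<Rightarrow> 'h \<Rightarrow> complex" where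
  "spec_integral E u f g =
     (\<Sum>j<4. \<i> ^ j * complex_of_real (\<integral>t. u t \<partial>spec_measure E (f + (\<i> ^ j) *\<^sub>C g))) / 4"

text \<open>The operator \<open>u(T) = \<integral> u(t) dE\<^sub>t\<close>, with domain \<open>{f. \<integral> |u(t)|\<^sup>2 d\<langle>E\<^sub>t f | f\<rangle> < \<infinity>}\<close>, is
  determined by \<open>\<langle>u(T) f | g\<rangle> = \<integral> u(t) d\<langle>E\<^sub>t f | g\<rangle>\<close> for \<open>g\<close> in this domain, which is dense.\<close>

definition spec_domain :: "(real \<Rightarrow> 'h::chilbert_space \<Rightarrow> 'h) \<Rightarrow> (real \<Rightarrow> real) \<Rightarrow> 'h set" where
  "spec_domain E u = {f. (\<integral>\<^sup>+t. ennreal ((u t)\<^sup>2) \<partial>spec_measure E f) < \<infinity>}"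

definition spec_operator :: "(real \<Rightarrow> 'h::chilbert_space \<Rightarrow> 'h) \<Rightarrow> (real \<Rightarrow> real) \<Rightarrow> 'h oper" where
  "spec_operator E u = assoc_operator (spec_domain E u) (spec_integral E u)"

text \<open>The spectral theorem provides exactly one such family for every self-adjoint \<open>T\<close>.\<close>

definition spectral_family_of :: "'h::chilbert_space oper \<Rightarrow> real \<Rightarrow> 'h \<Rightarrow> 'h" where
  "spectral_family_of T = (SOME E. spectral_family E \<and> T = spec_operator E (\<lambda>t. t))"

text \<open>Only meant for self-adjoint \<open>T\<close> with a positive lower bound: the spectral measures then live
  on a half-line \<open>{c..}\<close> with \<open>c > 0\<close>, so that the values of \<open>powr\<close> at \<open>t \<le> 0\<close>
  (in particular \<open>0 powr 0 = 0\<close>) are irrelevant.\<close>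

definition opower :: "'h::chilbert_space oper \<Rightarrow> real \<Rightarrow> 'h oper" where
  "opower T s = spec_operator (spectral_family_of T) (\<lambda>t. t powr s)"

text \<open>\<open>power_space T m\<close> is \<open>\<H>(T\<^sup>m)\<close>; \<open>power_map \<mu> \<phi> k\<close> is \<open>x \<mapsto> T\<^sup>-\<^sup>k \<phi>\<^sub>x\<close> for \<open>T = frame_operator \<mu> \<phi>\<close>.\<close>

definition power_space :: "'h::chilbert_space oper \<Rightarrow> real \<Rightarrow> 'h hspace" where
  "power_space T m =
     \<lparr>hcarrier = Domain (opower T m),
      hinner = (\<lambda>f g. cinner (oapply (opower T m) f) (oapply (opower T m) g))\<rparr>"

definition power_map :: "'x measure \<Rightarrow> ('x \<Rightarrow> 'h::chilbert_space) \<Rightarrow> real \<Rightarrow> 'x \<Rightarrow> 'h" where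
  "power_map \<mu> \<phi> k = (\<lambda>x. oapply (opower (frame_operator \<mu> \<phi>) (- k)) (\<phi> x))"

abbreviation frame_space :: "'x measure \<Rightarrow> ('x \<Rightarrow> 'h::chilbert_space) \<Rightarrow> real \<Rightarrow> 'h hspace" where
  "frame_space \<mu> \<phi> m \<equiv> power_space (frame_operator \<mu> \<phi>) m"

end

theory Submission
  imports Defs "HOL-Probability.Distribution_Functions"
begin

text \<open>
  Let \<open>T = \<integral> t dE\<^sub>t\<close> be the frame operator and \<open>\<mu>\<^sub>g\<close> the measure \<open>d\<langle>E\<^sub>t g | g\<rangle>\<close>. The map \<open>g \<mapsto> T\<^sup>-\<^sup>m g\<close>
  identifies the ambient space isometrically with \<open>\<H>(T\<^sup>m)\<close>, and for \<open>f = T\<^sup>-\<^sup>m g\<close> one has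
  \<open>\<langle>f | T\<^sup>-\<^sup>k \<phi>\<^sub>x\<rangle>\<^sub>m = \<langle>T\<^sup>m\<^sup>-\<^sup>k g | \<phi>\<^sub>x\<rangle>\<close>. Hence the frame integral of \<open>f\<close> is \<open>\<Omega>\<^sub>\<phi>\<close> at \<open>T\<^sup>m\<^sup>-\<^sup>k g\<close>, which is
  \<open>\<integral> t\<^sup>p d\<mu>\<^sub>g\<close> with \<open>p = 1 + 2 m - 2 k\<close>, possibly \<open>\<infinity>\<close> (\<open>energy_eq_spectral_integral\<close>, \<open>energy_R\<close>,
  \<open>frame_integral_power_map\<close>). All parts of the theorem are now statements on \<open>p\<close>. As \<open>T\<close> has a
  positive lower bound, the integral is at most a multiple of \<open>\<parallel>g\<parallel>\<^sup>2\<close> if \<open>p \<le> 0\<close>, at least a multiple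
  if \<open>p \<ge> 0\<close>, and equal to \<open>\<parallel>g\<parallel>\<^sup>2\<close> if \<open>p = 0\<close>. Conversely, if it is bounded above for some
  \<open>p > 0\<close>, or below for some \<open>p < 0\<close>, then testing with vectors \<open>g\<close> whose spectrum lies above a large
  number shows that \<open>T\<close> is bounded, that is, that \<open>\<phi>\<close> is a Bessel mapping
  (\<open>bessel_if_power_bounded_above\<close>, \<open>bessel_if_power_bounded_below\<close>). If \<open>\<phi>\<close> is not a Bessel mapping,
  the bounds thus force the sign of \<open>p\<close>. For a Bessel mapping \<open>\<phi>\<close> all powers of \<open>T\<close> are bounded with
  bounded inverses, and nothing can be inferred about \<open>k\<close>.

  The operator theory behind this is built from the bounded inverse \<open>A\<close> of \<open>T\<close>. Fatou's lemma shows
  that the form \<open>\<Omega>\<^sub>\<phi>\<close> is closed, and the Riesz theorem on its domain yields \<open>A\<close>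
  (\<open>frame_operator_inverse\<close>). The spectral projections of \<open>A\<close> are the projections onto the kernels of
  \<open>\<bar>A - s\<bar> - (A - s)\<close> (\<open>sign_projection_exists\<close>), and they form the spectral family of \<open>T\<close>
  (\<open>spectral_theorem_inverse\<close>). The powers of \<open>T\<close> refer to an arbitrary family \<open>E\<close> with
  \<open>T = \<integral> t dE\<^sub>t\<close>; therefore the functional calculus is developed for every such family. Two bounded functionals \<open>u \<mapsto> \<integral> u d\<langle>E\<^sub>t f | g\<rangle>\<close> coincide once they coincide on the
  indicators of half-lines (\<open>combo_vanishes\<close>), where they are inner products with \<open>E\<^sub>t\<close>; this makes
  \<open>u \<mapsto> u(T)\<close> multiplicative on bounded functions (\<open>fcalc_fcalc\<close>), and an unbounded \<open>u(T)\<close> is expressed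
  by bounded functions of \<open>T\<close> (\<open>spec_operator_eq_range\<close>).
\<close>

section \<open>Elementary facts on complex Hilbert spaces\<close>

instance chilbert_space \<subseteq> banach ..

lemma cinner_add_right: "cinner x (y + z) = cinner x y + cinner x z"
  for x y z :: "'a::chilbert_space"
  by (metis cinner_add_left cinner_commute complex_cnj_add)

lemma cinner_scaleC_right: "cinner x (a *\<^sub>C y) = cnj a * cinner x y"
  for x y :: "'a::chilbert_space"
  by (metis cinner_commute cinner_scaleC_left complex_cnj_mult)

lemma cinner_scaleR_left: "cinner (r *\<^sub>R x) y = of_real r * cinner x y"
  for x y :: "'a::chilbert_space"
  by (metis cinner_scaleC_left scaleC_of_real)

lemma cinner_scaleR_right: "cinner x (r *\<^sub>R y) = of_real r * cinner x y"
  for x y :: "'a::chilbert_space"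
  by (metis cinner_scaleC_right scaleC_of_real complex_cnj_complex_of_real)

lemma cinner_zero_left [simp]: "cinner 0 y = 0" for y :: "'a::chilbert_space"
  using cinner_scaleR_left[of 0 0 y] by simp

lemma cinner_zero_right [simp]: "cinner x 0 = 0" for x :: "'a::chilbert_space"
  using cinner_scaleR_right[of x 0 0] by simp

lemma cinner_minus_left: "cinner (- x) y = - cinner x y" for x y :: "'a::chilbert_space"
  using cinner_scaleR_left[of "-1" x y] by simp

lemma cinner_minus_right: "cinner x (- y) = - cinner x y" for x y :: "'a::chilbert_space"
  using cinner_scaleR_right[of x "-1" y] by simp

lemma cinner_diff_left: "cinner (x - y) z = cinner x z - cinner y z"
  for x y z :: "'a::chilbert_space"
  using cinner_add_left[of x "- y" z] by (simp add: cinner_minus_left)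

lemma cinner_diff_right: "cinner x (y - z) = cinner x y - cinner x z"
  for x y z :: "'a::chilbert_space"
  using cinner_add_right[of x y "- z"] by (simp add: cinner_minus_right)

lemma Im_cinner: "Im (cinner x y) = inner x (\<i> *\<^sub>C y)" for x y :: "'a::chilbert_space"
  by (simp add: inner_eq_Re_cinner cinner_scaleC_right)

lemma cinner_self: "cinner x x = complex_of_real ((norm x)\<^sup>2)" for x :: "'a::chilbert_space"
proof -
  have "Im (cinner x x) = 0"
    using arg_cong[OF cinner_commute[of x x], of Im] by simp
  then show ?thesis
    by (simp add: complex_eq_iff power2_norm_eq_inner inner_eq_Re_cinner)
qed

lemma scaleC_one [simp]: "1 *\<^sub>C x = x" for x :: "'a::chilbert_space"
  using scaleC_of_real[of 1 x] by simp

lemma scaleC_minus_one [simp]: "(- 1) *\<^sub>C x = - x" for x :: "'a::chilbert_space"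
  using scaleC_of_real[of "- 1" x] by simp

lemma scaleC_scaleR: "a *\<^sub>C (r *\<^sub>R x) = r *\<^sub>R (a *\<^sub>C x)" for x :: "'a::chilbert_space"
  by (simp add: scaleC_of_real[symmetric] scaleC_scaleC mult.commute)

lemma norm_scaleC: "norm (a *\<^sub>C x) = cmod a * norm x" for x :: "'a::chilbert_space"
proof -
  have "complex_of_real ((norm (a *\<^sub>C x))\<^sup>2) = of_real ((cmod a * norm x)\<^sup>2)"
    unfolding cinner_self[symmetric] cinner_scaleC_left cinner_scaleC_right
    by (simp add: cinner_self power_mult_distrib complex_norm_square[of a, unfolded of_real_power] mult_ac)
  then have "(norm (a *\<^sub>C x))\<^sup>2 = (cmod a * norm x)\<^sup>2"
    by (simp only: of_real_eq_iff)
  then show ?thesis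
    by (simp add: power2_eq_iff_nonneg)
qed

lemma bounded_linear_scaleC: "bounded_linear ((*\<^sub>C) a :: 'a::chilbert_space \<Rightarrow> 'a)"
  by (rule bounded_linear_intro[of _ "cmod a"])
    (simp_all add: scaleC_add_right scaleC_scaleR norm_scaleC mult.commute)

lemma cmod_cinner_le: "cmod (cinner x y) \<le> norm x * norm y" for x y :: "'a::chilbert_space"
proof (cases "cinner x y = 0")
  case False
  define a where "a = cnj (cinner x y) / of_real (cmod (cinner x y))"
  have a: "cmod a = 1"
    using False by (simp add: a_def norm_divide)
  have "a * cinner x y = of_real (cmod (cinner x y))"
    using False complex_norm_square[of "cinner x y"]
    by (simp add: a_def field_simps power2_eq_square)
  then have "cmod (cinner x y) = inner (a *\<^sub>C x) y"
    by (simp add: inner_eq_Re_cinner cinner_scaleC_left)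
  also have "\<dots> \<le> norm (a *\<^sub>C x) * norm y"
    by (rule norm_cauchy_schwarz)
  finally show ?thesis
    by (simp add: norm_scaleC a)
qed simp

lemma bounded_linear_cinner_left: "bounded_linear (\<lambda>x. cinner x y)" for y :: "'a::chilbert_space"
  by (rule bounded_linear_intro[of _ "norm y"])
    (simp_all add: cinner_add_left cinner_scaleR_left scaleR_conv_of_real cmod_cinner_le)

lemma bounded_linear_cinner_right: "bounded_linear (cinner x)" for x :: "'a::chilbert_space"
  by (rule bounded_linear_intro[of _ "norm x"])
    (simp_all add: cinner_add_right cinner_scaleR_right scaleR_conv_of_real cmod_cinner_le
      mult.commute[of _ "norm x"])

lemma cinner_ext:
  fixes x y :: "'a::chilbert_space"
  assumes "\<And>z. cinner x z = cinner y z"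
  shows "x = y"
proof -
  have "cinner (x - y) (x - y) = 0"
    using assms[of "x - y"] by (simp add: cinner_diff_left)
  then show ?thesis
    by (simp add: cinner_self)
qed

lemma cinner_ext_dense:
  fixes x y :: "'a::chilbert_space"
  assumes eq: "\<And>z. z \<in> D \<Longrightarrow> cinner x z = cinner y z" and dense: "closure D = UNIV"
  shows "x = y"
proof (rule cinner_ext)
  fix z
  obtain d where d: "\<And>n. d n \<in> D" "d \<longlonglongrightarrow> z"
    using dense closure_sequential[of z D] by auto
  have "(\<lambda>n. cinner x (d n)) \<longlonglongrightarrow> cinner x z" "(\<lambda>n. cinner y (d n)) \<longlonglongrightarrow> cinner y z"
    using bounded_linear.tendsto[OF bounded_linear_cinner_right d(2)] by auto
  then show "cinner x z = cinner y z"
    using eq[OF d(1)] LIMSEQ_unique by simp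
qed

section \<open>The Riesz representation theorem for a form\<close>

text \<open>The representing vector minimises \<open>b g g - 2 * l g\<close>; the parallelogram law turns every
  minimising sequence into a Cauchy sequence.\<close>

lemma riesz_representation_form:
  fixes b :: "'a::real_vector \<Rightarrow> 'a \<Rightarrow> real" and l :: "'a \<Rightarrow> real"
  assumes D: "subspace D"
    and b_add: "\<And>x y z. x \<in> D \<Longrightarrow> y \<in> D \<Longrightarrow> z \<in> D \<Longrightarrow> b (x + y) z = b x z + b y z"
    and b_scale: "\<And>r x y. x \<in> D \<Longrightarrow> y \<in> D \<Longrightarrow> b (r *\<^sub>R x) y = r * b x y"
    and b_sym: "\<And>x y. x \<in> D \<Longrightarrow> y \<in> D \<Longrightarrow> b x y = b y x"
    and b_nonneg: "\<And>x. x \<in> D \<Longrightarrow> 0 \<le> b x x"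
    and complete: "\<And>X. (\<And>n. X n \<in> D) \<Longrightarrow>
        (\<And>e. 0 < e \<Longrightarrow> \<exists>N. \<forall>m\<ge>N. \<forall>n\<ge>N. b (X m - X n) (X m - X n) < e) \<Longrightarrow>
        \<exists>u\<in>D. (\<lambda>n. b (X n - u) (X n - u)) \<longlonglongrightarrow> 0"
    and l_add: "\<And>x y. x \<in> D \<Longrightarrow> y \<in> D \<Longrightarrow> l (x + y) = l x + l y"
    and l_scale: "\<And>r x. x \<in> D \<Longrightarrow> l (r *\<^sub>R x) = r * l x"
    and l_bound: "\<And>x. x \<in> D \<Longrightarrow> (l x)\<^sup>2 \<le> K * b x x"
  shows "\<exists>u\<in>D. \<forall>g\<in>D. b u g = l g"
proof -
  have D_add: "x + y \<in> D" and D_scale: "r *\<^sub>R x \<in> D" and D_diff: "x - y \<in> D"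
    if "x \<in> D" "y \<in> D" for x y r
    using D that by (auto intro: subspace_add subspace_scale subspace_diff)
  have b_add_right: "b z (x + y) = b z x + b z y" if "x \<in> D" "y \<in> D" "z \<in> D" for x y z
    using b_add[of x y z] b_sym[of z "x + y"] b_sym[of z x] b_sym[of z y] D_add that by simp
  have b_scale_right: "b y (r *\<^sub>R x) = r * b y x" if "x \<in> D" "y \<in> D" for r x y
    using b_scale[of x y r] b_sym[of y "r *\<^sub>R x"] b_sym[of y x] D_scale[OF that] that by simp
  define J where "J x = b x x - 2 * l x" for x
  have J_line: "J (x + t *\<^sub>R y) = J x + 2 * t * (b x y - l y) + t\<^sup>2 * b y y"
    if "x \<in> D" "y \<in> D" for x y t
    using that D_add D_scale
    by (simp add: J_def b_add b_add_right b_scale b_scale_right l_add l_scale b_sym[of y x]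
        power2_eq_square algebra_simps)
  have J_lower: "- \<bar>K\<bar> \<le> J x" if "x \<in> D" for x
  proof -
    have "(l x)\<^sup>2 \<le> \<bar>K\<bar> * b x x"
      using l_bound[OF that] b_nonneg[OF that] by (meson abs_ge_self mult_right_mono order_trans)
    moreover have "4 * (\<bar>K\<bar> * b x x) \<le> (\<bar>K\<bar> + b x x)\<^sup>2"
      using zero_le_power2[of "\<bar>K\<bar> - b x x"] by (simp add: power2_eq_square algebra_simps)
    ultimately have "(2 * l x)\<^sup>2 \<le> (\<bar>K\<bar> + b x x)\<^sup>2"
      by (simp add: power_mult_distrib)
    then have "2 * l x \<le> \<bar>K\<bar> + b x x"
      by (rule power2_le_imp_le) (use b_nonneg[OF that] in auto)
    then show ?thesis
      by (simp add: J_def)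
  qed
  define i where "i = (INF x\<in>D. J x)"
  have bdd: "bdd_below (J ` D)"
    using J_lower by (auto intro!: bdd_belowI[of _ "- \<bar>K\<bar>"])
  have D_ne: "D \<noteq> {}"
    using subspace_0[OF D] by auto
  have i_le: "i \<le> J x" if "x \<in> D" for x
    unfolding i_def using bdd that by (rule cINF_lower)
  have "\<exists>x\<in>D. J x < i + inverse (real (Suc n))" for n
    using cInf_lessD[of "J ` D" "i + inverse (real (Suc n))"] D_ne by (auto simp: i_def)
  then obtain X where X: "\<And>n. X n \<in> D" and X_J: "\<And>n. J (X n) < i + inverse (real (Suc n))"
    by metis
  have parallelogram: "b (x - y) (x - y) \<le> 2 * (J x - i) + 2 * (J y - i)"
    if "x \<in> D" "y \<in> D" for x y
  proof -
    have 1: "J (x + (1/2) *\<^sub>R (y - x)) = J x + (b x (y - x) - l (y - x)) + b (y - x) (y - x) / 4"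
      using J_line[of x "y - x" "1/2"] that D_diff by (simp add: power2_eq_square)
    have 2: "J y = J x + 2 * (b x (y - x) - l (y - x)) + b (y - x) (y - x)"
      using J_line[of x "y - x" 1] that D_diff by (simp add: power2_eq_square)
    have "i \<le> J (x + (1/2) *\<^sub>R (y - x))"
      using that D_diff D_add D_scale by (intro i_le) simp
    moreover have "b (x - y) (x - y) = b (y - x) (y - x)"
      using b_scale[of "y - x" "x - y" "-1"] b_scale_right[of "y - x" "y - x" "-1"] that D_diff by simp
    ultimately show ?thesis
      using 1 2 by argo
  qed
  have cauchy: "\<exists>N. \<forall>m\<ge>N. \<forall>n\<ge>N. b (X m - X n) (X m - X n) < e" if "0 < e" for e
  proof -
    obtain N where N: "inverse (real (Suc N)) < e / 4"
      using reals_Archimedean[of "e / 4"] \<open>0 < e\<close> by (auto simp del: of_nat_Suc)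
    have "b (X m - X n) (X m - X n) < e" if "m \<ge> N" "n \<ge> N" for m n
    proof -
      have "inverse (real (Suc m)) \<le> inverse (real (Suc N))" "inverse (real (Suc n)) \<le> inverse (real (Suc N))"
        using that by auto
      then show ?thesis
        using parallelogram[OF X X, of m n] X_J[of m] X_J[of n] N by argo
    qed
    then show ?thesis
      by blast
  qed
  obtain u where u: "u \<in> D" and lim: "(\<lambda>n. b (X n - u) (X n - u)) \<longlonglongrightarrow> 0"
    using complete[of X, OF X cauchy] by blast
  \<comment> \<open>Every \<open>X n\<close> is a near-minimiser, hence so is \<open>u\<close>: expand \<open>J\<close> at \<open>X n\<close> along \<open>g\<close> and pass to the limit.\<close>
  have key: "2 * t * (b u g - l g) + t\<^sup>2 * b g g \<ge> 0" if g: "g \<in> D" for g t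
  proof -
    have cs: "\<bar>b x g\<bar> \<le> sqrt (b x x) * sqrt (b g g)" if "x \<in> D" for x
    proof -
      have "0 \<le> b x x + 2 * s * b x g + s\<^sup>2 * b g g" for s
        using b_nonneg[of "x + s *\<^sub>R g"] that g D_add D_scale
        by (simp add: b_add b_add_right b_scale b_scale_right b_sym[of g x] power2_eq_square algebra_simps)
      note pos = this
      have "(b x g)\<^sup>2 \<le> b x x * b g g"
      proof (cases "b g g = 0")
        case True
        have "b x g = 0"
        proof (rule ccontr)
          assume "b x g \<noteq> 0"
          then show False
            using pos[of "- (b x x + 1) / (2 * b x g)"] True by (simp add: field_simps)
        qed
        then show ?thesis
          using True by simp
      next
        case False
        then have "0 < b g g"
          using b_nonneg[OF g] by simp
        then show ?thesis
          using pos[of "- b x g / b g g"] by (simp add: field_simps power2_eq_square)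
      qed
      then show ?thesis
        by (metis real_sqrt_abs real_sqrt_le_iff real_sqrt_mult)
    qed
    have *: "(\<lambda>n. sqrt (b (X n - u) (X n - u)) * sqrt (b g g)) \<longlonglongrightarrow> sqrt 0 * sqrt (b g g)"
      using lim by (intro tendsto_intros)
    have "(\<lambda>n. b (X n - u) g) \<longlonglongrightarrow> 0"
    proof (rule Lim_null_comparison[rotated])
      show "(\<lambda>n. sqrt (b (X n - u) (X n - u)) * sqrt (b g g)) \<longlonglongrightarrow> 0"
        using * by simp
    qed (auto intro!: always_eventually cs[OF D_diff[OF X u]])
    then have "(\<lambda>n. 2 * t * (b (X n - u) g + (b u g - l g)) + t\<^sup>2 * b g g + inverse (real (Suc n)))
        \<longlonglongrightarrow> 2 * t * (0 + (b u g - l g)) + t\<^sup>2 * b g g + 0"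
      by (intro tendsto_intros LIMSEQ_inverse_real_of_nat)
    moreover have "0 \<le> 2 * t * (b (X n - u) g + (b u g - l g)) + t\<^sup>2 * b g g + inverse (real (Suc n))" for n
    proof -
      have "b (X n) g = b (X n - u) g + b u g"
        using b_add[of "X n - u" u g] X u g D_diff by simp
      moreover have "i \<le> J (X n + t *\<^sub>R g)"
        using X g D_add D_scale by (intro i_le) simp
      ultimately show ?thesis
        using J_line[OF X g, of n t] X_J[of n] by (simp add: algebra_simps)
    qed
    ultimately show ?thesis
      by (simp add: LIMSEQ_le_const)
  qed
  have "b u g = l g" if g: "g \<in> D" for g
  proof (rule ccontr)
    assume ne: "b u g \<noteq> l g"
    define d where "d = b u g - l g"
    \<comment> \<open>The minimum over \<open>t\<close> is at \<open>- d / b g g\<close>; the summand \<open>1\<close> covers the case \<open>b g g = 0\<close>.\<close>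
    define t where "t = - d / (b g g + 1)"
    have pos: "0 < b g g + 1"
      using b_nonneg[OF g] by simp
    have "t * (b g g + 1) = - d"
      using pos by (simp add: t_def)
    then have "t * (t * (b g g + 1)) = t * (- d)"
      by simp
    then have "2 * t * d + t\<^sup>2 * b g g = t * d - t\<^sup>2"
      by (simp add: power2_eq_square algebra_simps)
    moreover have "t * d \<le> 0"
      using pos by (simp add: t_def divide_nonpos_pos)
    moreover have "0 < t\<^sup>2"
      using ne pos by (simp add: t_def d_def)
    ultimately show False
      using key[OF g, of t] by (simp add: d_def)
  qed
  then show ?thesis
    using u by blast
qed

lemma riesz_representation_closed_subspace:
  fixes M :: "'a::{real_inner, banach} set"
  assumes M: "subspace M" "closed M"
    and l_add: "\<And>x y. x \<in> M \<Longrightarrow> y \<in> M \<Longrightarrow> l (x + y) = l x + l y"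
    and l_scale: "\<And>r x. x \<in> M \<Longrightarrow> l (r *\<^sub>R x) = r * l x"
    and l_bound: "\<And>x. x \<in> M \<Longrightarrow> \<bar>l x\<bar> \<le> K * norm x"
  shows "\<exists>u\<in>M. \<forall>g\<in>M. inner u g = l g"
proof (rule riesz_representation_form[OF M(1), where K="K\<^sup>2"])
  fix X :: "nat \<Rightarrow> 'a"
  assume X: "\<And>n. X n \<in> M"
    and cauchy: "\<And>e. 0 < e \<Longrightarrow> \<exists>N. \<forall>m\<ge>N. \<forall>n\<ge>N. inner (X m - X n) (X m - X n) < e"
  have "Cauchy X"
  proof (rule metric_CauchyI)
    fix e :: real assume "0 < e"
    then obtain N where N: "\<forall>m\<ge>N. \<forall>n\<ge>N. inner (X m - X n) (X m - X n) < e\<^sup>2"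
      using cauchy[of "e\<^sup>2"] by auto
    then have "dist (X m) (X n) < e" if "m \<ge> N" "n \<ge> N" for m n
      using that \<open>0 < e\<close> power2_less_imp_less[of "norm (X m - X n)" e]
      by (simp add: dist_norm power2_norm_eq_inner)
    then show "\<exists>N. \<forall>m\<ge>N. \<forall>n\<ge>N. dist (X m) (X n) < e"
      by blast
  qed
  then obtain u where lim: "X \<longlonglongrightarrow> u"
    using Cauchy_convergent_iff convergent_def by blast
  have "u \<in> M"
    using M(2) X lim closed_sequentially by blast
  moreover have "(\<lambda>n. inner (X n - u) (X n - u)) \<longlonglongrightarrow> inner (u - u) (u - u)"
    using lim by (intro tendsto_intros)
  ultimately show "\<exists>u\<in>M. (\<lambda>n. inner (X n - u) (X n - u)) \<longlonglongrightarrow> 0"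
    by auto
next
  fix x assume "x \<in> M"
  then have "\<bar>l x\<bar>\<^sup>2 \<le> (K * norm x)\<^sup>2"
    by (intro power_mono l_bound) simp_all
  then show "(l x)\<^sup>2 \<le> K\<^sup>2 * inner x x"
    by (simp add: power_mult_distrib power2_norm_eq_inner)
qed (auto simp: inner_add_left inner_add_right inner_commute l_add l_scale)

lemma orthogonal_projection_exists:
  fixes M :: "'a::{real_inner, banach} set"
  assumes M: "subspace M" "closed M"
  obtains P where "\<And>x. P x \<in> M" "\<And>x g. g \<in> M \<Longrightarrow> inner (x - P x) g = 0"
proof -
  have "\<exists>u\<in>M. \<forall>g\<in>M. inner u g = inner x g" for x
    by (rule riesz_representation_closed_subspace[OF M, where K="norm x"])
      (simp_all add: inner_add_right Cauchy_Schwarz_ineq2)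
  then obtain P where "\<And>x. P x \<in> M" "\<And>x g. g \<in> M \<Longrightarrow> inner (P x) g = inner x g"
    by metis
  then show ?thesis
    by (intro that[of P]) (auto simp: inner_diff_left)
qed

section \<open>The spectral family of a positive operator\<close>

text \<open>For sequences with orthogonal increments, such as \<open>n \<mapsto> E (t n) f\<close> for a monotone \<open>t\<close>, the squared
  increments are the absolute increments of the numbers \<open>\<parallel>X n\<parallel>\<^sup>2\<close>, which converge by monotonicity.\<close>

lemma convergent_if_increments_dominated:
  fixes X :: "nat \<Rightarrow> 'a::{real_normed_vector, complete_space}" and a :: "nat \<Rightarrow> real"
  assumes a: "convergent a" and le: "\<And>m n. m \<le> n \<Longrightarrow> (norm (X n - X m))\<^sup>2 \<le> \<bar>a n - a m\<bar>"
  shows "convergent X"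
proof -
  have "Cauchy a"
    using a by (rule convergent_Cauchy)
  have "Cauchy X"
  proof (rule metric_CauchyI)
    fix e :: real assume e: "0 < e"
    then obtain N where N: "\<And>m n. m \<ge> N \<Longrightarrow> n \<ge> N \<Longrightarrow> dist (a m) (a n) < e\<^sup>2"
      using metric_CauchyD[OF \<open>Cauchy a\<close>, of "e\<^sup>2"] by auto
    have *: "norm (X n - X m) < e" if "N \<le> m" "m \<le> n" for m n
    proof (rule power2_less_imp_less)
      show "(norm (X n - X m))\<^sup>2 < e\<^sup>2"
        using le[of m n] N[of n m] that by (simp add: dist_real_def)
    qed (use e in simp)
    have "dist (X m) (X n) < e" if "N \<le> m" "N \<le> n" for m n
      using *[of m n] *[of n m] that by (cases "m \<le> n") (auto simp: dist_norm norm_minus_commute)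
    then show "\<exists>M. \<forall>m\<ge>M. \<forall>n\<ge>M. dist (X m) (X n) < e"
      by blast
  qed
  then show ?thesis
    by (rule Cauchy_convergent)
qed

text \<open>The solution \<open>Y\<close> of \<open>2 Y = X + Y\<^sup>2\<close> makes \<open>1 - Y\<close> a square root of \<open>1 - X\<close>. It is the limit of
  the iteration \<open>Y\<^sub>n\<^sub>+\<^sub>1 = (X + Y\<^sub>n\<^sup>2) / 2\<close>, whose increments are dominated in norm by those of the same
  iteration for the number \<open>1\<close> in place of \<open>X\<close>; the iterates of the latter increase and stay below \<open>1\<close>.\<close>

lemma contraction_quadratic_solution:
  fixes X :: "'a::{real_inner, banach} \<Rightarrow>\<^sub>L 'a"
  assumes X: "norm X \<le> 1" and sym: "\<And>x y. inner (X x) y = inner x (X y)"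
  obtains Y :: "'a \<Rightarrow>\<^sub>L 'a" where "norm Y \<le> 1" "\<And>x. 2 *\<^sub>R Y x = X x + Y (Y x)"
    "\<And>x y. inner (Y x) y = inner x (Y y)"
    "\<And>B x. bounded_linear B \<Longrightarrow> (\<And>x. B (X x) = X (B x)) \<Longrightarrow> B (Y x) = Y (B x)"
proof -
  define F where "F Z = (1/2) *\<^sub>R (X + (Z o\<^sub>L Z))" for Z
  define Y where "Y n = (F ^^ n) 0" for n
  define y :: "nat \<Rightarrow> real" where "y n = ((\<lambda>z. (1 + z\<^sup>2) / 2) ^^ n) 0" for n
  have Y_Suc: "Y (Suc n) = F (Y n)" and y_Suc: "y (Suc n) = (1 + (y n)\<^sup>2) / 2" for n
    by (simp_all add: Y_def y_def)
  have y_bounds: "0 \<le> y n \<and> y n \<le> 1" for n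
  proof (induction n)
    case (Suc n)
    then have "(y n)\<^sup>2 \<le> 1"
      by (simp add: power_le_one)
    then show ?case
      using zero_le_power2[of "y n"] by (simp add: y_Suc del: zero_le_power2)
  qed (simp add: y_def)
  have Y_le: "norm (Y n) \<le> y n" for n
  proof (induction n)
    case (Suc n)
    have "norm (Y n o\<^sub>L Y n) \<le> norm (Y n) * norm (Y n)"
      by (rule norm_blinfun_compose)
    also have "\<dots> \<le> y n * y n"
      using Suc y_bounds by (intro mult_mono) auto
    finally have "norm (X + (Y n o\<^sub>L Y n)) \<le> 1 + y n * y n"
      using X norm_triangle_ineq[of X "Y n o\<^sub>L Y n"] by linarith
    then show ?case
      by (simp add: Y_Suc F_def y_Suc power2_eq_square)
  qed (simp add: Y_def y_def)
  have incr: "norm (Y (Suc n) - Y n) \<le> y (Suc n) - y n" for n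
  proof (induction n)
    case 0
    then show ?case
      using Y_le[of 1] by (simp add: Y_def y_def)
  next
    case (Suc n)
    define D where "D = Y (Suc n) - Y n"
    have "Y (Suc (Suc n)) - Y (Suc n) = (1/2) *\<^sub>R ((Y (Suc n) o\<^sub>L D) + (D o\<^sub>L Y n))"
      by (simp add: D_def Y_Suc[of "Suc n"] Y_Suc[of n] F_def bounded_bilinear.diff_left[OF bounded_bilinear_blinfun_compose]
          bounded_bilinear.diff_right[OF bounded_bilinear_blinfun_compose] scaleR_diff_right[symmetric] del: scaleR_diff_right)
    then have "norm (Y (Suc (Suc n)) - Y (Suc n)) = norm ((Y (Suc n) o\<^sub>L D) + (D o\<^sub>L Y n)) / 2"
      by simp
    also have "\<dots> \<le> (norm (Y (Suc n)) * norm D + norm D * norm (Y n)) / 2"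
      using norm_triangle_ineq[of "Y (Suc n) o\<^sub>L D" "D o\<^sub>L Y n"]
        norm_blinfun_compose[of "Y (Suc n)" D] norm_blinfun_compose[of D "Y n"] by argo
    also have "\<dots> \<le> (y (Suc n) * (y (Suc n) - y n) + (y (Suc n) - y n) * y n) / 2"
    proof -
      have D_le: "norm D \<le> y (Suc n) - y n"
        using Suc by (simp add: D_def)
      then have "0 \<le> y (Suc n) - y n"
        using norm_ge_zero order_trans by blast
      then show ?thesis
        using mult_mono[OF Y_le[of "Suc n"] D_le] mult_mono[OF D_le Y_le[of n]] y_bounds by simp
    qed
    also have "\<dots> = y (Suc (Suc n)) - y (Suc n)"
      by (simp add: y_Suc[of "Suc n"] y_Suc[of n] power2_eq_square field_simps)
    finally show ?case .
  qed
  have y_mono: "y m \<le> y n" if "m \<le> n" for m n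
  proof (rule lift_Suc_mono_le[OF _ that])
    show "y k \<le> y (Suc k)" for k
      using order_trans[OF norm_ge_zero incr[of k]] by simp
  qed
  have incrs: "norm (Y n - Y m) \<le> y n - y m" if "m \<le> n" for m n
    using that
  proof (induction rule: dec_induct)
    case (step n)
    have "norm (Y (Suc n) - Y m) \<le> norm (Y (Suc n) - Y n) + norm (Y n - Y m)"
      using norm_triangle_ineq[of "Y (Suc n) - Y n" "Y n - Y m"] by simp
    then show ?case
      using step incr[of n] by linarith
  qed simp
  have "convergent Y"
  proof (rule convergent_if_increments_dominated)
    show "convergent y"
      using y_bounds y_mono by (intro Bseq_mono_convergent BseqI'[of _ 1]) (auto simp: abs_le_iff)
    fix m n :: nat assume "m \<le> n"
    have "(norm (Y n - Y m))\<^sup>2 \<le> (y n - y m)\<^sup>2"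
      using incrs[OF \<open>m \<le> n\<close>] by (simp add: power_mono)
    also have "\<dots> \<le> y n - y m"
      using y_bounds[of n] y_bounds[of m] y_mono[OF \<open>m \<le> n\<close>]
      by (simp add: power2_eq_square mult_left_le)
    finally show "(norm (Y n - Y m))\<^sup>2 \<le> \<bar>y n - y m\<bar>"
      by simp
  qed
  then obtain Z where Z: "Y \<longlonglongrightarrow> Z"
    by (auto simp: convergent_def)
  have lim: "(\<lambda>n. Y n x) \<longlonglongrightarrow> Z x" for x
    using bounded_linear.tendsto[OF blinfun.bounded_linear_left Z] .
  have Y_sym: "inner (Y n x) z = inner x (Y n z)" for n x z
    by (induction n arbitrary: x z)
      (simp_all add: Y_def F_def sym blinfun.bilinear_simps inner_add_left inner_add_right)
  show ?thesis
  proof (rule that[of Z])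
    show "norm Z \<le> 1"
      using tendsto_norm[OF Z] by (rule LIMSEQ_le_const2) (simp add: order_trans[OF Y_le] y_bounds)
    have "(\<lambda>n. Y (Suc n)) \<longlonglongrightarrow> F Z"
      unfolding Y_Suc F_def
      by (rule tendsto_scaleR[OF tendsto_const tendsto_add[OF tendsto_const
            bounded_bilinear.tendsto[OF bounded_bilinear_blinfun_compose Z Z]]])
    then have "F Z = Z"
      by (rule LIMSEQ_unique[OF _ LIMSEQ_Suc[OF Z]])
    then have "F Z x = Z x" for x
      by simp
    then have "(1/2) *\<^sub>R (X x + Z (Z x)) = Z x" for x
      unfolding F_def blinfun.add_left blinfun.scaleR_left blinfun_apply_blinfun_compose .
    then have "2 *\<^sub>R ((1/2) *\<^sub>R (X x + Z (Z x))) = 2 *\<^sub>R Z x" for x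
      by (rule arg_cong)
    then show "2 *\<^sub>R Z x = X x + Z (Z x)" for x
      by simp
    show "inner (Z x) z = inner x (Z z)" for x z
      using tendsto_inner[OF lim[of x] tendsto_const[of z]] tendsto_inner[OF tendsto_const[of x] lim[of z]]
        LIMSEQ_unique by (simp add: Y_sym)
    show "B (Z x) = Z (B x)" if B: "bounded_linear B" and comm: "\<And>x. B (X x) = X (B x)" for B x
    proof -
      interpret B: bounded_linear B by (rule B)
      have "B (Y n x) = Y n (B x)" for n x
        by (induction n arbitrary: x)
          (simp_all add: Y_def F_def comm blinfun.bilinear_simps B.add B.scaleR B.zero)
      then show ?thesis
        using LIMSEQ_unique[OF B.tendsto[OF lim[of x]]] lim[of "B x"] by simp
    qed
  qed
qed

text \<open>\<open>P\<close> is the spectral projection of \<open>S\<close> for \<open>[0, \<infinity>)\<close>, obtained as the projection onto the kernel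
  of \<open>\<bar>S\<bar> - S\<close>, where \<open>\<bar>S\<bar>\<close> is the square root of \<open>S\<^sup>2\<close>. As \<open>(\<bar>S\<bar> - S) (\<bar>S\<bar> + S) = 0\<close>, \<open>\<bar>S\<bar> = - S\<close>
  on the complement of that kernel.\<close>

lemma sign_projection_exists:
  fixes S :: "'a::{real_inner, banach} \<Rightarrow> 'a"
  assumes S: "bounded_linear S" and sym: "\<And>x y. inner (S x) y = inner x (S y)"
  obtains P where "\<And>x. P (P x) = P x" "\<And>x y. inner (P x) y = inner x (P y)"
    "\<And>x. 0 \<le> inner (S (P x)) (P x)"
    "\<And>x. P x \<noteq> x \<Longrightarrow> inner (S (x - P x)) (x - P x) < 0"
    "\<And>B B' x. bounded_linear B \<Longrightarrow> (\<And>x y. inner (B x) y = inner x (B' y)) \<Longrightarrow>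
       (\<And>x. B (S x) = S (B x)) \<Longrightarrow> B (P x) = P (B x)"
proof -
  interpret S: bounded_linear S by (rule S)
  \<comment> \<open>\<open>T\<close> is \<open>S\<close> normalised to a contraction; with \<open>X = 1 - T\<^sup>2\<close> the square root \<open>R = 1 - Y\<close> of \<open>1 - X\<close>
    is \<open>\<bar>T\<bar>\<close>. The summand \<open>1\<close> in \<open>c\<close> covers the case \<open>S = 0\<close>.\<close>
  define c where "c = onorm S + 1"
  have c: "0 < c"
    using onorm_pos_le[OF S] by (simp add: c_def)
  define T where "T x = (1/c) *\<^sub>R S x" for x
  have S_T: "S x = c *\<^sub>R T x" for x
    using c by (simp add: T_def)
  have T: "bounded_linear T"
    unfolding T_def using S by (rule bounded_linear_const_scaleR)
  interpret T: bounded_linear T by (rule T)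
  have T_sym: "inner (T x) y = inner x (T y)" for x y
    by (simp add: T_def sym)
  have T_le: "norm (T x) \<le> norm x" for x
  proof -
    have "norm (S x) \<le> onorm S * norm x"
      using onorm[OF S] .
    also have "\<dots> \<le> c * norm x"
      by (simp add: c_def mult_right_mono)
    finally show ?thesis
      using c by (simp add: T_def field_simps)
  qed
  define X where "X = Blinfun (\<lambda>x. x - T (T x))"
  have X: "X x = x - T (T x)" for x
    unfolding X_def
    by (subst bounded_linear_Blinfun_apply)
      (auto intro!: bounded_linear_sub bounded_linear_ident bounded_linear_compose[OF T] T)
  have "norm X \<le> 1"
  proof (rule norm_blinfun_bound)
    fix x
    have "(norm (X x))\<^sup>2 = (norm x)\<^sup>2 - 2 * (norm (T x))\<^sup>2 + (norm (T (T x)))\<^sup>2"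
      by (simp add: X power2_norm_eq_inner inner_diff_left inner_diff_right T_sym inner_commute)
    also have "\<dots> \<le> (norm x)\<^sup>2"
      using power_mono[OF T_le[of "T x"] norm_ge_zero, of 2] zero_le_power2[of "norm (T x)"]
      by linarith
    finally show "norm (X x) \<le> 1 * norm x"
      by (simp add: power2_le_iff_abs_le)
  qed simp
  moreover have "inner (X x) y = inner x (X y)" for x y
    by (simp add: X inner_diff_left inner_diff_right T_sym)
  ultimately obtain Y :: "'a \<Rightarrow>\<^sub>L 'a" where Y_norm: "norm Y \<le> 1"
    and Y_eq: "\<And>x. 2 *\<^sub>R Y x = X x + Y (Y x)" and Y_sym: "\<And>x y. inner (Y x) y = inner x (Y y)"
    and Y_comm: "\<And>B x. bounded_linear B \<Longrightarrow> (\<And>x. B (X x) = X (B x)) \<Longrightarrow> B (Y x) = Y (B x)"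
    using contraction_quadratic_solution by blast
  define R where "R x = x - Y x" for x
  have R_R: "R (R x) = T (T x)" for x
    using Y_eq[of x] by (simp add: R_def X blinfun.diff_right scaleR_2 algebra_simps)
  have R_T: "T (R x) = R (T x)" for x
    using Y_comm[OF T, of x] by (simp add: X R_def T.diff)
  have R_sym: "inner (R x) y = inner x (R y)" for x y
    by (simp add: R_def inner_diff_left inner_diff_right Y_sym)
  have R_lin: "R (x + y) = R x + R y" "R (x - y) = R x - R y" "R (r *\<^sub>R x) = r *\<^sub>R R x" "R 0 = 0" for x y r
    by (simp_all add: R_def blinfun.bilinear_simps algebra_simps)
  have Y_le: "norm (Y x) \<le> norm x" for x
    using norm_blinfun[of Y x] Y_norm by (meson mult_left_le_one_le norm_ge_zero order_trans)
  have R_pos: "0 \<le> inner (R x) x" for x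
  proof -
    have "inner (Y x) x \<le> norm (Y x) * norm x"
      by (rule norm_cauchy_schwarz)
    also have "\<dots> \<le> norm x * norm x"
      using Y_le by (simp add: mult_right_mono)
    finally show ?thesis
      by (simp add: R_def inner_diff_left power2_norm_eq_inner[symmetric] power2_eq_square)
  qed
  have R_zero: "R x = 0" if "inner (R x) x = 0" for x
  proof -
    have "(norm (R x))\<^sup>2 = (norm (Y x))\<^sup>2 - (norm x)\<^sup>2 + 2 * inner (R x) x"
      by (simp add: R_def power2_norm_eq_inner inner_diff_left inner_diff_right inner_commute)
    also have "\<dots> \<le> 0"
      using that power_mono[OF Y_le[of x], of 2] by simp
    finally show ?thesis
      by simp
  qed
  define M where "M = {x. R x = T x}"
  have M: "subspace M"
    by (rule subspaceI) (auto simp: M_def R_lin T.zero T.add T.scaleR)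
  have "closed M"
    unfolding M_def R_def
    by (intro closed_Collect_eq continuous_intros T.continuous_on blinfun.continuous_on)
  then obtain P where P_M: "\<And>x. P x \<in> M" and P_orth: "\<And>x g. g \<in> M \<Longrightarrow> inner (x - P x) g = 0"
    using orthogonal_projection_exists[OF M] by blast
  have P_unique: "P x = u" if u: "u \<in> M" and orth: "\<And>g. g \<in> M \<Longrightarrow> inner (x - u) g = 0" for x u
  proof -
    have d: "P x - u \<in> M"
      using M P_M u by (simp add: subspace_diff)
    have "inner (P x - u) (P x - u) = inner (x - u) (P x - u) - inner (x - P x) (P x - u)"
      by (simp add: inner_diff_left)
    then show ?thesis
      using orth[OF d] P_orth[OF d] by simp
  qed
  have neg: "R x = - T x" if "\<And>g. g \<in> M \<Longrightarrow> inner x g = 0" for x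
  proof -
    have "R y + T y \<in> M" for y
      by (simp add: M_def R_lin T.add R_R R_T add.commute)
    then have "inner (R x + T x) y = 0" for y
      using that[of "R y + T y"] by (simp add: inner_add_left inner_add_right R_sym T_sym)
    then have "R x + T x = 0"
      by (metis inner_eq_zero_iff)
    then show ?thesis
      by (simp add: eq_neg_iff_add_eq_0)
  qed
  show ?thesis
  proof (rule that[of P])
    show "P (P x) = P x" for x
      by (rule P_unique) (simp_all add: P_M)
    show "inner (P x) y = inner x (P y)" for x y
    proof -
      have "inner x (P y) = inner (P x) (P y)" "inner y (P x) = inner (P y) (P x)"
        using P_orth[OF P_M[of y], of x] P_orth[OF P_M[of x], of y] by (simp_all add: inner_diff_left)
      then show ?thesis
        by (metis inner_commute)
    qed
    show "0 \<le> inner (S (P x)) (P x)" for x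
      using P_M[of x] R_pos[of "P x"] c by (simp add: S_T M_def)
    show "inner (S (x - P x)) (x - P x) < 0" if "P x \<noteq> x" for x
    proof -
      let ?y = "x - P x"
      have T_y: "T ?y = - R ?y"
        using neg[OF P_orth, of x] by simp
      have "inner (R ?y) ?y \<noteq> 0"
      proof
        assume "inner (R ?y) ?y = 0"
        then have "R ?y = 0"
          by (rule R_zero)
        then have "?y \<in> M"
          using T_y by (simp add: M_def)
        from P_orth[OF this, of x] show False
          using that by simp
      qed
      then show ?thesis
        using R_pos[of ?y] c by (simp add: S_T T_y mult_pos_pos)
    qed
    fix B B' :: "'a \<Rightarrow> 'a" and x
    assume B: "bounded_linear B" and adj: "\<And>x y. inner (B x) y = inner x (B' y)"
      and comm: "\<And>x. B (S x) = S (B x)"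
    interpret B: bounded_linear B by (rule B)
    have B_T: "B (T x) = T (B x)" for x
      by (simp add: T_def B.scaleR comm)
    have B_R: "B (R x) = R (B x)" for x
      using Y_comm[OF B, of x] by (simp add: X R_def B.diff B_T)
    have "inner y (B' (T x)) = inner y (T (B' x))" "inner y (B' (R x)) = inner y (R (B' x))" for x y
      by (simp_all add: adj[symmetric] T_sym[symmetric] R_sym[symmetric] B_T B_R)
    then have "B' (T x) = T (B' x)" "B' (R x) = R (B' x)" for x
      by (metis vector_eq_ldot)+
    then have B'_M: "B' g \<in> M" if "g \<in> M" for g
      using that unfolding M_def by simp metis
    show "B (P x) = P (B x)"
    proof (rule P_unique[symmetric])
      show "B (P x) \<in> M"
        using P_M[of x] by (simp add: M_def B_T[symmetric] B_R[symmetric])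
      show "inner (B x - B (P x)) g = 0" if "g \<in> M" for g
        using P_orth[OF B'_M[OF that], of x] by (simp add: B.diff[symmetric] adj)
    qed
  qed
qed

lemma symmetric_idempotent_bounded_linear:
  fixes P :: "'a::real_inner \<Rightarrow> 'a"
  assumes idem: "\<And>x. P (P x) = P x" and sym: "\<And>x y. inner (P x) y = inner x (P y)"
  shows "bounded_linear P"
proof (rule bounded_linear_intro[of _ 1])
  show "P (x + y) = P x + P y" for x y
    by (rule vector_eq_ldot[THEN iffD1]) (simp add: sym[symmetric] inner_add_right)
  show "P (r *\<^sub>R x) = r *\<^sub>R P x" for r x
    by (rule vector_eq_ldot[THEN iffD1]) (simp add: sym[symmetric])
  show "norm (P x) \<le> norm x * 1" for x
  proof (cases "P x = 0")
    case False
    have "norm (P x) * norm (P x) = inner x (P x)"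
      using sym[of x "P x"] by (simp add: idem power2_norm_eq_inner[symmetric] power2_eq_square)
    also have "\<dots> \<le> norm x * norm (P x)"
      by (rule norm_cauchy_schwarz)
    finally show ?thesis
      using False by simp
  qed simp
qed

text \<open>\<open>E t\<close> is the spectral projection of \<open>A\<close> for \<open>[1 / t, \<infinity>)\<close>, that is, of the inverse of \<open>A\<close> for
  \<open>(0, t]\<close>. As \<open>A \<ge> 1 / t\<close> on the range of \<open>E t\<close> and \<open>A < 1 / t\<close> on its complement, and all these
  projections commute, the ranges are nested. The limits exist by monotonicity; the same two
  bounds identify the limit from the right, and the strict positivity of \<open>A\<close> the limit at \<open>\<infinity>\<close>.\<close>

lemma spectral_family_of_inverse_exists:
  fixes A :: "'h::chilbert_space \<Rightarrow> 'h"
  assumes A: "bounded_linear A" and sym: "\<And>x y. cinner (A x) y = cinner x (A y)"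
    and pos: "\<And>x. x \<noteq> 0 \<Longrightarrow> 0 < inner (A x) x"
  obtains E c where "spectral_family E" "\<And>t f. A (E t f) = E t (A f)"
    "\<And>t f. 0 < t \<Longrightarrow> (norm (E t f))\<^sup>2 \<le> t * inner (A (E t f)) (E t f)"
    "\<And>t f. 0 < t \<Longrightarrow> t * inner (A (f - E t f)) (f - E t f) \<le> (norm (f - E t f))\<^sup>2"
    "0 < c" "\<And>t f. t \<le> c \<Longrightarrow> E t f = 0"
proof -
  interpret A: bounded_linear A by (rule A)
  have A_sym: "inner (A x) y = inner x (A y)" for x y
    by (simp add: inner_eq_Re_cinner sym)
  have A_scaleC: "A (a *\<^sub>C x) = a *\<^sub>C A x" for a x
    by (rule cinner_ext) (simp add: sym cinner_scaleC_left)
  have "\<exists>P. (\<forall>x. P (P x) = P x) \<and> (\<forall>x y. inner (P x) y = inner x (P y)) \<and>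
      (\<forall>x. s * (norm (P x))\<^sup>2 \<le> inner (A (P x)) (P x)) \<and>
      (\<forall>x. P x \<noteq> x \<longrightarrow> inner (A (x - P x)) (x - P x) < s * (norm (x - P x))\<^sup>2) \<and>
      (\<forall>B B'. bounded_linear B \<longrightarrow> (\<forall>x y. inner (B x) y = inner x (B' y)) \<longrightarrow>
         (\<forall>x. B (A x) = A (B x)) \<longrightarrow> (\<forall>x. B (P x) = P (B x)))" for s
  proof -
    define S where "S x = A x - s *\<^sub>R x" for x
    have S: "bounded_linear S"
      unfolding S_def
      by (intro bounded_linear_sub A bounded_linear_const_scaleR bounded_linear_ident)
    have S_sym: "inner (S x) y = inner x (S y)" for x y
      by (simp add: S_def inner_diff_left inner_diff_right A_sym)
    have S_comm: "B (S x) = S (B x)" if "bounded_linear B" "\<And>x. B (A x) = A (B x)" for B x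
    proof -
      interpret B: bounded_linear B by (rule that)
      show ?thesis
        by (simp add: S_def B.diff B.scaleR that(2))
    qed
    have S_inner: "inner (S x) x = inner (A x) x - s * (norm x)\<^sup>2" for x
      by (simp add: S_def inner_diff_left power2_norm_eq_inner)
    obtain P where P: "\<And>x. P (P x) = P x" "\<And>x y. inner (P x) y = inner x (P y)"
      "\<And>x. 0 \<le> inner (S (P x)) (P x)"
      "\<And>x. P x \<noteq> x \<Longrightarrow> inner (S (x - P x)) (x - P x) < 0"
      "\<And>B B' x. bounded_linear B \<Longrightarrow> (\<And>x y. inner (B x) y = inner x (B' y)) \<Longrightarrow>
         (\<And>x. B (S x) = S (B x)) \<Longrightarrow> B (P x) = P (B x)"
      using sign_projection_exists[OF S S_sym] by blast
    show ?thesis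
    proof (intro exI[of _ P] conjI allI impI)
      fix B B' :: "'h \<Rightarrow> 'h" and x
      assume "bounded_linear B" "\<forall>x y. inner (B x) y = inner x (B' y)" "\<forall>x. B (A x) = A (B x)"
      then show "B (P x) = P (B x)"
        by (intro P(5)[of B B'] S_comm) auto
    qed (use P(1,2,3,4) in \<open>auto simp: S_inner\<close>)
  qed
  then obtain G where idem: "\<And>s x. G s (G s x) = G s x"
    and G_sym: "\<And>s x y. inner (G s x) y = inner x (G s y)"
    and G_ge: "\<And>s x. s * (norm (G s x))\<^sup>2 \<le> inner (A (G s x)) (G s x)"
    and G_less: "\<And>s x. G s x \<noteq> x \<Longrightarrow> inner (A (x - G s x)) (x - G s x) < s * (norm (x - G s x))\<^sup>2"
    and G_comm: "\<And>s B B' x. bounded_linear B \<Longrightarrow> (\<forall>x y. inner (B x) y = inner x (B' y)) \<Longrightarrow>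
         (\<forall>x. B (A x) = A (B x)) \<Longrightarrow> B (G s x) = G s (B x)"
    by metis
  have G: "bounded_linear (G s)" for s
    by (rule symmetric_idempotent_bounded_linear) (simp_all add: idem G_sym)
  have G_diff: "G s (x - y) = G s x - G s y" for s x y
    by (rule linear_diff[OF bounded_linear.linear[OF G]])
  have G_A: "A (G s x) = G s (A x)" for s x
    by (rule G_comm[OF A]) (auto simp: A_sym)
  have G_G: "G r (G s x) = G s (G r x)" for r s x
    by (rule G_comm[OF G]) (auto simp: G_sym G_A)
  have G_i: "\<i> *\<^sub>C G s x = G s (\<i> *\<^sub>C x)" for s x
  proof (rule G_comm[OF bounded_linear_scaleC, where B'="\<lambda>y. (- \<i>) *\<^sub>C y"], safe)
    show "inner (\<i> *\<^sub>C x) y = inner x ((- \<i>) *\<^sub>C y)" for x y :: 'h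
      by (simp add: inner_eq_Re_cinner cinner_scaleC_left cinner_scaleC_right)
  qed (simp add: A_scaleC)
  have G_csym: "cinner (G s x) y = cinner x (G s y)" for s x y
  proof (rule complex_eqI)
    show "Re (cinner (G s x) y) = Re (cinner x (G s y))"
      using G_sym[of s x y] by (simp add: inner_eq_Re_cinner)
    show "Im (cinner (G s x) y) = Im (cinner x (G s y))"
      using G_sym[of s x "\<i> *\<^sub>C y"] by (simp add: Im_cinner G_i)
  qed
  have G_mono: "G a (G b x) = G b x" if "a \<le> b" for a b x
  proof (rule ccontr)
    assume ne: "G a (G b x) \<noteq> G b x"
    define y where "y = G b x - G a (G b x)"
    have "inner (A y) y < a * (norm y)\<^sup>2"
      using G_less[OF ne] by (simp add: y_def)
    also have "\<dots> \<le> b * (norm y)\<^sup>2"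
      using that by (simp add: mult_right_mono)
    also have "G b y = y"
      by (simp add: y_def G_diff idem G_G[of b a])
    then have "b * (norm y)\<^sup>2 \<le> inner (A y) y"
      using G_ge[of b y] by simp
    finally show False
      by simp
  qed
  define E where "E t f = (if t \<le> 0 then 0 else G (1 / t) f)" for t f
  have E_pos: "E t f = G (1 / t) f" if "0 < t" for t f
    using that by (simp add: E_def)
  have orth: "orth_projection (E t)" for t
    by (auto simp: orth_projection_def E_def idem G_csym)
  have E_comp: "E s (E t f) = E (min s t) f" for s t f
  proof (cases "s \<le> 0 \<or> t \<le> 0")
    case True
    then show ?thesis
      using linear_0[OF bounded_linear.linear[OF G]] by (auto simp: E_def min_def)
  next
    case False
    then have "G (1 / s) (G (1 / t) f) = G (1 / min s t) f"
      using G_mono[of "1 / s" "1 / t" f] G_mono[of "1 / t" "1 / s" f] G_G[of "1 / s" "1 / t" f]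
      by (auto simp: min_def frac_le)
    then show ?thesis
      using False by (simp add: E_def min_def)
  qed
  have E_sym: "inner (E t x) y = inner x (E t y)" for t x y
    by (auto simp: E_def G_sym)
  have E_lin: "bounded_linear (E t)" for t
    by (rule symmetric_idempotent_bounded_linear) (simp_all add: E_comp E_sym)
  have E_diff: "E t (x - y) = E t x - E t y" for t x y
    by (rule linear_diff[OF bounded_linear.linear[OF E_lin]])
  have E_A: "A (E t f) = E t (A f)" for t f
    by (simp add: E_def G_A A.zero)
  have E_dist: "(norm (E t f - E s f))\<^sup>2 = (norm (E t f))\<^sup>2 - (norm (E s f))\<^sup>2" if "s \<le> t" for s t f
  proof -
    have "inner (E t f) (E s f) = (norm (E s f))\<^sup>2"
      using E_sym[of s f "E t f"] E_sym[of s f "E s f"] that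
      by (simp add: E_comp min_def power2_norm_eq_inner inner_commute)
    then show ?thesis
      by (simp add: power2_norm_eq_inner inner_diff_left inner_diff_right inner_commute)
  qed
  have E_norm_mono: "(norm (E s f))\<^sup>2 \<le> (norm (E t f))\<^sup>2" if "s \<le> t" for s t f
    using E_dist[OF that, of f] zero_le_power2[of "norm (E t f - E s f)"] by linarith
  have E_norm_le: "norm (E t f) \<le> norm f" for t f
  proof (cases "E t f = 0")
    case False
    have "norm (E t f) * norm (E t f) \<le> norm f * norm (E t f)"
      using norm_cauchy_schwarz[of f "E t f"] E_sym[of t f "E t f"]
      by (simp add: E_comp power2_norm_eq_inner[symmetric] power2_eq_square)
    then show ?thesis
      using False by (simp add: mult_right_le_imp_le)
  qed simp
  have E_upper: "(norm (E t f))\<^sup>2 \<le> t * inner (A (E t f)) (E t f)" if "0 < t" for t f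
    using G_ge[of "1 / t" f] that by (simp add: E_pos field_simps)
  have E_lower: "t * inner (A (f - E t f)) (f - E t f) \<le> (norm (f - E t f))\<^sup>2" if "0 < t" for t f
    using G_less[of "1 / t" f] that by (cases "E t f = f") (auto simp: E_pos field_simps A.zero)
  have seq_lim: "\<exists>g. (\<lambda>n. E (S n) f) \<longlonglongrightarrow> g" if "monoseq S" for S f
  proof -
    have mono: "monoseq (\<lambda>n. (norm (E (S n) f))\<^sup>2)"
      using that E_norm_mono by (auto simp: monoseq_def)
    have "(norm (E (S n) f))\<^sup>2 \<le> (norm f)\<^sup>2" for n
      using E_norm_le by (simp add: power_mono)
    then have "convergent (\<lambda>n. (norm (E (S n) f))\<^sup>2)"
      by (intro Bseq_monoseq_convergent mono BseqI'[of _ "(norm f)\<^sup>2"]) simp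
    then have "convergent (\<lambda>n. E (S n) f)"
    proof (rule convergent_if_increments_dominated)
      show "(norm (E (S n) f - E (S m) f))\<^sup>2 \<le> \<bar>(norm (E (S n) f))\<^sup>2 - (norm (E (S m) f))\<^sup>2\<bar>" for m n
        using E_dist[of "S m" "S n" f] E_dist[of "S n" "S m" f]
        by (cases "S m \<le> S n") (auto simp: norm_minus_commute)
    qed
    then show ?thesis
      by (auto simp: convergent_def)
  qed
  \<comment> \<open>The projection of \<open>A\<close> for \<open>[1 / t, \<infinity>)\<close> vanishes as soon as \<open>1 / t\<close> exceeds the norm of \<open>A\<close>.\<close>
  define c where "c = 1 / (onorm A + 1)"
  have c: "0 < c"
    using onorm_pos_le[OF A] by (simp add: c_def)
  have E_zero: "E t f = 0" if "t \<le> c" for t f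
  proof (cases "0 < t")
    case True
    define y where "y = E t f"
    have "(norm y)\<^sup>2 \<le> t * inner (A y) y"
      using E_upper[OF True] by (simp add: y_def)
    also have "\<dots> \<le> t * (onorm A * (norm y)\<^sup>2)"
      using norm_cauchy_schwarz[of "A y" y] mult_right_mono[OF onorm[OF A, of y], of "norm y"] True
      by (intro mult_left_mono) (auto simp: power2_eq_square mult.assoc)
    also have "\<dots> \<le> c * (onorm A * (norm y)\<^sup>2)"
      using that onorm_pos_le[OF A] by (intro mult_right_mono) auto
    finally have "(norm y)\<^sup>2 \<le> 0"
      using onorm_pos_le[OF A] by (simp add: c_def field_simps)
    then show ?thesis
      by (simp add: y_def)
  qed (simp add: E_def)
  have right: "((\<lambda>t. E t f) \<longlongrightarrow> E s f) (at_right s)" for s f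
  proof (cases "s < c")
    case True
    then have "eventually (\<lambda>t. E t f = E s f) (at_right s)"
      by (auto simp: eventually_at_right_field E_zero intro!: exI[of _ c])
    then show ?thesis
      by (rule tendsto_eventually)
  next
    case False
    then have s: "0 < s"
      using c by simp
    show ?thesis
    proof (rule tendsto_at_right_sequentially)
      show "s < s + 1" by simp
      fix S assume S: "\<And>n. s < S n" "decseq S" "S \<longlonglongrightarrow> s"
      then obtain g where g: "(\<lambda>n. E (S n) f) \<longlonglongrightarrow> g"
        using seq_lim[of S f] by (auto simp: monoseq_iff)
      \<comment> \<open>The limit \<open>g\<close> has no component above \<open>s\<close>: there \<open>A < 1 / s\<close> strictly, while \<open>A \<ge> 1 / S n\<close> on \<open>g\<close>.\<close>
      have g_E: "E (S n) g = g" for n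
      proof -
        have "(\<lambda>k. E (S n) (E (S k) f)) \<longlonglongrightarrow> E (S n) g"
          by (rule bounded_linear.tendsto[OF E_lin g])
        moreover have "eventually (\<lambda>k. E (S n) (E (S k) f) = E (S k) f) sequentially"
          using S(2) by (auto simp: eventually_sequentially E_comp decseq_def min_absorb2 intro!: exI[of _ n])
        ultimately have "(\<lambda>k. E (S k) f) \<longlonglongrightarrow> E (S n) g"
          by (simp add: tendsto_cong)
        then show ?thesis
          using g LIMSEQ_unique by blast
      qed
      have E_g: "E s g = E s f"
      proof -
        have "(\<lambda>k. E s (E (S k) f)) \<longlonglongrightarrow> E s g"
          by (rule bounded_linear.tendsto[OF E_lin g])
        moreover have "E s (E (S k) f) = E s f" for k
          using S(1)[of k] by (simp add: E_comp min_def)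
        ultimately show ?thesis
          by (simp add: LIMSEQ_const_iff)
      qed
      have "E s g = g"
      proof (rule ccontr)
        assume ne: "E s g \<noteq> g"
        define y where "y = g - E s g"
        have lt: "s * inner (A y) y < (norm y)\<^sup>2"
          using G_less[of "1 / s" g] ne s by (simp add: E_pos y_def field_simps)
        have "E (S n) y = y" for n
          using S(1)[of n] by (simp add: y_def E_diff g_E E_comp min_def)
        then have "(norm y)\<^sup>2 \<le> S n * inner (A y) y" for n
          using E_upper[of "S n" y] S(1)[of n] s by simp
        moreover have "(\<lambda>n. S n * inner (A y) y) \<longlonglongrightarrow> s * inner (A y) y"
          using S(3) by (intro tendsto_intros)
        ultimately have "(norm y)\<^sup>2 \<le> s * inner (A y) y"
          by (intro LIMSEQ_le_const) auto
        then show False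
          using lt by simp
      qed
      then show "(\<lambda>n. E (S n) f) \<longlonglongrightarrow> E s f"
        using g E_g by simp
    qed
  qed
  have top: "((\<lambda>t. E t f) \<longlongrightarrow> f) at_top" for f
  proof -
    obtain g where g: "(\<lambda>n. E (real n) f) \<longlonglongrightarrow> g"
      using seq_lim[of real f] by (auto simp: monoseq_def)
    define y where "y = f - g"
    have "E (real m) g = E (real m) f" for m
    proof -
      have "(\<lambda>k. E (real m) (E (real k) f)) \<longlonglongrightarrow> E (real m) g"
        by (rule bounded_linear.tendsto[OF E_lin g])
      moreover have "eventually (\<lambda>k. E (real m) (E (real k) f) = E (real m) f) sequentially"
        by (auto simp: eventually_sequentially E_comp min_def intro!: exI[of _ m])
      ultimately have "(\<lambda>k::nat. E (real m) f) \<longlonglongrightarrow> E (real m) g"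
        by (simp add: tendsto_cong)
      then show ?thesis
        by (simp add: LIMSEQ_const_iff)
    qed
    then have E_y: "E (real m) y = 0" for m
      by (simp add: y_def E_diff)
    have "inner (A y) y \<le> (norm y)\<^sup>2 / real (Suc m)" for m
      using E_lower[of "real (Suc m)" y] E_y[of "Suc m"] by (simp add: field_simps)
    moreover have "(\<lambda>m. (norm y)\<^sup>2 / real (Suc m)) \<longlonglongrightarrow> 0"
      using LIMSEQ_Suc[OF lim_const_over_n] by blast
    ultimately have "inner (A y) y \<le> 0"
      by (intro LIMSEQ_le_const) auto
    then have "y = 0"
      using pos[of y] by fastforce
    then have f: "(\<lambda>n. E (real n) f) \<longlonglongrightarrow> f"
      using g by (simp add: y_def)
    show ?thesis
    proof (rule tendstoI)
      fix e :: real assume "0 < e"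
      then obtain n where n: "dist (E (real n) f) f < e"
        using metric_LIMSEQ_D[OF f] by blast
      have "dist (E t f) f \<le> dist (E (real n) f) f" if "real n \<le> t" for t
      proof -
        have "inner (E (real n) f - E t f) (E t f - f) = 0"
        proof -
          have "E t (E (real n) f - E t f) = E (real n) f - E t f"
            using that by (simp add: E_diff E_comp min_def)
          then have "inner (E (real n) f - E t f) (E t f - f)
              = inner (E (real n) f - E t f) (E t (E t f - f))"
            by (metis E_sym)
          then show ?thesis
            by (simp add: E_diff E_comp)
        qed
        then have "(norm (E (real n) f - f))\<^sup>2 = (norm (E (real n) f - E t f))\<^sup>2 + (norm (E t f - f))\<^sup>2"
          using norm_add_Pythagorean[of "E (real n) f - E t f" "E t f - f"] by (simp add: orthogonal_def)
        then have "(norm (E t f - f))\<^sup>2 \<le> (norm (E (real n) f - f))\<^sup>2"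
          by simp
        then show ?thesis
          unfolding dist_norm by (rule power2_le_imp_le) simp
      qed
      then show "\<forall>\<^sub>F t in at_top. dist (E t f) f < e"
        unfolding eventually_at_top_linorder using n by (meson le_less_trans)
    qed
  qed
  have "((\<lambda>t. E t f) \<longlongrightarrow> 0) at_bot" for f
    by (rule tendsto_eventually) (auto simp: eventually_at_bot_linorder E_zero intro!: exI[of _ c])
  then have "spectral_family E"
    unfolding spectral_family_def using orth right top by (simp add: E_comp min_def)
  then show ?thesis
    using that[of E c] E_A E_upper E_lower c E_zero by blast
qed

section \<open>Integrals against signed combinations of measures\<close>

definition bounded_borel :: "(real \<Rightarrow> real) \<Rightarrow> bool" where
  "bounded_borel u \<longleftrightarrow> u \<in> borel_measurable borel \<and> (\<exists>K. \<forall>t. \<bar>u t\<bar> \<le> K)"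

lemma bounded_borelI: "u \<in> borel_measurable borel \<Longrightarrow> (\<And>t. \<bar>u t\<bar> \<le> K) \<Longrightarrow> bounded_borel u"
  by (auto simp: bounded_borel_def)

lemma bounded_borel_measurable: "bounded_borel u \<Longrightarrow> u \<in> borel_measurable borel"
  by (simp add: bounded_borel_def)

lemma bounded_borel_bound:
  assumes "bounded_borel u"
  obtains K where "0 \<le> K" "\<And>t. \<bar>u t\<bar> \<le> K"
proof -
  obtain K where K: "\<And>t. \<bar>u t\<bar> \<le> K"
    using assms by (auto simp: bounded_borel_def)
  show ?thesis
    by (rule that[OF order_trans[OF abs_ge_zero K] K])
qed

lemma bounded_borel_const: "bounded_borel (\<lambda>t. c)"
  by (rule bounded_borelI[of _ "\<bar>c\<bar>"]) auto

lemma bounded_borel_indicator: "A \<in> sets borel \<Longrightarrow> bounded_borel (indicator A)"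
  by (rule bounded_borelI[of _ 1]) (auto simp: indicator_def)

lemma bounded_borel_add:
  assumes "bounded_borel u" "bounded_borel v"
  shows "bounded_borel (\<lambda>t. u t + v t)"
proof -
  obtain K L where "\<And>t. \<bar>u t\<bar> \<le> K" "\<And>t. \<bar>v t\<bar> \<le> L"
    using assms by (auto simp: bounded_borel_def)
  then show ?thesis
    using assms[THEN bounded_borel_measurable]
    by (intro bounded_borelI[of _ "K + L"] borel_measurable_add) (auto intro: order_trans[OF abs_triangle_ineq add_mono])
qed

lemma bounded_borel_mult:
  assumes "bounded_borel u" "bounded_borel v"
  shows "bounded_borel (\<lambda>t. u t * v t)"
proof -
  obtain K where K: "0 \<le> K" "\<And>t. \<bar>u t\<bar> \<le> K"
    using bounded_borel_bound[OF assms(1)] by blast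
  obtain L where L: "0 \<le> L" "\<And>t. \<bar>v t\<bar> \<le> L"
    using bounded_borel_bound[OF assms(2)] by blast
  show ?thesis
    using assms[THEN bounded_borel_measurable] K L
    by (intro bounded_borelI[of _ "K * L"] borel_measurable_times) (auto simp: abs_mult intro!: mult_mono)
qed

lemma bounded_borel_cmult: "bounded_borel u \<Longrightarrow> bounded_borel (\<lambda>t. c * u t)"
  by (intro bounded_borel_mult bounded_borel_const)

lemma bounded_borel_diff: "bounded_borel u \<Longrightarrow> bounded_borel v \<Longrightarrow> bounded_borel (\<lambda>t. u t - v t)"
  using bounded_borel_add[OF _ bounded_borel_cmult[of v "-1"], of u] by simp

lemma bounded_borel_power2: "bounded_borel u \<Longrightarrow> bounded_borel (\<lambda>t. (u t)\<^sup>2)"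
  using bounded_borel_mult[of u u] by (simp add: power2_eq_square)

lemma bounded_borel_resolvent:
  assumes u: "u \<in> borel_measurable borel"
  shows "bounded_borel (\<lambda>t. 1 / (1 + \<bar>u t\<bar>))" "bounded_borel (\<lambda>t. u t / (1 + \<bar>u t\<bar>))"
proof -
  have pos: "0 < 1 + \<bar>u t\<bar>" for t
    by (rule add_pos_nonneg) simp_all
  have "\<bar>1 / (1 + \<bar>u t\<bar>)\<bar> \<le> 1" "\<bar>u t / (1 + \<bar>u t\<bar>)\<bar> \<le> 1" for t
    unfolding abs_divide abs_of_pos[OF pos] by (subst divide_le_eq_1_pos[OF pos]; simp)+
  then show "bounded_borel (\<lambda>t. 1 / (1 + \<bar>u t\<bar>))" "bounded_borel (\<lambda>t. u t / (1 + \<bar>u t\<bar>))"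
    using u by (auto intro!: bounded_borelI[of _ 1])
qed

definition finite_borel :: "real measure \<Rightarrow> bool" where
  "finite_borel M \<longleftrightarrow> finite_measure M \<and> sets M = sets borel"

lemma integrable_bounded_borel:
  assumes "finite_borel M" "bounded_borel u"
  shows "integrable M u"
proof -
  interpret finite_measure M
    using assms by (simp add: finite_borel_def)
  obtain K where K: "\<And>t. \<bar>u t\<bar> \<le> K"
    using assms by (auto simp: bounded_borel_def)
  show ?thesis
    using assms K
    by (intro integrable_const_bound[where B=K])
      (auto simp: finite_borel_def bounded_borel_def cong: measurable_cong_sets)
qed

text \<open>Complex measures enter as lists of finite measures with coefficients: the sum of two functionals
  is the concatenation of the lists.\<close>

definition combo :: "(complex \<times> real measure) list \<Rightarrow> (real \<Rightarrow> real) \<Rightarrow> complex" where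
  "combo xs u = (\<Sum>(c, M)\<leftarrow>xs. c * complex_of_real (\<integral>t. u t \<partial>M))"

definition finite_combo :: "(complex \<times> real measure) list \<Rightarrow> bool" where
  "finite_combo xs \<longleftrightarrow> (\<forall>(c, M)\<in>set xs. finite_borel M)"

definition scale_combo :: "complex \<Rightarrow> (complex \<times> real measure) list \<Rightarrow> (complex \<times> real measure) list" where
  "scale_combo a = map (\<lambda>(c, M). (a * c, M))"

definition density_combo :: "(real \<Rightarrow> real) \<Rightarrow> (complex \<times> real measure) list \<Rightarrow> (complex \<times> real measure) list" where
  "density_combo v = map (\<lambda>(c, M). (c, density M (\<lambda>t. ennreal (v t))))"

definition cnj_combo :: "(complex \<times> real measure) list \<Rightarrow> (complex \<times> real measure) list" where
  "cnj_combo = map (\<lambda>(c, M). (cnj c, M))"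

lemma combo_Nil [simp]: "combo [] u = 0"
  by (simp add: combo_def)

lemma combo_Cons [simp]: "combo ((c, M) # xs) u = c * complex_of_real (\<integral>t. u t \<partial>M) + combo xs u"
  by (simp add: combo_def)

lemma combo_zero [simp]: "combo xs (\<lambda>t. 0) = 0"
  by (induction xs) auto

lemma combo_append [simp]: "combo (xs @ ys) u = combo xs u + combo ys u"
  by (simp add: combo_def)

lemma finite_combo_Nil [simp]: "finite_combo []"
  by (simp add: finite_combo_def)

lemma finite_combo_Cons [simp]: "finite_combo ((c, M) # xs) \<longleftrightarrow> finite_borel M \<and> finite_combo xs"
  by (simp add: finite_combo_def)

lemma finite_combo_append [simp]: "finite_combo (xs @ ys) \<longleftrightarrow> finite_combo xs \<and> finite_combo ys"
  by (auto simp: finite_combo_def)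

lemma finite_combo_scale [simp]: "finite_combo (scale_combo a xs) \<longleftrightarrow> finite_combo xs"
  by (auto simp: finite_combo_def scale_combo_def)

lemma finite_combo_cnj [simp]: "finite_combo (cnj_combo xs) \<longleftrightarrow> finite_combo xs"
  by (auto simp: finite_combo_def cnj_combo_def)

lemma combo_scale [simp]: "combo (scale_combo a xs) u = a * combo xs u"
  by (induction xs) (auto simp: scale_combo_def algebra_simps)

lemma combo_cnj [simp]: "combo (cnj_combo xs) u = cnj (combo xs u)"
  by (induction xs) (auto simp: cnj_combo_def)

lemma finite_borel_density:
  assumes M: "finite_borel M" and v: "bounded_borel v"
  shows "finite_borel (density M (\<lambda>t. ennreal (v t)))"
proof -
  have "integrable M v"
    using assms by (rule integrable_bounded_borel)
  then have "(\<integral>\<^sup>+t. ennreal (norm (v t)) \<partial>M) < \<infinity>"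
    by (simp add: integrable_iff_bounded)
  then have "(\<integral>\<^sup>+t. ennreal (v t) \<partial>M) < \<infinity>"
    by (rule le_less_trans[rotated]) (intro nn_integral_mono ennreal_leI, simp)
  moreover have "v \<in> borel_measurable M"
    using assms by (simp add: finite_borel_def bounded_borel_def cong: measurable_cong_sets)
  then have "emeasure (density M (\<lambda>t. ennreal (v t))) (space M) = (\<integral>\<^sup>+t. ennreal (v t) \<partial>M)"
    by (subst emeasure_density) (auto intro!: nn_integral_cong)
  ultimately have "finite_measure (density M (\<lambda>t. ennreal (v t)))"
    by (intro finite_measureI) simp
  then show ?thesis
    using M by (simp add: finite_borel_def)
qed

lemma finite_combo_density: "finite_combo xs \<Longrightarrow> bounded_borel v \<Longrightarrow> finite_combo (density_combo v xs)"
  by (auto simp: finite_combo_def density_combo_def finite_borel_density)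

lemma combo_density:
  assumes "finite_combo xs" "u \<in> borel_measurable borel" "v \<in> borel_measurable borel" "\<And>t. 0 \<le> v t"
  shows "combo (density_combo v xs) u = combo xs (\<lambda>t. u t * v t)"
  using assms(1)
proof (induction xs)
  case (Cons x xs)
  obtain c M where x: "x = (c, M)" by force
  have "sets M = sets borel"
    using Cons by (simp add: x finite_borel_def)
  then have "(\<integral>t. u t \<partial>density M (\<lambda>t. ennreal (v t))) = (\<integral>t. u t * v t \<partial>M)"
    using assms(2-4)
    by (subst integral_density) (auto simp: mult.commute cong: measurable_cong_sets)
  then show ?case
    using Cons by (simp add: x density_combo_def)
qed (simp add: density_combo_def)

lemma combo_add:
  assumes "finite_combo xs" "bounded_borel u" "bounded_borel v"
  shows "combo xs (\<lambda>t. u t + v t) = combo xs u + combo xs v"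
  using assms(1) by (induction xs) (auto simp: integrable_bounded_borel assms(2,3) algebra_simps)

lemma combo_cmult: "combo xs (\<lambda>t. c * u t) = complex_of_real c * combo xs u"
  by (induction xs) (auto simp: algebra_simps)

lemma combo_bounded_convergence:
  assumes xs: "finite_combo xs"
    and U: "\<And>n. U n \<in> borel_measurable borel" "\<And>n t. \<bar>U n t\<bar> \<le> K"
    and lim: "\<And>t. (\<lambda>n. U n t) \<longlonglongrightarrow> u t"
  shows "(\<lambda>n. combo xs (U n)) \<longlonglongrightarrow> combo xs u"
  using xs
proof (induction xs)
  case (Cons x xs)
  obtain c M where x: "x = (c, M)" by force
  have M: "finite_borel M"
    using Cons by (simp add: x)
  have u: "u \<in> borel_measurable borel"
    using U(1) lim by (rule borel_measurable_LIMSEQ_real[rotated])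
  have "(\<lambda>n. \<integral>t. U n t \<partial>M) \<longlonglongrightarrow> (\<integral>t. u t \<partial>M)"
    using M U lim u integrable_bounded_borel[OF M bounded_borel_const[of K]]
    by (intro integral_dominated_convergence[where w="\<lambda>_. K"])
      (auto simp: finite_borel_def cong: measurable_cong_sets)
  then show ?case
    using Cons by (auto simp: x intro!: tendsto_intros)
qed simp

text \<open>The half-lines \<open>{..t}\<close> are an intersection-stable generator of the Borel sets; the Borel sets
  and then the bounded Borel functions on which the functional vanishes are reached by the usual
  induction.\<close>

lemma combo_vanishes:
  assumes xs: "finite_combo xs" and half_line: "\<And>t. combo xs (indicator {..t}) = 0"
    and u: "bounded_borel u"
  shows "combo xs u = 0"
proof -
  have UNIV: "combo xs (indicator UNIV) = 0"
  proof -
    have "(\<lambda>n. combo xs (indicator {..real n})) \<longlonglongrightarrow> combo xs (indicator UNIV)"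
    proof (rule combo_bounded_convergence[OF xs])
      show "(\<lambda>n. indicator {..real n} t :: real) \<longlonglongrightarrow> indicator UNIV t" for t
      proof (rule tendsto_eventually)
        obtain N :: nat where "t \<le> real N"
          using real_arch_simple by blast
        then show "\<forall>\<^sub>F n in sequentially. indicator {..real n} t = (indicator UNIV t :: real)"
          by (auto simp: eventually_sequentially indicator_def intro!: exI[of _ N])
      qed
      show "\<bar>indicator {..real n} t\<bar> \<le> (1::real)" for n t
        by (simp add: indicator_def)
    qed simp
    then show ?thesis
      by (simp add: half_line LIMSEQ_const_iff)
  qed
  have sets: "combo xs (indicator A) = 0" if "A \<in> sets borel" for A
  proof -
    have gen: "sets (borel :: real measure) = sigma_sets UNIV (range atMost)"
      by (simp add: borel_eq_atMost)
    have "Int_stable (range (atMost :: real \<Rightarrow> real set))"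
      by (auto simp: Int_stable_def)
    moreover have "range (atMost :: real \<Rightarrow> real set) \<subseteq> Pow UNIV"
      by simp
    moreover have "A \<in> sigma_sets UNIV (range atMost)"
      using that gen by simp
    ultimately show ?thesis
    proof (induction rule: sigma_sets_induct_disjoint)
      case (basic A)
      then show ?case using half_line by auto
    next
      case empty
      then show ?case by simp
    next
      case (compl A)
      then have A: "A \<in> sets borel" using gen by simp
      have "indicator (UNIV - A) = (\<lambda>t. indicator UNIV t + (- 1) * indicator A t :: real)"
        by (auto simp: indicator_def)
      then have "combo xs (indicator (UNIV - A)) = combo xs (indicator UNIV) + combo xs (\<lambda>t. (-1) * indicator A t)"
        using combo_add[OF xs bounded_borel_indicator bounded_borel_cmult[OF bounded_borel_indicator[OF A]], of UNIV "-1"]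
        by simp
      then show ?case
        using compl UNIV combo_cmult[of xs "-1" "indicator A"] by simp
    next
      case (union A)
      have A: "A i \<in> sets borel" for i
        using union(2) gen by auto
      have "combo xs (indicator (\<Union>i<n. A i)) = 0" for n
      proof (induction n)
        case 0
        then show ?case by simp
      next
        case (Suc n)
        have "A i \<inter> A n = {}" if "i < n" for i
          using disjoint_family_onD[OF union(1), of i n] that by simp
        then have "indicator (\<Union>i<Suc n. A i) t = (indicator (\<Union>i<n. A i) t + indicator (A n) t :: real)" for t
          unfolding lessThan_Suc UN_insert Un_commute[of "A n"]
          by (subst indicator_disj_union[symmetric]) auto
        then have "indicator (\<Union>i<Suc n. A i) = (\<lambda>t. indicator (\<Union>i<n. A i) t + indicator (A n) t :: real)"
          by (rule ext)
        moreover have "combo xs (\<lambda>t. indicator (\<Union>i<n. A i) t + indicator (A n) t)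
            = combo xs (indicator (\<Union>i<n. A i)) + combo xs (indicator (A n))"
          using A by (intro combo_add xs bounded_borel_indicator) auto
        ultimately show ?case
          using Suc union(3)[of n] by simp
      qed
      moreover have "(\<lambda>n. combo xs (indicator (\<Union>i<n. A i))) \<longlonglongrightarrow> combo xs (indicator (\<Union>i. A i))"
        using A by (intro combo_bounded_convergence[OF xs, of _ 1] LIMSEQ_indicator_UN) (auto simp: indicator_def)
      ultimately show ?case
        by (simp add: LIMSEQ_const_iff)
    qed
  qed
  have nonneg: "combo xs u = 0" if "u \<in> borel_measurable borel" "\<And>t. 0 \<le> u t" "\<exists>K. \<forall>t. u t \<le> K" for u
    using that
  proof (induction rule: borel_measurable_induct_real)
    case (set A)
    then show ?case using sets by simp
  next
    case (mult u c)
    show ?case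
    proof (cases "c = 0")
      case False
      with mult obtain K where "\<forall>t. c * u t \<le> K" by auto
      then have "\<forall>t. u t \<le> K / c"
        using False mult by (simp add: field_simps)
      then show ?thesis
        using mult by (simp add: combo_cmult) blast
    qed (simp add: combo_cmult)
  next
    case (add u v)
    then obtain K where "\<forall>t. v t + u t \<le> K" by auto
    moreover have "u t \<le> v t + u t" "v t \<le> v t + u t" for t
      using add by simp_all
    ultimately have K: "\<forall>t. u t \<le> K" "\<forall>t. v t \<le> K"
      using order_trans by blast+
    then have "bounded_borel u" "bounded_borel v"
      using add by (auto simp: bounded_borel_def)
    moreover have "combo xs u = 0" "combo xs v = 0"
      using add K by blast+
    ultimately show ?case
      by (simp add: combo_add[OF xs])
  next
    case (seq U)
    then obtain K where K: "\<And>t. u t \<le> K" by auto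
    have U_le: "U i t \<le> u t" for i t
      using seq by (intro incseq_le[of "\<lambda>i. U i t"]) (auto simp: incseq_def le_fun_def)
    then have "combo xs (U i) = 0" for i
      using seq.IH[of i] order_trans[OF U_le K] by blast
    moreover have "(\<lambda>i. combo xs (U i)) \<longlonglongrightarrow> combo xs u"
    proof (rule combo_bounded_convergence[OF xs])
      show "\<bar>U i t\<bar> \<le> K" for i t
        using seq.hyps(2)[of i t] order_trans[OF U_le K] by simp
    qed (use seq in auto)
    ultimately show ?case
      by (simp add: LIMSEQ_const_iff)
  qed
  obtain K where K: "0 \<le> K" "\<And>t. \<bar>u t\<bar> \<le> K"
    using bounded_borel_bound[OF u] by blast
  have bb: "bounded_borel (\<lambda>t. u t + K)"
    using u by (intro bounded_borel_add bounded_borel_const)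
  have "combo xs (\<lambda>t. u t + K) = 0"
  proof (rule nonneg)
    show "0 \<le> u t + K" for t
      using K(2)[of t] by simp
    show "\<exists>L. \<forall>t. u t + K \<le> L"
      using K(2) by (intro exI[of _ "K + K"]) (auto simp: abs_le_iff)
  qed (use bb in \<open>simp add: bounded_borel_measurable\<close>)
  moreover have "combo xs (\<lambda>t. K) = 0"
    using combo_cmult[of xs K "indicator UNIV"] UNIV by simp
  ultimately show ?thesis
    by (simp add: combo_add[OF xs u bounded_borel_const])
qed

lemma combo_eqI:
  assumes "finite_combo xs" "finite_combo ys"
    and "\<And>t. combo xs (indicator {..t}) = combo ys (indicator {..t})" and "bounded_borel u"
  shows "combo xs u = combo ys u"
  using combo_vanishes[of "xs @ scale_combo (-1) ys" u] assms by simp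

section \<open>Bounded functional calculus\<close>

lemma complex_polarization:
  fixes x y :: "'h::chilbert_space"
  shows "cinner x y = (1/4) * complex_of_real ((norm (x + y))\<^sup>2)
    + (\<i>/4) * complex_of_real ((norm (x + \<i> *\<^sub>C y))\<^sup>2)
    + (-1/4) * complex_of_real ((norm (x - y))\<^sup>2)
    + (-\<i>/4) * complex_of_real ((norm (x - \<i> *\<^sub>C y))\<^sup>2)"
  unfolding cinner_self[symmetric]
  by (simp add: cinner_add_left cinner_add_right cinner_diff_left cinner_diff_right
      cinner_scaleC_left cinner_scaleC_right field_simps)

locale spectral_resolution =
  fixes E :: "real \<Rightarrow> 'h::chilbert_space \<Rightarrow> 'h"
  assumes spectral_family: "spectral_family E"
begin

lemma E_idem: "E t (E t f) = E t f" and E_csym: "cinner (E t f) g = cinner f (E t g)"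
  using spectral_family by (auto simp: spectral_family_def orth_projection_def)

lemma E_comp: "E s (E t f) = E (min s t) f"
proof (cases "s \<le> t")
  case True
  then show ?thesis
    using spectral_family by (simp add: spectral_family_def)
next
  case False
  then have "E t (E s g) = E t g" for g
    using spectral_family by (simp add: spectral_family_def)
  then have "cinner (E s (E t f)) g = cinner (E t f) g" for g
    by (simp add: E_csym)
  then have "E s (E t f) = E t f"
    by (rule cinner_ext)
  then show ?thesis
    using False by (simp add: min_def)
qed

lemma E_add: "E t (f + g) = E t f + E t g"
  by (rule cinner_ext) (simp add: E_csym cinner_add_left)

lemma E_diff: "E t (f - g) = E t f - E t g"
  by (rule cinner_ext) (simp add: E_csym cinner_diff_left)

lemma E_scaleC: "E t (a *\<^sub>C f) = a *\<^sub>C E t f"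
  by (rule cinner_ext) (simp add: E_csym cinner_scaleC_left)

lemma norm_E: "(complex_of_real (norm (E t f)))\<^sup>2 = cinner (E t f) f"
  using cinner_self[of "E t f"] by (simp add: E_csym E_idem)

lemma norm_E_mono:
  assumes "s \<le> t"
  shows "(norm (E s f))\<^sup>2 \<le> (norm (E t f))\<^sup>2"
proof -
  have "cinner (E s f) (E t f) = cinner (E s f) f"
    using assms by (simp add: E_csym[of t, symmetric] E_comp min_def)
  then have "complex_of_real ((norm (E s f))\<^sup>2) = cinner (E s f) (E t f)"
    by (simp add: norm_E)
  then have "(norm (E s f))\<^sup>2 = inner (E s f) (E t f)"
    by (metis Re_complex_of_real inner_eq_Re_cinner)
  also have "\<dots> \<le> norm (E s f) * norm (E t f)"
    by (rule norm_cauchy_schwarz)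
  finally have "norm (E s f) \<le> norm (E t f)"
    by (cases "E s f = 0") (auto simp: power2_eq_square)
  then show ?thesis
    by (rule power_mono) simp
qed

lemma norm_E_limits:
  "continuous (at_right s) (\<lambda>t. (norm (E t f))\<^sup>2)"
  "((\<lambda>t. (norm (E t f))\<^sup>2) \<longlongrightarrow> 0) at_bot"
  "((\<lambda>t. (norm (E t f))\<^sup>2) \<longlongrightarrow> (norm f)\<^sup>2) at_top"
proof -
  have "((\<lambda>t. E t f) \<longlongrightarrow> E s f) (at_right s)" "((\<lambda>t. E t f) \<longlongrightarrow> 0) at_bot" "((\<lambda>t. E t f) \<longlongrightarrow> f) at_top"
    using spectral_family by (simp_all add: spectral_family_def)
  from this[THEN tendsto_norm, THEN tendsto_power, of 2]
  show "continuous (at_right s) (\<lambda>t. (norm (E t f))\<^sup>2)"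
    "((\<lambda>t. (norm (E t f))\<^sup>2) \<longlongrightarrow> 0) at_bot" "((\<lambda>t. (norm (E t f))\<^sup>2) \<longlongrightarrow> (norm f)\<^sup>2) at_top"
    by (simp_all add: continuous_within)
qed

lemma sets_spec_measure [simp, measurable_cong]: "sets (spec_measure E f) = sets borel"
  by (simp add: spec_measure_def)

lemma space_spec_measure [simp]: "space (spec_measure E f) = UNIV"
  by (simp add: spec_measure_def)

lemma emeasure_spec_measure_UNIV: "emeasure (spec_measure E f) UNIV = ennreal ((norm f)\<^sup>2)"
  unfolding spec_measure_def using norm_E_mono norm_E_limits by (intro interval_measure_UNIV) auto

lemma finite_borel_spec_measure: "finite_borel (spec_measure E f)"
  unfolding finite_borel_def
  by (auto intro!: finite_measureI simp: emeasure_spec_measure_UNIV)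

lemma measure_spec_measure_UNIV: "measure (spec_measure E f) UNIV = (norm f)\<^sup>2"
  by (simp add: measure_def emeasure_spec_measure_UNIV)

lemma measure_spec_measure_atMost: "measure (spec_measure E f) {..t} = (norm (E t f))\<^sup>2"
  unfolding spec_measure_def using norm_E_mono norm_E_limits by (intro measure_interval_measure_Iic) auto

lemma integral_spec_measure_le:
  assumes u: "u \<in> borel_measurable borel" "\<And>t. \<bar>u t\<bar> \<le> K"
  shows "\<bar>\<integral>t. u t \<partial>spec_measure E f\<bar> \<le> K * (norm f)\<^sup>2"
proof -
  have int: "integrable (spec_measure E f) u" "integrable (spec_measure E f) (\<lambda>t. K)"
    using bounded_borelI[OF assms] bounded_borel_const
    by (auto intro!: integrable_bounded_borel finite_borel_spec_measure)
  have "\<bar>\<integral>t. u t \<partial>spec_measure E f\<bar> \<le> (\<integral>t. \<bar>u t\<bar> \<partial>spec_measure E f)"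
    by (rule integral_abs_bound)
  also have "\<dots> \<le> (\<integral>t. K \<partial>spec_measure E f)"
    using int u by (intro integral_mono) auto
  finally show ?thesis
    by (simp add: measure_spec_measure_UNIV mult.commute)
qed

text \<open>The complex measure \<open>d\<langle>E\<^sub>t f | g\<rangle>\<close>.\<close>

definition polar :: "'h \<Rightarrow> 'h \<Rightarrow> (complex \<times> real measure) list" where
  "polar f g = [(1/4, spec_measure E (f + g)), (\<i>/4, spec_measure E (f + \<i> *\<^sub>C g)),
     (-1/4, spec_measure E (f - g)), (-\<i>/4, spec_measure E (f - \<i> *\<^sub>C g))]"

lemma finite_combo_polar [simp]: "finite_combo (polar f g)"
  by (simp add: polar_def finite_borel_spec_measure)

lemma spec_integral_eq_combo: "spec_integral E u f g = combo (polar f g) u"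
proof -
  have 3: "\<i> ^ 3 = - \<i>"
    by (simp add: power3_eq_cube)
  have "(- \<i>) *\<^sub>C g = - (\<i> *\<^sub>C g)"
    using scaleC_scaleC[of "-1" \<i> g] by simp
  moreover have "{..<4} = {0, 1, 2, 3::nat}"
    by auto
  ultimately show ?thesis
    by (simp add: spec_integral_def polar_def 3 algebra_simps add_divide_distrib diff_divide_distrib)
qed

lemma spec_integral_half_line: "spec_integral E (indicator {..t}) f g = cinner (E t f) g"
proof -
  have "spec_integral E (indicator {..t}) f g = cinner (E t f) (E t g)"
    unfolding spec_integral_eq_combo complex_polarization[of "E t f" "E t g"]
    by (simp add: polar_def measure_spec_measure_atMost E_add E_diff E_scaleC)
  then show ?thesis
    by (simp add: E_csym E_idem)
qed

lemma spec_integral_one: "spec_integral E (\<lambda>t. 1) f g = cinner f g"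
  unfolding spec_integral_eq_combo complex_polarization[of f g]
  by (simp add: polar_def measure_spec_measure_UNIV)

lemma spec_integral_self:
  assumes "bounded_borel u"
  shows "spec_integral E u f f = complex_of_real (\<integral>t. u t \<partial>spec_measure E f)"
proof -
  have "combo (polar f f) u = combo [(1, spec_measure E f)] u"
  proof (rule combo_eqI[OF _ _ _ assms])
    show "combo (polar f f) (indicator {..t}) = combo [(1, spec_measure E f)] (indicator {..t})" for t
      unfolding spec_integral_eq_combo[symmetric] spec_integral_half_line
      by (simp add: measure_spec_measure_atMost norm_E[symmetric])
  qed (simp_all add: finite_borel_spec_measure)
  then show ?thesis
    by (simp add: spec_integral_eq_combo)
qed

lemma spec_integral_add_left:
  assumes "bounded_borel u"
  shows "spec_integral E u (f1 + f2) g = spec_integral E u f1 g + spec_integral E u f2 g"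
proof -
  have "combo (polar (f1 + f2) g) u = combo (polar f1 g @ polar f2 g) u"
  proof (rule combo_eqI[OF _ _ _ assms])
    show "combo (polar (f1 + f2) g) (indicator {..t}) = combo (polar f1 g @ polar f2 g) (indicator {..t})" for t
      by (simp add: spec_integral_eq_combo[symmetric] spec_integral_half_line E_add cinner_add_left)
  qed simp_all
  then show ?thesis
    by (simp add: spec_integral_eq_combo)
qed

lemma spec_integral_scaleC_left:
  assumes "bounded_borel u"
  shows "spec_integral E u (a *\<^sub>C f) g = a * spec_integral E u f g"
proof -
  have "combo (polar (a *\<^sub>C f) g) u = combo (scale_combo a (polar f g)) u"
  proof (rule combo_eqI[OF _ _ _ assms])
    show "combo (polar (a *\<^sub>C f) g) (indicator {..t}) = combo (scale_combo a (polar f g)) (indicator {..t})" for t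
      by (simp add: spec_integral_eq_combo[symmetric] spec_integral_half_line E_scaleC cinner_scaleC_left)
  qed simp_all
  then show ?thesis
    by (simp add: spec_integral_eq_combo)
qed

lemma spec_integral_cnj:
  assumes "bounded_borel u"
  shows "spec_integral E u g f = cnj (spec_integral E u f g)"
proof -
  have "combo (polar g f) u = combo (cnj_combo (polar f g)) u"
  proof (rule combo_eqI[OF _ _ _ assms])
    show "combo (polar g f) (indicator {..t}) = combo (cnj_combo (polar f g)) (indicator {..t})" for t
      using cinner_commute[of "E t g" f]
      by (simp add: spec_integral_eq_combo[symmetric] spec_integral_half_line E_csym[of t f g])
  qed simp_all
  then show ?thesis
    by (simp add: spec_integral_eq_combo)
qed

lemma spec_integral_bound:
  assumes u: "u \<in> borel_measurable borel" "\<And>t. \<bar>u t\<bar> \<le> K"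
  shows "cmod (spec_integral E u f g) \<le> K * (norm f + norm g)\<^sup>2"
proof -
  have *: "cmod (c / 4 * complex_of_real (\<integral>t. u t \<partial>spec_measure E x)) \<le> K * (norm f + norm g)\<^sup>2 / 4"
    if "cmod c = 1" "norm x \<le> norm f + norm g" for c x
  proof -
    have "0 \<le> K"
      using u(2)[of 0] by (rule order_trans[OF abs_ge_zero])
    then have "K * (norm x)\<^sup>2 \<le> K * (norm f + norm g)\<^sup>2"
      using that by (intro mult_left_mono power_mono) auto
    then have "\<bar>\<integral>t. u t \<partial>spec_measure E x\<bar> \<le> K * (norm f + norm g)\<^sup>2"
      using integral_spec_measure_le[OF assms, of x] by (rule order_trans[rotated])
    then show ?thesis
      using that by (simp add: norm_mult norm_divide)
  qed
  have n: "norm (f + g) \<le> norm f + norm g" "norm (f - g) \<le> norm f + norm g"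
    "norm (f + \<i> *\<^sub>C g) \<le> norm f + norm g" "norm (f - \<i> *\<^sub>C g) \<le> norm f + norm g"
    using norm_triangle_ineq[of f g] norm_triangle_ineq4[of f g]
      norm_triangle_ineq[of f "\<i> *\<^sub>C g"] norm_triangle_ineq4[of f "\<i> *\<^sub>C g"] by (simp_all add: norm_scaleC)
  define a b c d where "a = 1 / 4 * complex_of_real (\<integral>t. u t \<partial>spec_measure E (f + g))"
    and "b = \<i> / 4 * complex_of_real (\<integral>t. u t \<partial>spec_measure E (f + \<i> *\<^sub>C g))"
    and "c = -1 / 4 * complex_of_real (\<integral>t. u t \<partial>spec_measure E (f - g))"
    and "d = -\<i> / 4 * complex_of_real (\<integral>t. u t \<partial>spec_measure E (f - \<i> *\<^sub>C g))"
  have "cmod a \<le> K * (norm f + norm g)\<^sup>2 / 4" "cmod b \<le> K * (norm f + norm g)\<^sup>2 / 4"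
    "cmod c \<le> K * (norm f + norm g)\<^sup>2 / 4" "cmod d \<le> K * (norm f + norm g)\<^sup>2 / 4"
    using *[of 1, OF _ n(1)] *[of \<i>, OF _ n(3)] *[of "-1", OF _ n(2)] *[of "-\<i>", OF _ n(4)]
    unfolding a_def b_def c_def d_def by simp_all
  moreover have "cmod (a + (b + (c + d))) \<le> cmod a + (cmod b + (cmod c + cmod d))"
    by (intro order_trans[OF norm_triangle_ineq] add_left_mono) (rule order_refl)
  moreover have "spec_integral E u f g = a + (b + (c + d))"
    by (simp add: spec_integral_eq_combo polar_def a_def b_def c_def d_def)
  ultimately show ?thesis
    by simp
qed

text \<open>The bounded operator \<open>u(T)\<close>.\<close>

definition fcalc :: "(real \<Rightarrow> real) \<Rightarrow> 'h \<Rightarrow> 'h" where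
  "fcalc u f = (THE h. \<forall>g. cinner h g = spec_integral E u f g)"

text \<open>The Riesz theorem represents the real part of \<open>g \<mapsto> \<integral> u d\<langle>E\<^sub>t f | g\<rangle>\<close>; the imaginary part is the real
  part at \<open>\<i> g\<close>.\<close>

lemma cinner_fcalc:
  assumes u: "bounded_borel u"
  shows "cinner (fcalc u f) g = spec_integral E u f g"
proof -
  obtain K where K: "0 \<le> K" "\<And>t. \<bar>u t\<bar> \<le> K"
    using bounded_borel_bound[OF u] by blast
  have add: "spec_integral E u f (x + y) = spec_integral E u f x + spec_integral E u f y" for x y
    using spec_integral_add_left[OF u, of x y f] by (simp add: spec_integral_cnj[OF u, of f])
  have scale: "spec_integral E u f (a *\<^sub>C x) = cnj a * spec_integral E u f x" for a x
    using spec_integral_scaleC_left[OF u, of a x f] by (simp add: spec_integral_cnj[OF u, of f])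
  have scaleR: "spec_integral E u f (r *\<^sub>R x) = of_real r * spec_integral E u f x" for r x
    using scale[of "of_real r" x] by (simp add: scaleC_of_real)
  have "\<exists>h\<in>UNIV. \<forall>g\<in>UNIV. inner h g = Re (spec_integral E u f g)"
  proof (rule riesz_representation_closed_subspace[where K="K * (norm f + 1)\<^sup>2"])
    fix x :: 'h
    show "\<bar>Re (spec_integral E u f x)\<bar> \<le> K * (norm f + 1)\<^sup>2 * norm x"
    proof (cases "x = 0")
      case True
      then show ?thesis
        using scaleR[of 0 0] by simp
    next
      case False
      define e where "e = (1 / norm x) *\<^sub>R x"
      have e: "norm e = 1" "x = norm x *\<^sub>R e"
        using False by (simp_all add: e_def)
      have "spec_integral E u f x = of_real (norm x) * spec_integral E u f e"
        using scaleR[of "norm x" e] e(2) by simp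
      then have "\<bar>Re (spec_integral E u f x)\<bar> = norm x * \<bar>Re (spec_integral E u f e)\<bar>"
        by (simp add: abs_mult)
      also have "\<dots> \<le> norm x * (K * (norm f + 1)\<^sup>2)"
        using spec_integral_bound[OF bounded_borel_measurable[OF u] K(2), of f e] e(1)
        by (intro mult_left_mono order_trans[OF abs_Re_le_cmod]) simp_all
      finally show ?thesis
        by (simp add: mult.commute)
    qed
  qed (simp_all add: add scaleR)
  then obtain h where h: "\<And>g. inner h g = Re (spec_integral E u f g)"
    by auto
  have "cinner h g = spec_integral E u f g" for g
    using h[of g] h[of "\<i> *\<^sub>C g"] by (intro complex_eqI) (simp_all add: Im_cinner inner_eq_Re_cinner[symmetric] scale)
  then have "fcalc u f = h"
    unfolding fcalc_def by (intro the_equality) (auto intro: cinner_ext)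
  then show ?thesis
    using \<open>\<And>g. cinner h g = spec_integral E u f g\<close> by simp
qed

lemma fcalc_eqI:
  assumes "bounded_borel u" "\<And>g. cinner h g = spec_integral E u f g"
  shows "fcalc u f = h"
  by (rule cinner_ext) (simp add: cinner_fcalc assms)

lemma fcalc_csym: "bounded_borel u \<Longrightarrow> cinner (fcalc u f) g = cinner f (fcalc u g)"
  by (metis cinner_commute cinner_fcalc spec_integral_cnj)

lemma fcalc_add: "bounded_borel u \<Longrightarrow> fcalc u (f + g) = fcalc u f + fcalc u g"
  by (rule cinner_ext) (simp add: fcalc_csym cinner_add_left)

lemma fcalc_diff: "bounded_borel u \<Longrightarrow> fcalc u (f - g) = fcalc u f - fcalc u g"
  by (rule cinner_ext) (simp add: fcalc_csym cinner_diff_left)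

lemma fcalc_scaleC: "bounded_borel u \<Longrightarrow> fcalc u (a *\<^sub>C f) = a *\<^sub>C fcalc u f"
  by (rule cinner_ext) (simp add: fcalc_csym cinner_scaleC_left)

lemma fcalc_one [simp]: "fcalc (\<lambda>t. 1) f = f"
  by (rule fcalc_eqI) (simp_all add: bounded_borel_const spec_integral_one)

lemma fcalc_half_line: "fcalc (indicator {..t}) f = E t f"
  by (rule fcalc_eqI) (simp_all add: bounded_borel_indicator spec_integral_half_line)

lemma fcalc_plus: "bounded_borel u \<Longrightarrow> bounded_borel v \<Longrightarrow> fcalc (\<lambda>t. u t + v t) f = fcalc u f + fcalc v f"
  by (rule fcalc_eqI)
    (simp_all add: bounded_borel_add cinner_add_left cinner_fcalc spec_integral_eq_combo combo_add)

lemma fcalc_cmult: "bounded_borel u \<Longrightarrow> fcalc (\<lambda>t. c * u t) f = c *\<^sub>R fcalc u f"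
  by (rule fcalc_eqI)
    (simp_all add: bounded_borel_cmult cinner_scaleR_left cinner_fcalc spec_integral_eq_combo combo_cmult)

lemma fcalc_minus:
  assumes "bounded_borel u" "bounded_borel v"
  shows "fcalc (\<lambda>t. u t - v t) f = fcalc u f - fcalc v f"
  using fcalc_plus[OF assms(1) bounded_borel_cmult[OF assms(2), of "-1"]] fcalc_cmult[OF assms(2), of "-1"]
  by simp

text \<open>For fixed \<open>v\<close> both sides are bounded functionals of \<open>u\<close>, so that \<open>u\<close> may be taken to be the
  indicator of a half-line; by self-adjointness the same reduction then applies to \<open>v\<close>.\<close>

lemma fcalc_fcalc:
  assumes u: "bounded_borel u" and v: "bounded_borel v"
  shows "fcalc u (fcalc v f) = fcalc (\<lambda>t. u t * v t) f"
proof -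
  have half: "spec_integral E u (E s f) g = spec_integral E (\<lambda>t. u t * indicator {..s} t) f g"
    if u: "bounded_borel u" for u s f g
  proof -
    have ind: "(\<lambda>t. indicator {..r} t * indicator {..s} t :: real) = indicator {..min r s}" for r
      by (auto simp: indicator_def)
    have dens: "combo (density_combo (indicator {..s}) (polar f g)) u = combo (polar f g) (\<lambda>t. u t * indicator {..s} t)"
      if "bounded_borel u" for u
      using that by (intro combo_density) (auto simp: bounded_borel_def)
    have "combo (polar (E s f) g) u = combo (density_combo (indicator {..s}) (polar f g)) u"
    proof (rule combo_eqI[OF _ _ _ u])
      show "finite_combo (density_combo (indicator {..s}) (polar f g))"
        by (simp add: finite_combo_density bounded_borel_indicator)
      show "combo (polar (E s f) g) (indicator {..r})
          = combo (density_combo (indicator {..s}) (polar f g)) (indicator {..r})" for r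
        by (simp add: dens bounded_borel_indicator ind spec_integral_eq_combo[symmetric]
            spec_integral_half_line E_comp)
    qed simp
    then show ?thesis
      using dens[OF u] by (simp add: spec_integral_eq_combo)
  qed
  \<comment> \<open>For \<open>v \<ge> 0\<close> the right-hand side is a functional of \<open>u\<close> given by measures with density \<open>v\<close>. A general
    \<open>v\<close> becomes non-negative after the addition of a constant.\<close>
  have nonneg: "fcalc u (fcalc v f) = fcalc (\<lambda>t. u t * v t) f"
    if u: "bounded_borel u" and v: "bounded_borel v" and pos: "\<And>t. 0 \<le> v t" for u v f
  proof (rule cinner_ext)
    fix g
    have dens: "combo (density_combo v (polar f g)) u = combo (polar f g) (\<lambda>t. u t * v t)"
      if "bounded_borel u" for u
      using that v pos by (intro combo_density) (auto simp: bounded_borel_def)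
    have "combo (polar (fcalc v f) g) u = combo (density_combo v (polar f g)) u"
    proof (rule combo_eqI[OF _ _ _ u])
      fix s
      have bb: "bounded_borel (\<lambda>t. v t * indicator {..s} t)"
        by (intro bounded_borel_mult v bounded_borel_indicator) simp
      have "cinner (E s (fcalc v f)) g = spec_integral E v f (E s g)"
        by (simp add: E_csym cinner_fcalc v)
      also have "\<dots> = cnj (spec_integral E v (E s g) f)"
        by (rule spec_integral_cnj[OF v])
      also have "\<dots> = spec_integral E (\<lambda>t. v t * indicator {..s} t) f g"
        using spec_integral_cnj[OF bb, of f g] by (simp add: half[OF v])
      finally show "combo (polar (fcalc v f) g) (indicator {..s})
          = combo (density_combo v (polar f g)) (indicator {..s})"
        by (simp add: dens bounded_borel_indicator spec_integral_eq_combo[symmetric] spec_integral_half_line mult.commute)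
    qed (simp_all add: finite_combo_density v)
    then show "cinner (fcalc u (fcalc v f)) g = cinner (fcalc (\<lambda>t. u t * v t) f) g"
      using dens[OF u] by (simp add: cinner_fcalc u v bounded_borel_mult spec_integral_eq_combo)
  qed
  obtain K where K: "0 \<le> K" "\<And>t. \<bar>v t\<bar> \<le> K"
    using bounded_borel_bound[OF v] by blast
  define w where "w t = v t + K" for t
  have w: "bounded_borel w" "\<And>t. 0 \<le> w t"
    unfolding w_def using K(2) by (auto intro!: bounded_borel_add v bounded_borel_const simp: abs_le_iff)
      (metis abs_ge_minus_self add.commute add_increasing2 diff_0 diff_le_eq order_trans)
  have "fcalc (\<lambda>t. u t * w t) f = fcalc (\<lambda>t. u t * v t + K * u t) f"
    by (simp add: w_def algebra_simps)
  also have "\<dots> = fcalc (\<lambda>t. u t * v t) f + K *\<^sub>R fcalc u f"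
    by (simp add: fcalc_plus fcalc_cmult bounded_borel_mult bounded_borel_cmult u v)
  finally have 1: "fcalc u (fcalc w f) = fcalc (\<lambda>t. u t * v t) f + K *\<^sub>R fcalc u f"
    using nonneg[OF u w] by simp
  have "fcalc w f = fcalc v f + K *\<^sub>R f"
    using fcalc_plus[OF v bounded_borel_cmult[OF bounded_borel_const], of K 1 f]
      fcalc_cmult[OF bounded_borel_const, of K 1 f] by (simp add: w_def[abs_def])
  then have "fcalc u (fcalc w f) = fcalc u (fcalc v f) + K *\<^sub>R fcalc u f"
    using fcalc_scaleC[OF u, of "of_real K" f] by (simp add: fcalc_add u scaleC_of_real)
  then show ?thesis
    using 1 by simp
qed

lemma fcalc_commute: "bounded_borel u \<Longrightarrow> bounded_borel v \<Longrightarrow> fcalc u (fcalc v f) = fcalc v (fcalc u f)"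
  by (simp add: fcalc_fcalc mult.commute)

lemma fcalc_inner:
  assumes "bounded_borel u"
  shows "inner (fcalc u f) f = (\<integral>t. u t \<partial>spec_measure E f)"
  by (simp add: inner_eq_Re_cinner cinner_fcalc assms spec_integral_self)

lemma norm_fcalc:
  assumes "bounded_borel u"
  shows "(norm (fcalc u f))\<^sup>2 = (\<integral>t. (u t)\<^sup>2 \<partial>spec_measure E f)"
proof -
  have "(norm (fcalc u f))\<^sup>2 = inner (fcalc (\<lambda>t. (u t)\<^sup>2) f) f"
    using assms fcalc_csym[of u "fcalc u f" f]
    by (simp add: power2_norm_eq_inner inner_eq_Re_cinner fcalc_fcalc cinner_self power2_eq_square)
  then show ?thesis
    using assms by (simp add: fcalc_inner bounded_borel_power2)
qed

text \<open>Both measures give a half-line \<open>{..s}\<close> the mass \<open>\<parallel>(1\<^bsub>{..s}\<^esub> v)(T) f\<parallel>\<^sup>2\<close>.\<close>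

lemma spec_measure_fcalc:
  assumes v: "bounded_borel v"
  shows "spec_measure E (fcalc v f) = density (spec_measure E f) (\<lambda>t. ennreal ((v t)\<^sup>2))"
proof -
  let ?M = "spec_measure E (fcalc v f)" and ?N = "density (spec_measure E f) (\<lambda>t. ennreal ((v t)\<^sup>2))"
  have fin: "finite_borel ?M" "finite_borel ?N"
    using v by (auto intro!: finite_borel_density finite_borel_spec_measure bounded_borel_power2)
  then interpret M: finite_measure ?M + N: finite_measure ?N
    by (simp_all add: finite_borel_def)
  have int: "(\<integral>t. u t \<partial>?N) = (\<integral>t. (v t)\<^sup>2 * u t \<partial>spec_measure E f)" if "bounded_borel u" for u
    using v that by (subst integral_density) (auto simp: bounded_borel_def)
  have "combo [(1, ?M)] u = combo [(1, ?N)] u" if "bounded_borel u" for u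
  proof (rule combo_eqI[OF _ _ _ that])
    fix s
    have bb: "bounded_borel (indicator {..s})"
      by (simp add: bounded_borel_indicator)
    have bbv: "bounded_borel (\<lambda>t. indicator {..s} t * v t)"
      by (intro bounded_borel_mult bb v)
    have "(norm (E s (fcalc v f)))\<^sup>2 = (norm (fcalc (\<lambda>t. indicator {..s} t * v t) f))\<^sup>2"
      by (simp add: fcalc_fcalc[OF bb v, symmetric] fcalc_half_line)
    also have "\<dots> = (\<integral>t. (v t)\<^sup>2 * indicator {..s} t \<partial>spec_measure E f)"
      unfolding norm_fcalc[OF bbv] by (intro Bochner_Integration.integral_cong) (auto simp: indicator_def)
    finally show "combo [(1, ?M)] (indicator {..s}) = combo [(1, ?N)] (indicator {..s})"
      using int[OF bb] by (simp add: measure_spec_measure_atMost)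
  qed (simp_all add: fin)
  then have "measure ?M A = measure ?N A" if "A \<in> sets borel" for A
    using that bounded_borel_indicator[OF that] by (force simp del: of_real_eq_iff dest: of_real_eq_iff[THEN iffD1])
  then show ?thesis
    by (intro measure_eqI) (auto simp: M.emeasure_eq_measure N.emeasure_eq_measure)
qed

lemma nn_integral_spec_measure_fcalc:
  assumes "bounded_borel v" "w \<in> borel_measurable borel"
  shows "(\<integral>\<^sup>+t. w t \<partial>spec_measure E (fcalc v f)) = (\<integral>\<^sup>+t. ennreal ((v t)\<^sup>2) * w t \<partial>spec_measure E f)"
proof -
  have [measurable]: "v \<in> borel_measurable borel" "w \<in> borel_measurable borel"
    using assms by (simp_all add: bounded_borel_measurable)
  show ?thesis
    unfolding spec_measure_fcalc[OF assms(1)] by (subst nn_integral_density) simp_all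
qed

lemma fcalc_cong_AE:
  assumes "bounded_borel u" "bounded_borel v" "\<And>f. AE t in spec_measure E f. u t = v t"
  shows "fcalc u = fcalc v"
proof -
  have "spec_integral E u f g = spec_integral E v f g" for f g
    unfolding spec_integral_def using assms
    by (intro arg_cong2[where f="(/)"] refl sum.cong arg_cong2[where f="(*)"] arg_cong[where f=of_real]
        integral_cong_AE) (auto simp: bounded_borel_def)
  then show ?thesis
    by (simp add: fcalc_def fun_eq_iff)
qed

section \<open>Unbounded functions of the operator\<close>

lemma tendsto_fcalc_truncation:
  assumes u: "u \<in> borel_measurable borel"
  shows "(\<lambda>n. cinner (fcalc (indicator {t. \<bar>u t\<bar> \<le> real n}) f) g) \<longlonglongrightarrow> cinner f g"
proof -
  have meas: "{t. \<bar>u t\<bar> \<le> real n} \<in> sets borel" for n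
    using u by measurable
  have "(\<lambda>n. combo (polar f g) (indicator {t. \<bar>u t\<bar> \<le> real n})) \<longlonglongrightarrow> combo (polar f g) (\<lambda>t. 1)"
  proof (rule combo_bounded_convergence)
    show "(\<lambda>n. indicator {t. \<bar>u t\<bar> \<le> real n} t :: real) \<longlonglongrightarrow> 1" for t
    proof (rule tendsto_eventually)
      obtain N :: nat where "\<bar>u t\<bar> \<le> real N"
        using real_arch_simple by blast
      then show "\<forall>\<^sub>F n in sequentially. indicator {t. \<bar>u t\<bar> \<le> real n} t = (1 :: real)"
        by (auto simp: eventually_sequentially indicator_def intro!: exI[of _ N])
    qed
    show "\<bar>indicator {t. \<bar>u t\<bar> \<le> real n} t\<bar> \<le> (1::real)" for n t
      by (simp add: indicator_def)
  qed (use meas in auto)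
  then show ?thesis
    using meas by (simp add: cinner_fcalc bounded_borel_indicator spec_integral_eq_combo[symmetric] spec_integral_one)
qed

text \<open>Truncations of \<open>1 + \<bar>u\<bar>\<close>, which are bounded functions, recover \<open>y\<close> in the limit.\<close>

lemma fcalc_resolvent_inject:
  assumes u: "u \<in> borel_measurable borel"
    and eq: "fcalc (\<lambda>t. 1 / (1 + \<bar>u t\<bar>)) y = fcalc (\<lambda>t. 1 / (1 + \<bar>u t\<bar>)) y'"
  shows "y = y'"
proof -
  define v where "v t = 1 / (1 + \<bar>u t\<bar>)" for t
  have v: "bounded_borel v"
    unfolding v_def by (rule bounded_borel_resolvent(1)[OF u])
  define w where "w n t = (1 + \<bar>u t\<bar>) * indicator {t. \<bar>u t\<bar> \<le> real n} t" for n t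
  have w: "bounded_borel (w n)" for n
    unfolding w_def using u
    by (intro bounded_borelI[of _ "1 + real n"]) (auto simp: indicator_def)
  have w_v: "(\<lambda>t. w n t * v t) = indicator {t. \<bar>u t\<bar> \<le> real n}" for n
    by (auto simp: w_def v_def fun_eq_iff indicator_def)
  have "fcalc (indicator {t. \<bar>u t\<bar> \<le> real n}) y = fcalc (indicator {t. \<bar>u t\<bar> \<le> real n}) y'" for n
  proof -
    have "fcalc v y = fcalc v y'"
      using eq by (simp add: v_def[abs_def])
    then have "fcalc (\<lambda>t. w n t * v t) y = fcalc (\<lambda>t. w n t * v t) y'"
      by (simp add: fcalc_fcalc[OF w v, symmetric])
    then show ?thesis
      unfolding w_v .
  qed
  then show ?thesis
    using tendsto_fcalc_truncation[OF u, of y] tendsto_fcalc_truncation[OF u, of y'] LIMSEQ_unique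
    by (intro cinner_ext) fastforce
qed

text \<open>Let \<open>v = 1 / (1 + \<bar>u\<bar>)\<close>. Since \<open>u v\<close> is bounded, \<open>v(T)\<close> maps into the domain of \<open>u(T)\<close>, and for
  \<open>f = v(T) h\<close> and \<open>g = v(T) k\<close> the integral \<open>\<integral> u d\<langle>E\<^sub>t f | g\<rangle>\<close> is \<open>\<langle>(u v)(T) h | v(T) k\<rangle>\<close>. Every \<open>f\<close> in the
  domain is of this form: \<open>h\<close> is the limit of the vectors \<open>(1 / v)(T) f\<close> with \<open>1 / v\<close> truncated, which
  converge because \<open>u\<close> is square integrable with respect to \<open>d\<langle>E\<^sub>t f | f\<rangle>\<close>.\<close>

theorem spec_operator_eq_range:
  assumes u: "u \<in> borel_measurable borel"
  shows "spec_operator E u =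
    range (\<lambda>h. (fcalc (\<lambda>t. 1 / (1 + \<bar>u t\<bar>)) h, fcalc (\<lambda>t. u t / (1 + \<bar>u t\<bar>)) h))"
proof -
  define v p where "v t = 1 / (1 + \<bar>u t\<bar>)" and "p t = u t / (1 + \<bar>u t\<bar>)" for t
  have v: "bounded_borel v"
    unfolding v_def by (rule bounded_borel_resolvent(1)[OF u])
  have p: "bounded_borel p"
    unfolding p_def by (rule bounded_borel_resolvent(2)[OF u])
  define w where "w n t = (1 + \<bar>u t\<bar>) * indicator {t. \<bar>u t\<bar> \<le> real n} t" for n t
  have w: "bounded_borel (w n)" for n
    unfolding w_def using u
    by (intro bounded_borelI[of _ "1 + real n"]) (auto simp: indicator_def)
  have meas: "{t. \<bar>u t\<bar> \<le> real n} \<in> sets borel" for n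
    using u by measurable
  have w_v: "(\<lambda>t. w n t * v t) = indicator {t. \<bar>u t\<bar> \<le> real n}" for n
    by (auto simp: w_def v_def fun_eq_iff indicator_def)
  have domain: "spec_domain E u = range (fcalc v)"
  proof (intro equalityI subsetI)
    fix f assume "f \<in> range (fcalc v)"
    then obtain h where h: "f = fcalc v h" by auto
    have "(\<integral>\<^sup>+t. ennreal ((u t)\<^sup>2) \<partial>spec_measure E f) = (\<integral>\<^sup>+t. ennreal ((p t)\<^sup>2) \<partial>spec_measure E h)"
      using u v by (simp add: h nn_integral_spec_measure_fcalc ennreal_mult'[symmetric] p_def v_def power_divide)
    also have "\<dots> < \<infinity>"
      using integrable_bounded_borel[OF finite_borel_spec_measure bounded_borel_power2[OF p]]
      by (simp add: integrable_iff_bounded)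
    finally show "f \<in> spec_domain E u"
      by (simp add: spec_domain_def)
  next
    fix f assume "f \<in> spec_domain E u"
    then have fin: "(\<integral>\<^sup>+t. ennreal ((u t)\<^sup>2) \<partial>spec_measure E f) < \<infinity>"
      by (simp add: spec_domain_def)
    then have "integrable (spec_measure E f) (\<lambda>t. (u t)\<^sup>2)"
      using u by (simp add: integrable_iff_bounded)
    then have int: "integrable (spec_measure E f) (\<lambda>t. 2 + 2 * (u t)\<^sup>2)"
      using integrable_bounded_borel[OF finite_borel_spec_measure bounded_borel_const] by auto
    have int_w: "integrable (spec_measure E f) (\<lambda>t. (w n t)\<^sup>2)" for n
      by (intro integrable_bounded_borel finite_borel_spec_measure bounded_borel_power2 w)
    define a where "a n = (\<integral>t. (w n t)\<^sup>2 \<partial>spec_measure E f)" for n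
    have a_le: "a n \<le> (\<integral>t. 2 + 2 * (u t)\<^sup>2 \<partial>spec_measure E f)" for n
      unfolding a_def
    proof (rule integral_mono[OF int_w int])
      fix t
      show "(w n t)\<^sup>2 \<le> 2 + 2 * (u t)\<^sup>2"
        using zero_le_power2[of "1 - \<bar>u t\<bar>"]
        by (auto simp: w_def indicator_def power2_eq_square algebra_simps)
    qed
    have split: "(w n t - w m t)\<^sup>2 = (w n t)\<^sup>2 - (w m t)\<^sup>2" if "m \<le> n" for m n t
      using that by (auto simp: w_def indicator_def)
    have a_diff: "(norm (fcalc (w n) f - fcalc (w m) f))\<^sup>2 = a n - a m" if "m \<le> n" for m n
    proof -
      have "(norm (fcalc (w n) f - fcalc (w m) f))\<^sup>2 = (\<integral>t. (w n t - w m t)\<^sup>2 \<partial>spec_measure E f)"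
        using w by (simp add: fcalc_minus[symmetric] norm_fcalc bounded_borel_diff)
      also have "\<dots> = a n - a m"
        unfolding split[OF that] a_def by (intro Bochner_Integration.integral_diff int_w)
      finally show ?thesis .
    qed
    have "incseq a"
      unfolding incseq_def using a_diff by (metis diff_ge_0_iff_ge zero_le_power2)
    then have "convergent a"
      using a_le incseq_convergent[of a "\<integral>t. 2 + 2 * (u t)\<^sup>2 \<partial>spec_measure E f"] unfolding convergent_def by metis
    then have "convergent (\<lambda>n. fcalc (w n) f)"
      by (rule convergent_if_increments_dominated) (simp add: a_diff)
    then obtain h where h: "(\<lambda>n. fcalc (w n) f) \<longlonglongrightarrow> h"
      by (auto simp: convergent_def)
    have "fcalc v h = f"
    proof (rule cinner_ext)
      fix g
      have "(\<lambda>n. cinner (fcalc (w n) f) (fcalc v g)) \<longlonglongrightarrow> cinner h (fcalc v g)"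
        by (rule bounded_linear.tendsto[OF bounded_linear_cinner_left h])
      moreover have "cinner (fcalc (w n) f) (fcalc v g)
          = cinner (fcalc (indicator {t. \<bar>u t\<bar> \<le> real n}) f) g" for n
        using fcalc_fcalc[OF v w[of n], of f] w_v[of n] by (simp add: fcalc_csym[OF v, symmetric] mult.commute)
      ultimately have "(\<lambda>n. cinner (fcalc (indicator {t. \<bar>u t\<bar> \<le> real n}) f) g) \<longlonglongrightarrow> cinner h (fcalc v g)"
        by simp
      then show "cinner (fcalc v h) g = cinner f g"
        using LIMSEQ_unique[OF tendsto_fcalc_truncation[OF u]] by (simp add: fcalc_csym[OF v])
    qed
    then show "f \<in> range (fcalc v)"
      by auto
  qed
  have form: "spec_integral E u (fcalc v h) (fcalc v k) = cinner (fcalc p h) (fcalc v k)" for h k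
  proof -
    have eq: "(\<integral>t. u t \<partial>spec_measure E (fcalc v x)) = (\<integral>t. p t * v t \<partial>spec_measure E x)" for x
      using u v unfolding spec_measure_fcalc[OF v]
      by (subst integral_density)
        (auto simp: bounded_borel_def p_def v_def power2_eq_square intro!: Bochner_Integration.integral_cong)
    have "spec_integral E u (fcalc v h) (fcalc v k) = spec_integral E (\<lambda>t. p t * v t) h k"
      using v by (simp add: spec_integral_eq_combo polar_def fcalc_add[symmetric] fcalc_diff[symmetric]
          fcalc_scaleC[symmetric] eq)
    also have "\<dots> = cinner (fcalc v (fcalc p h)) k"
      using v p by (simp add: fcalc_fcalc cinner_fcalc bounded_borel_mult mult.commute)
    finally show ?thesis
      using v by (simp add: fcalc_csym)
  qed
  have inj: "y = y'" if eq: "\<And>k. cinner y (fcalc v k) = cinner y' (fcalc v k)" for y y'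
  proof (rule fcalc_resolvent_inject[OF u])
    show "fcalc (\<lambda>t. 1 / (1 + \<bar>u t\<bar>)) y = fcalc (\<lambda>t. 1 / (1 + \<bar>u t\<bar>)) y'"
      using eq unfolding v_def[abs_def, symmetric] by (intro cinner_ext) (simp add: fcalc_csym[OF v])
  qed
  have "(f, y) \<in> spec_operator E u \<longleftrightarrow> (\<exists>h. f = fcalc v h \<and> y = fcalc p h)" for f y
  proof
    assume "(f, y) \<in> spec_operator E u"
    then obtain h where h: "f = fcalc v h" and y: "\<And>k. spec_integral E u f (fcalc v k) = cinner y (fcalc v k)"
      by (auto simp: spec_operator_def assoc_operator_def domain)
    have "y = fcalc p h"
      by (rule inj) (simp add: y[symmetric] h form)
    then show "\<exists>h. f = fcalc v h \<and> y = fcalc p h"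
      using h by blast
  qed (auto simp: spec_operator_def assoc_operator_def domain form)
  then have "spec_operator E u = range (\<lambda>h. (fcalc v h, fcalc p h))"
    by auto
  then show ?thesis
    by (simp add: v_def[abs_def] p_def[abs_def])
qed

lemma spec_operator_single_valued:
  assumes u: "u \<in> borel_measurable borel" and "(f, y) \<in> spec_operator E u" "(f, y') \<in> spec_operator E u"
  shows "y = y'"
proof -
  obtain h where h: "f = fcalc (\<lambda>t. 1 / (1 + \<bar>u t\<bar>)) h" "y = fcalc (\<lambda>t. u t / (1 + \<bar>u t\<bar>)) h"
    using assms(2) unfolding spec_operator_eq_range[OF u] by blast
  obtain h' where h': "f = fcalc (\<lambda>t. 1 / (1 + \<bar>u t\<bar>)) h'" "y' = fcalc (\<lambda>t. u t / (1 + \<bar>u t\<bar>)) h'"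
    using assms(3) unfolding spec_operator_eq_range[OF u] by blast
  have "h = h'"
    using h(1) h'(1) fcalc_resolvent_inject[OF u, of h h'] by simp
  then show ?thesis
    using h h' by simp
qed

lemma oapply_spec_operator:
  assumes "u \<in> borel_measurable borel" "(f, y) \<in> spec_operator E u"
  shows "oapply (spec_operator E u) f = y"
  unfolding oapply_def using assms spec_operator_single_valued[OF assms(1)] by (intro the_equality)

lemma spec_operator_fcalcI:
  assumes u: "u \<in> borel_measurable borel" and w: "bounded_borel w" and uw: "bounded_borel (\<lambda>t. u t * w t)"
  shows "(fcalc w f, fcalc (\<lambda>t. u t * w t) f) \<in> spec_operator E u"
proof -
  define v p where "v t = 1 / (1 + \<bar>u t\<bar>)" and "p t = u t / (1 + \<bar>u t\<bar>)" for t
  have v: "bounded_borel v"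
    unfolding v_def by (rule bounded_borel_resolvent(1)[OF u])
  have p: "bounded_borel p"
    unfolding p_def by (rule bounded_borel_resolvent(2)[OF u])
  define z where "z t = (1 + \<bar>u t\<bar>) * w t" for t
  have z: "bounded_borel z"
  proof -
    obtain K L where K: "\<And>t. \<bar>w t\<bar> \<le> K" "\<And>t. \<bar>u t * w t\<bar> \<le> L"
      using w uw by (auto simp: bounded_borel_def)
    have "\<bar>z t\<bar> \<le> K + L" for t
    proof -
      have "\<bar>1 + \<bar>u t\<bar>\<bar> = 1 + \<bar>u t\<bar>"
        by (rule abs_of_nonneg) simp
      then have "\<bar>z t\<bar> = (1 + \<bar>u t\<bar>) * \<bar>w t\<bar>"
        by (simp only: z_def abs_mult)
      then have "\<bar>z t\<bar> = \<bar>w t\<bar> + \<bar>u t * w t\<bar>"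
        by (simp add: abs_mult distrib_right)
      then show ?thesis
        using add_mono[OF K(1)[of t] K(2)[of t]] by simp
    qed
    then show ?thesis
      using u w by (intro bounded_borelI[of _ "K + L"]) (auto simp: z_def[abs_def] bounded_borel_def)
  qed
  have "(\<lambda>t. v t * z t) = w" "(\<lambda>t. p t * z t) = (\<lambda>t. u t * w t)"
    by (auto simp: v_def p_def z_def fun_eq_iff)
  then have "(fcalc w f, fcalc (\<lambda>t. u t * w t) f) = (fcalc v (fcalc z f), fcalc p (fcalc z f))"
    by (simp add: fcalc_fcalc v p z)
  then show ?thesis
    unfolding spec_operator_eq_range[OF u] v_def[abs_def] p_def[abs_def] by (rule range_eqI)
qed

lemma spec_operator_bounded:
  assumes u: "u \<in> borel_measurable borel" and v: "bounded_borel v"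
    and eq: "\<And>f. AE t in spec_measure E f. u t = v t"
  shows "(f, fcalc v f) \<in> spec_operator E u"
proof -
  define w where "w t = (indicator {t. u t = v t} t :: real)" for t
  have "{t. u t = v t} \<in> sets borel"
    using u v by (auto simp: bounded_borel_def)
  then have w: "bounded_borel w"
    unfolding w_def by (rule bounded_borel_indicator)
  note vw = bounded_borel_mult[OF v w]
  have uw: "(\<lambda>t. u t * w t) = (\<lambda>t. v t * w t)"
    by (auto simp: w_def indicator_def)
  have "fcalc w = fcalc (\<lambda>t. 1)"
  proof (rule fcalc_cong_AE[OF w bounded_borel_const])
    show "AE t in spec_measure E f. w t = 1" for f
      using eq[of f] by eventually_elim (simp add: w_def)
  qed
  moreover have "fcalc (\<lambda>t. v t * w t) = fcalc v"
  proof (rule fcalc_cong_AE[OF vw v])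
    show "AE t in spec_measure E f. v t * w t = v t" for f
      using eq[of f] by eventually_elim (simp add: w_def)
  qed
  ultimately show ?thesis
    using spec_operator_fcalcI[OF u w, of f] vw by (simp add: uw)
qed

lemma spec_operator_inverse:
  assumes u: "u \<in> borel_measurable borel" and v: "bounded_borel v"
    and eq: "\<And>f. AE t in spec_measure E f. u t * v t = 1"
  shows "spec_operator E u = range (\<lambda>h. (fcalc v h, h))"
proof (intro equalityI subsetI)
  fix x assume "x \<in> range (\<lambda>h. (fcalc v h, h))"
  then obtain h where h: "x = (fcalc v h, h)" by auto
  define w where "w t = v t * indicator {t. u t * v t = 1} t" for t
  have meas: "{t. u t * v t = 1} \<in> sets borel"
    using u v by (auto simp: bounded_borel_def)
  then have w: "bounded_borel w"
    unfolding w_def using v by (intro bounded_borel_mult bounded_borel_indicator)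
  have uw: "(\<lambda>t. u t * w t) = indicator {t. u t * v t = 1}"
    by (auto simp: w_def indicator_def)
  have "fcalc w = fcalc v"
  proof (rule fcalc_cong_AE[OF w v])
    show "AE t in spec_measure E f. w t = v t" for f
      using eq[of f] by eventually_elim (simp add: w_def)
  qed
  moreover have "fcalc (indicator {t. u t * v t = 1}) = fcalc (\<lambda>t. 1)"
  proof (rule fcalc_cong_AE[OF bounded_borel_indicator[OF meas] bounded_borel_const])
    show "AE t in spec_measure E f. indicator {t. u t * v t = 1} t = (1::real)" for f
      using eq[of f] by eventually_elim simp
  qed
  ultimately show "x \<in> spec_operator E u"
    using spec_operator_fcalcI[OF u w, of h] meas by (simp add: uw h bounded_borel_indicator)
next
  fix x assume "x \<in> spec_operator E u"
  define q p where "q t = 1 / (1 + \<bar>u t\<bar>)" and "p t = u t / (1 + \<bar>u t\<bar>)" for t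
  have q: "bounded_borel q"
    unfolding q_def by (rule bounded_borel_resolvent(1)[OF u])
  have p: "bounded_borel p"
    unfolding p_def by (rule bounded_borel_resolvent(2)[OF u])
  obtain h where h: "x = (fcalc q h, fcalc p h)"
    using \<open>x \<in> spec_operator E u\<close> unfolding spec_operator_eq_range[OF u] q_def[abs_def] p_def[abs_def] by auto
  have "fcalc (\<lambda>t. v t * p t) = fcalc q"
  proof (rule fcalc_cong_AE)
    show "AE t in spec_measure E f. v t * p t = q t" for f
      using eq[of f] by eventually_elim (simp add: p_def q_def mult.commute)
  qed (simp_all add: bounded_borel_mult v p q)
  then show "x \<in> range (\<lambda>h. (fcalc v h, h))"
    using fcalc_fcalc[OF v p, of h] by (auto simp: h image_iff)
qed

end

section \<open>The spectral theorem for the inverse of a positive operator\<close>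

context spectral_resolution
begin

lemma AE_greater_if_E_zero:
  assumes "E a f = 0"
  shows "AE t in spec_measure E f. a < t"
proof -
  interpret finite_measure "spec_measure E f"
    using finite_borel_spec_measure by (simp add: finite_borel_def)
  have "measure (spec_measure E f) {..a} = 0"
    using assms by (simp add: measure_spec_measure_atMost)
  then have "{..a} \<in> null_sets (spec_measure E f)"
    by (auto simp: null_sets_def emeasure_eq_measure)
  then have "AE t in spec_measure E f. t \<notin> {..a}"
    by (rule AE_not_in)
  then show ?thesis
    by (rule eventually_mono) auto
qed

lemma AE_le_if_E_fixes:
  assumes "E b f = f"
  shows "AE t in spec_measure E f. t \<le> b"
proof -
  interpret finite_measure "spec_measure E f"
    using finite_borel_spec_measure by (simp add: finite_borel_def)
  have "measure (spec_measure E f) (space (spec_measure E f) - {..b}) = 0"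
    using assms by (subst finite_measure_compl) (simp_all add: measure_spec_measure_atMost measure_spec_measure_UNIV)
  then have "- {..b} \<in> null_sets (spec_measure E f)"
    by (auto simp: null_sets_def emeasure_eq_measure Compl_eq_Diff_UNIV)
  then have "AE t in spec_measure E f. t \<notin> - {..b}"
    by (rule AE_not_in)
  then show ?thesis
    by (rule eventually_mono) auto
qed

lemma integral_spec_measure_bounds:
  assumes u: "bounded_borel u" and AE: "AE t in spec_measure E f. a \<le> u t \<and> u t \<le> b"
  shows "a * (norm f)\<^sup>2 \<le> (\<integral>t. u t \<partial>spec_measure E f)" "(\<integral>t. u t \<partial>spec_measure E f) \<le> b * (norm f)\<^sup>2"
proof -
  have int: "integrable (spec_measure E f) u" "\<And>r::real. integrable (spec_measure E f) (\<lambda>t. r)"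
    by (intro integrable_bounded_borel finite_borel_spec_measure u bounded_borel_const)+
  have "(\<integral>t. a \<partial>spec_measure E f) \<le> (\<integral>t. u t \<partial>spec_measure E f)"
    by (rule integral_mono_AE[OF int(2,1)]) (use AE in \<open>auto elim: eventually_mono\<close>)
  moreover have "(\<integral>t. u t \<partial>spec_measure E f) \<le> (\<integral>t. b \<partial>spec_measure E f)"
    by (rule integral_mono_AE[OF int(1,2)]) (use AE in \<open>auto elim: eventually_mono\<close>)
  ultimately show "a * (norm f)\<^sup>2 \<le> (\<integral>t. u t \<partial>spec_measure E f)" "(\<integral>t. u t \<partial>spec_measure E f) \<le> b * (norm f)\<^sup>2"
    by (simp_all add: measure_spec_measure_UNIV mult.commute)
qed

end

text \<open>The family of \<open>A\<close> is cut at the points \<open>1 / (j \<epsilon>)\<close>. On each slice both \<open>A\<close> and \<open>\<integral> 1/t dE\<^sub>t\<close> lie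
  between \<open>j \<epsilon>\<close> and \<open>(j + 1) \<epsilon>\<close>, and both commute with the cuts; hence they differ by at most \<open>\<epsilon>\<close>
  on the whole space.\<close>

theorem spectral_theorem_inverse:
  fixes A :: "'h::chilbert_space \<Rightarrow> 'h"
  assumes A: "bounded_linear A" and sym: "\<And>x y. cinner (A x) y = cinner x (A y)"
    and pos: "\<And>x. x \<noteq> 0 \<Longrightarrow> 0 < inner (A x) x"
  obtains E where "spectral_family E" "range (\<lambda>h. (A h, h)) = spec_operator E (\<lambda>t. t)"
proof -
  obtain E c where E: "spectral_family E" and A_E: "\<And>t f. A (E t f) = E t (A f)"
    and upper: "\<And>t f. 0 < t \<Longrightarrow> (norm (E t f))\<^sup>2 \<le> t * inner (A (E t f)) (E t f)"
    and lower: "\<And>t f. 0 < t \<Longrightarrow> t * inner (A (f - E t f)) (f - E t f) \<le> (norm (f - E t f))\<^sup>2"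
    and c: "0 < c" and E_zero: "\<And>t f. t \<le> c \<Longrightarrow> E t f = 0"
    using spectral_family_of_inverse_exists[OF assms] by blast
  interpret A: bounded_linear A by (rule A)
  interpret spectral_resolution E
    by unfold_locales (rule E)
  have A_sym: "inner (A x) y = inner x (A y)" for x y
    by (simp add: inner_eq_Re_cinner sym)
  define v where "v t = (if c \<le> t then 1 / t else 0)" for t
  have v_nonneg: "0 \<le> v t" for t
    using c by (simp add: v_def)
  have v: "bounded_borel v"
    using c by (intro bounded_borelI[of _ "1 / c"]) (auto simp: v_def[abs_def] frac_le)
  have AE_c: "AE t in spec_measure E f. c < t" for f
    by (rule AE_greater_if_E_zero) (simp add: E_zero)
  define B where "B = fcalc v"
  have B_E: "B (E t f) = E t (B f)" for t f
    using fcalc_commute[OF v bounded_borel_indicator[of "{..t}"], of f] by (simp add: B_def fcalc_half_line)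
  have B_sym: "inner (B x) y = inner x (B y)" for x y
    by (simp add: B_def inner_eq_Re_cinner fcalc_csym[OF v])
  define D where "D x = A x - B x" for x
  have D_add: "D (x + y) = D x + D y" for x y
    by (simp add: D_def A.add B_def fcalc_add[OF v])
  have D_E: "D (E t x) = E t (D x)" for t x
    by (simp add: D_def A_E B_E E_diff)
  have D_sym: "inner (D x) y = inner x (D y)" for x y
    by (simp add: D_def inner_diff_left inner_diff_right A_sym B_sym)
  have E_sym: "inner (E t x) y = inner x (E t y)" for t x y
    by (simp add: inner_eq_Re_cinner E_csym)
  have D_small: "\<bar>inner (D f) f\<bar> \<le> 1 / (c * real N) * (norm f)\<^sup>2" if N: "0 < N" for N f
  proof -
    define e where "e = 1 / (c * real N)"
    have e: "0 < e"
      using c N by (simp add: e_def)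
    define y where "y j = (if j = 0 then f else E (1 / (real j * e)) f)" for j
    have y_Suc: "y (Suc j) = E (1 / (real (Suc j) * e)) (y j)" for j
    proof (cases "j = 0")
      case False
      then have "1 / (real (Suc j) * e) \<le> 1 / (real j * e)"
        using e by (intro frac_le) auto
      then show ?thesis
        using False by (simp add: y_def E_comp min_absorb1)
    qed (simp add: y_def)
    have y_fix: "E (1 / (real j * e)) (y j) = y j" if "0 < j" for j
      using that by (simp add: y_def E_idem)
    have y_N: "y N = 0"
    proof -
      have "1 / (real N * e) = c"
        using N c by (simp add: e_def)
      then show ?thesis
        using N by (simp add: y_def E_zero)
    qed
    have "\<bar>inner (D f) f - inner (D (y j)) (y j)\<bar> \<le> e * ((norm f)\<^sup>2 - (norm (y j))\<^sup>2)" for j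
    proof (induction j)
      case 0
      then show ?case by (simp add: y_def)
    next
      case (Suc j)
      define t where "t = 1 / (real (Suc j) * e)"
      have t: "0 < t"
        using e by (simp add: t_def)
      define x where "x = y j - y (Suc j)"
      have x: "x = y j - E t (y j)"
        by (simp add: x_def y_Suc t_def)
      have E_t_x: "E t x = 0"
        by (simp add: x E_diff E_idem)
      have orth: "inner (E t z) x = 0" for z
        by (simp add: E_sym E_t_x)
      have split: "y j = y (Suc j) + x"
        by (simp add: x_def)
      have "inner (y (Suc j)) x = 0"
        unfolding y_Suc t_def[symmetric] by (rule orth)
      then have norm: "(norm (y j))\<^sup>2 = (norm (y (Suc j)))\<^sup>2 + (norm x)\<^sup>2"
        unfolding split using norm_add_Pythagorean[of "y (Suc j)" x] by (simp add: orthogonal_def)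
      have "inner (D (y j)) (y j) = inner (D (y (Suc j))) (y (Suc j)) + inner (D x) x"
      proof -
        have 1: "inner (D (y (Suc j))) x = 0"
          unfolding y_Suc t_def[symmetric] D_E by (rule orth)
        then have "inner (D x) (y (Suc j)) = 0"
          using D_sym[of x "y (Suc j)"] inner_commute[of x "D (y (Suc j))"] by simp
        with 1 show ?thesis
          unfolding split by (simp add: D_add inner_add_left inner_add_right)
      qed
      moreover have "\<bar>inner (D x) x\<bar> \<le> e * (norm x)\<^sup>2"
      proof -
        have "t * inner (A x) x \<le> (norm x)\<^sup>2"
          using lower[OF t, of "y j"] by (simp add: x)
        then have A_upper: "inner (A x) x \<le> real (Suc j) * e * (norm x)\<^sup>2"
        proof -
          have "0 < real (Suc j) * e"
            using e by simp
          then show ?thesis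
            using \<open>t * inner (A x) x \<le> (norm x)\<^sup>2\<close> pos_divide_le_eq[of "real (Suc j) * e" "inner (A x) x"]
            unfolding t_def by (simp add: mult.commute)
        qed
        have A_lower: "real j * e * (norm x)\<^sup>2 \<le> inner (A x) x"
        proof (cases "j = 0")
          case True
          then show ?thesis
            using pos[of x] by (cases "x = 0") auto
        next
          case False
          have "E (1 / (real j * e)) x = x"
            using y_fix[of j] False by (simp add: x E_diff) (metis E_comp min.commute)
          then have "(norm x)\<^sup>2 \<le> 1 / (real j * e) * inner (A x) x"
            using upper[of "1 / (real j * e)" x] False e by simp
          then show ?thesis
            using False e by (simp add: field_simps)
        qed
        have AE_lower: "AE s in spec_measure E x. real j * e \<le> v s"
        proof (cases "j = 0")
          case True
          then show ?thesis
            by (simp add: v_nonneg)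
        next
          case False
          have "E (1 / (real j * e)) x = x"
            using y_fix[of j] False by (simp add: x E_diff) (metis E_comp min.commute)
          from AE_le_if_E_fixes[OF this] AE_c[of x] show ?thesis
          proof eventually_elim
            case (elim s)
            then show ?case
              using False e c by (simp add: v_def field_simps)
          qed
        qed
        have "AE s in spec_measure E x. v s \<le> real (Suc j) * e"
          using AE_greater_if_E_zero[OF E_t_x] AE_c[of x]
        proof eventually_elim
          case (elim s)
          have "1 / s \<le> 1 / t"
            using elim t by (intro frac_le) auto
          then show ?case
            using elim by (simp add: v_def t_def)
        qed
        with AE_lower have "AE s in spec_measure E x. real j * e \<le> v s \<and> v s \<le> real (Suc j) * e"
          by eventually_elim simp
        note B_bounds = integral_spec_measure_bounds[OF v this]
        have "inner (D x) x = inner (A x) x - (\<integral>s. v s \<partial>spec_measure E x)"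
          by (simp add: D_def inner_diff_left B_def fcalc_inner[OF v])
        moreover have "real (Suc j) * e * (norm x)\<^sup>2 = real j * e * (norm x)\<^sup>2 + e * (norm x)\<^sup>2"
          by (simp add: algebra_simps)
        ultimately show ?thesis
          using A_upper A_lower B_bounds unfolding abs_le_iff by argo
      qed
      moreover have "e * ((norm f)\<^sup>2 - (norm (y (Suc j)))\<^sup>2) = e * ((norm f)\<^sup>2 - (norm (y j))\<^sup>2) + e * (norm x)\<^sup>2"
        by (simp add: norm algebra_simps)
      ultimately show ?case
        using Suc unfolding abs_le_iff by argo
    qed
    from this[of N] show ?thesis
      by (simp add: y_N e_def D_def A.zero)
  qed
  have D_zero: "inner (D f) f = 0" for f
  proof -
    have "(\<lambda>n. 1 / (c * real (Suc n)) * (norm f)\<^sup>2) \<longlonglongrightarrow> 0"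
    proof -
      have "(\<lambda>n. inverse (real (Suc n)) * ((norm f)\<^sup>2 / c)) \<longlonglongrightarrow> 0 * ((norm f)\<^sup>2 / c)"
        by (intro tendsto_intros LIMSEQ_inverse_real_of_nat)
      then show ?thesis
        by (simp add: field_simps)
    qed
    then have "\<bar>inner (D f) f\<bar> \<le> 0"
      by (rule LIMSEQ_le_const) (use D_small[OF zero_less_Suc] in blast)
    then show ?thesis
      by simp
  qed
  have "D x = 0" for x
  proof -
    have "inner (D (x + D x)) (x + D x) = 2 * inner (D x) (D x)"
      using D_zero[of x] D_zero[of "D x"] D_sym[of "D x" x]
      by (simp add: D_add inner_add_left inner_add_right)
    then show ?thesis
      by (simp add: D_zero)
  qed
  then have "A = fcalc v"
    by (auto simp: D_def B_def)
  moreover have "spec_operator E (\<lambda>t. t) = range (\<lambda>h. (fcalc v h, h))"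
  proof (rule spec_operator_inverse[OF _ v])
    show "AE t in spec_measure E f. t * v t = 1" for f
      using AE_c[of f] by eventually_elim (use c in \<open>simp add: v_def\<close>)
  qed simp
  ultimately show ?thesis
    using that[OF E] by simp
qed

section \<open>The generalized frame operator\<close>

lemma frame_integral_ambient:
  "frame_integral \<mu> ambient \<phi> f = (\<integral>\<^sup>+x. ennreal ((cmod (cinner f (\<phi> x)))\<^sup>2) \<partial>\<mu>)"
  by (simp add: frame_integral_def ambient_def)

locale dense_lower_semi_frame =
  fixes \<mu> :: "'x measure" and \<phi> :: "'x \<Rightarrow> 'h::chilbert_space" and c :: real
  assumes weak_meas: "\<And>f. (\<lambda>x. cinner f (\<phi> x)) \<in> borel_measurable \<mu>"
    and c_pos: "0 < c"
    and lower_bound: "\<And>f. ennreal (c * (norm f)\<^sup>2) \<le> frame_integral \<mu> ambient \<phi> f"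
    and dense: "closure (analysis_domain \<mu> \<phi>) = UNIV"
begin

text \<open>The frame integral is \<open>\<Omega>\<^sub>\<phi>(f, f)\<close> on the form domain and \<open>\<infinity>\<close> outside.\<close>

abbreviation "q \<equiv> frame_integral \<mu> ambient \<phi>"
abbreviation "D \<equiv> analysis_domain \<mu> \<phi>"
abbreviation "\<Omega> \<equiv> frame_form \<mu> \<phi>"

lemma D_iff: "f \<in> D \<longleftrightarrow> q f < \<infinity>"
  by (simp add: analysis_domain_def frame_integral_ambient)

lemma form_integrand: "cinner f (\<phi> x) * cinner (\<phi> x) g = cinner f (\<phi> x) * cnj (cinner g (\<phi> x))"
  by (metis cinner_commute)

lemma weak_meas_cnj: "(\<lambda>x. cnj (cinner f (\<phi> x))) \<in> borel_measurable \<mu>"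
  using weak_meas[of f]
  by (rule measurable_compose) (intro borel_measurable_continuous_onI continuous_intros)

lemma energy_add_le: "q (f + g) \<le> 2 * q f + 2 * q g"
proof -
  have "ennreal ((cmod (a + b))\<^sup>2) \<le> 2 * ennreal ((cmod a)\<^sup>2) + 2 * ennreal ((cmod b)\<^sup>2)" for a b
  proof -
    have "(cmod (a + b))\<^sup>2 \<le> (cmod a + cmod b)\<^sup>2"
      by (intro power_mono norm_triangle_ineq) simp
    also have "\<dots> \<le> 2 * (cmod a)\<^sup>2 + 2 * (cmod b)\<^sup>2"
      using zero_le_power2[of "cmod a - cmod b"] by (simp add: power2_eq_square algebra_simps)
    finally have "ennreal ((cmod (a + b))\<^sup>2) \<le> ennreal (2 * (cmod a)\<^sup>2 + 2 * (cmod b)\<^sup>2)"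
      by (rule ennreal_leI)
    then show ?thesis
      by (simp add: ennreal_plus ennreal_mult')
  qed
  then have "q (f + g) \<le> (\<integral>\<^sup>+x. 2 * ennreal ((cmod (cinner f (\<phi> x)))\<^sup>2) + 2 * ennreal ((cmod (cinner g (\<phi> x)))\<^sup>2) \<partial>\<mu>)"
    unfolding frame_integral_ambient by (intro nn_integral_mono) (simp add: cinner_add_left)
  also have "\<dots> = 2 * q f + 2 * q g"
    using weak_meas[of f] weak_meas[of g]
    by (simp add: frame_integral_ambient nn_integral_add nn_integral_cmult)
  finally show ?thesis .
qed

lemma energy_scaleC: "q (a *\<^sub>C f) = ennreal ((cmod a)\<^sup>2) * q f"
  using weak_meas[of f]
  by (simp add: frame_integral_ambient cinner_scaleC_left norm_mult power_mult_distrib ennreal_mult' nn_integral_cmult)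

lemma D_add: "f \<in> D \<Longrightarrow> g \<in> D \<Longrightarrow> f + g \<in> D"
  using energy_add_le[of f g] by (auto simp: D_iff ennreal_mult_less_top intro: le_less_trans)

lemma D_scaleC: "f \<in> D \<Longrightarrow> a *\<^sub>C f \<in> D"
  by (simp add: D_iff energy_scaleC ennreal_mult_less_top)

lemma D_scaleR: "f \<in> D \<Longrightarrow> r *\<^sub>R f \<in> D"
  using D_scaleC[of f "of_real r"] by (simp add: scaleC_of_real)

lemma D_zero: "0 \<in> D"
  by (simp add: D_iff frame_integral_ambient)

lemma D_diff: "f \<in> D \<Longrightarrow> g \<in> D \<Longrightarrow> f - g \<in> D"
  using D_add[of f "(-1) *\<^sub>R g"] D_scaleR[of g "-1"] by simp

lemma form_integrable:
  assumes "f \<in> D" "g \<in> D"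
  shows "integrable \<mu> (\<lambda>x. cinner f (\<phi> x) * cinner (\<phi> x) g)"
  unfolding form_integrand integrable_iff_bounded
proof
  show "(\<lambda>x. cinner f (\<phi> x) * cnj (cinner g (\<phi> x))) \<in> borel_measurable \<mu>"
    by (intro borel_measurable_times weak_meas weak_meas_cnj)
  have "(\<integral>\<^sup>+x. ennreal (norm (cinner f (\<phi> x) * cnj (cinner g (\<phi> x)))) \<partial>\<mu>)
      \<le> (\<integral>\<^sup>+x. ennreal ((cmod (cinner f (\<phi> x)))\<^sup>2) + ennreal ((cmod (cinner g (\<phi> x)))\<^sup>2) \<partial>\<mu>)"
  proof (intro nn_integral_mono)
    fix x
    have "a * b \<le> a\<^sup>2 + b\<^sup>2" for a b :: real
      using zero_le_power2[of "a - b"] zero_le_power2[of a] zero_le_power2[of b]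
      unfolding power2_diff by argo
    then show "ennreal (norm (cinner f (\<phi> x) * cnj (cinner g (\<phi> x))))
        \<le> ennreal ((cmod (cinner f (\<phi> x)))\<^sup>2) + ennreal ((cmod (cinner g (\<phi> x)))\<^sup>2)"
      by (simp add: norm_mult ennreal_plus[symmetric] ennreal_leI del: ennreal_plus)
  qed
  also have "\<dots> = q f + q g"
    using weak_meas[of f] weak_meas[of g] by (simp add: frame_integral_ambient nn_integral_add)
  also have "\<dots> < \<infinity>"
    using assms by (simp add: D_iff)
  finally show "(\<integral>\<^sup>+x. ennreal (norm (cinner f (\<phi> x) * cnj (cinner g (\<phi> x)))) \<partial>\<mu>) < \<infinity>" .
qed

lemma form_add: "f \<in> D \<Longrightarrow> g \<in> D \<Longrightarrow> h \<in> D \<Longrightarrow> \<Omega> (f + g) h = \<Omega> f h + \<Omega> g h"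
  by (simp add: frame_form_def cinner_add_left distrib_right form_integrable)

lemma form_diff: "f \<in> D \<Longrightarrow> g \<in> D \<Longrightarrow> h \<in> D \<Longrightarrow> \<Omega> (f - g) h = \<Omega> f h - \<Omega> g h"
  by (simp add: frame_form_def cinner_diff_left left_diff_distrib form_integrable)

lemma form_scaleR: "\<Omega> (r *\<^sub>R f) h = of_real r * \<Omega> f h"
  by (simp add: frame_form_def cinner_scaleR_left mult.assoc)

lemma form_scaleC_right: "\<Omega> f (a *\<^sub>C h) = cnj a * \<Omega> f h"
  by (simp add: frame_form_def cinner_scaleC_right mult.left_commute)

lemma form_cnj: "\<Omega> g f = cnj (\<Omega> f g)"
  unfolding frame_form_def form_integrand
  by (subst Bochner_Integration.integral_cnj[symmetric]) (simp only: complex_cnj_mult complex_cnj_cnj mult.commute)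

lemma form_diff_right: "f \<in> D \<Longrightarrow> g \<in> D \<Longrightarrow> h \<in> D \<Longrightarrow> \<Omega> h (f - g) = \<Omega> h f - \<Omega> h g"
  using form_diff[of f g h] by (simp add: form_cnj[of h])

lemma energy_eq_form:
  assumes "f \<in> D"
  shows "q f = ennreal (Re (\<Omega> f f))" "0 \<le> Re (\<Omega> f f)"
proof -
  have eq: "cinner f (\<phi> x) * cinner (\<phi> x) f = complex_of_real ((cmod (cinner f (\<phi> x)))\<^sup>2)" for x
    unfolding form_integrand by (rule complex_norm_square[symmetric])
  have "integrable \<mu> (\<lambda>x. Re (complex_of_real ((cmod (cinner f (\<phi> x)))\<^sup>2)))"
    using form_integrable[OF assms assms] unfolding eq by (rule integrable_Re)
  then have int: "integrable \<mu> (\<lambda>x. (cmod (cinner f (\<phi> x)))\<^sup>2)"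
    unfolding Re_complex_of_real .
  have "\<Omega> f f = complex_of_real (\<integral>x. (cmod (cinner f (\<phi> x)))\<^sup>2 \<partial>\<mu>)"
    unfolding frame_form_def eq by (rule integral_complex_of_real)
  then have Re: "Re (\<Omega> f f) = (\<integral>x. (cmod (cinner f (\<phi> x)))\<^sup>2 \<partial>\<mu>)"
    by simp
  show "q f = ennreal (Re (\<Omega> f f))" "0 \<le> Re (\<Omega> f f)"
    unfolding Re frame_integral_ambient by (auto intro!: nn_integral_eq_integral int)
qed

lemma form_lower_bound:
  assumes "f \<in> D"
  shows "c * (norm f)\<^sup>2 \<le> Re (\<Omega> f f)"
  using lower_bound[of f] energy_eq_form[OF assms] c_pos by simp

text \<open>Fatou: the extended quadratic form is lower semicontinuous, even for weak convergence.\<close>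

lemma energy_le_if_weak_limit:
  assumes lim: "\<And>x. (\<lambda>n. cinner (X n) x) \<longlonglongrightarrow> cinner f x" and le: "\<And>n. N \<le> n \<Longrightarrow> q (X n) \<le> C"
  shows "q f \<le> C"
proof -
  have "q f = (\<integral>\<^sup>+x. liminf (\<lambda>n. ennreal ((cmod (cinner (X (n + N)) (\<phi> x)))\<^sup>2)) \<partial>\<mu>)"
    unfolding frame_integral_ambient
  proof (intro nn_integral_cong lim_imp_Liminf[symmetric])
    fix x
    have "(\<lambda>n. cinner (X (n + N)) (\<phi> x)) \<longlonglongrightarrow> cinner f (\<phi> x)"
      using lim by (rule LIMSEQ_ignore_initial_segment)
    then show "(\<lambda>n. ennreal ((cmod (cinner (X (n + N)) (\<phi> x)))\<^sup>2)) \<longlonglongrightarrow> ennreal ((cmod (cinner f (\<phi> x)))\<^sup>2)"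
      by (intro tendsto_intros tendsto_ennrealI)
  qed simp
  also have "\<dots> \<le> liminf (\<lambda>n. q (X (n + N)))"
    unfolding frame_integral_ambient
    by (intro nn_integral_liminf) (use weak_meas in \<open>measurable\<close>)
  also have "\<dots> \<le> liminf (\<lambda>n. C)"
    using le by (intro Liminf_mono always_eventually) simp
  finally show ?thesis
    by (simp add: Liminf_const)
qed

text \<open>The form is closed, so that \<open>\<langle>h, \<cdot>\<rangle>\<close> is represented by a vector \<open>A h\<close> of the form domain. This
  \<open>A\<close> is the bounded inverse of the frame operator.\<close>

lemma frame_operator_inverse:
  obtains A where "bounded_linear A" "\<And>x y. cinner (A x) y = cinner x (A y)"
    "\<And>x. x \<noteq> 0 \<Longrightarrow> 0 < inner (A x) x" "frame_operator \<mu> \<phi> = range (\<lambda>h. (A h, h))"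
proof -
  have "\<exists>u\<in>D. \<forall>g\<in>D. Re (\<Omega> u g) = Re (cinner h g)" for h
  proof (rule riesz_representation_form[where K="(norm h)\<^sup>2 / c"])
    show "subspace D"
      by (rule subspaceI) (simp_all add: D_zero D_add D_scaleR)
    show "Re (\<Omega> x y) = Re (\<Omega> y x)" for x y
      using form_cnj[of x y] by simp
    fix X :: "nat \<Rightarrow> 'h"
    assume X: "\<And>n. X n \<in> D"
      and cauchy: "\<And>e. 0 < e \<Longrightarrow> \<exists>N. \<forall>m\<ge>N. \<forall>n\<ge>N. Re (\<Omega> (X m - X n) (X m - X n)) < e"
    have "Cauchy X"
    proof (rule metric_CauchyI)
      fix e :: real assume e: "0 < e"
      then obtain N where N: "\<forall>m\<ge>N. \<forall>n\<ge>N. Re (\<Omega> (X m - X n) (X m - X n)) < c * e\<^sup>2"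
        using cauchy[of "c * e\<^sup>2"] c_pos by auto
      have "dist (X m) (X n) < e" if "m \<ge> N" "n \<ge> N" for m n
      proof -
        have "c * (norm (X m - X n))\<^sup>2 < c * e\<^sup>2"
          using form_lower_bound[OF D_diff[OF X X], of m n] N that by fastforce
        then show ?thesis
          using e c_pos power2_less_imp_less[of "norm (X m - X n)" e] by (simp add: dist_norm)
      qed
      then show "\<exists>N. \<forall>m\<ge>N. \<forall>n\<ge>N. dist (X m) (X n) < e"
        by blast
    qed
    then obtain u where lim: "X \<longlonglongrightarrow> u"
      using Cauchy_convergent_iff convergent_def by blast
    have close: "\<exists>N. \<forall>n\<ge>N. q (X n - u) \<le> ennreal e" if e: "0 < e" for e
    proof -
      obtain N where N: "\<forall>m\<ge>N. \<forall>n\<ge>N. Re (\<Omega> (X m - X n) (X m - X n)) < e"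
        using cauchy[OF e] by blast
      have "q (X n - u) \<le> ennreal e" if n: "N \<le> n" for n
      proof (rule energy_le_if_weak_limit)
        have "(\<lambda>m. X n - X m) \<longlonglongrightarrow> X n - u"
          using lim by (intro tendsto_intros)
        then show "(\<lambda>m. cinner (X n - X m) x) \<longlonglongrightarrow> cinner (X n - u) x" for x
          by (rule bounded_linear.tendsto[OF bounded_linear_cinner_left])
        show "q (X n - X m) \<le> ennreal e" if "N \<le> m" for m
          using N n that energy_eq_form(1)[OF D_diff[OF X X], of n m] by (simp add: ennreal_leI less_imp_le)
      qed
      then show ?thesis
        by blast
    qed
    then obtain N where "q (X N - u) \<le> ennreal 1"
      using close[of 1] by auto
    then have "X N - u \<in> D"
      by (auto simp: D_iff intro: le_less_trans)
    then have u: "u \<in> D"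
      using D_diff[OF X[of N], of "X N - u"] by simp
    have "(\<lambda>n. Re (\<Omega> (X n - u) (X n - u))) \<longlonglongrightarrow> 0"
    proof (rule LIMSEQ_I)
      fix e :: real assume e: "0 < e"
      then obtain N where N: "\<forall>n\<ge>N. q (X n - u) \<le> ennreal (e / 2)"
        using close[of "e / 2"] by auto
      have "norm (Re (\<Omega> (X n - u) (X n - u)) - 0) < e" if "N \<le> n" for n
      proof -
        have "Re (\<Omega> (X n - u) (X n - u)) \<le> e / 2"
          using N that e energy_eq_form(1)[OF D_diff[OF X u], of n] by auto
        then show ?thesis
          using energy_eq_form(2)[OF D_diff[OF X u], of n] e by simp
      qed
      then show "\<exists>N. \<forall>n\<ge>N. norm (Re (\<Omega> (X n - u) (X n - u)) - 0) < e"
        by blast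
    qed
    then show "\<exists>u\<in>D. (\<lambda>n. Re (\<Omega> (X n - u) (X n - u))) \<longlonglongrightarrow> 0"
      using u by blast
  next
    fix x assume "x \<in> D"
    have "(Re (cinner h x))\<^sup>2 \<le> (norm h * norm x)\<^sup>2"
      using Cauchy_Schwarz_ineq2[of h x] by (intro abs_le_square_iff[THEN iffD1]) (simp add: inner_eq_Re_cinner)
    also have "\<dots> = (norm h)\<^sup>2 / c * (c * (norm x)\<^sup>2)"
      using c_pos by (simp add: power_mult_distrib)
    also have "\<dots> \<le> (norm h)\<^sup>2 / c * Re (\<Omega> x x)"
      using c_pos form_lower_bound[OF \<open>x \<in> D\<close>] by (intro mult_left_mono) auto
    finally show "(Re (cinner h x))\<^sup>2 \<le> (norm h)\<^sup>2 / c * Re (\<Omega> x x)" .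
  qed (simp_all add: form_add form_scaleR cinner_add_right cinner_scaleR_right energy_eq_form(2))
  then obtain A where A_D: "\<And>h. A h \<in> D" and A_Re: "\<And>h g. g \<in> D \<Longrightarrow> Re (\<Omega> (A h) g) = Re (cinner h g)"
    by metis
  have A_form: "\<Omega> (A h) g = cinner h g" if g: "g \<in> D" for h g
  proof (rule complex_eqI)
    show "Re (\<Omega> (A h) g) = Re (cinner h g)"
      by (rule A_Re[OF g])
    show "Im (\<Omega> (A h) g) = Im (cinner h g)"
      using A_Re[OF D_scaleC[OF g], of h \<i>] by (simp add: form_scaleC_right cinner_scaleC_right)
  qed
  have A_sym: "cinner (A x) y = cinner x (A y)" for x y
    using A_form[OF A_D, of y x] A_form[OF A_D, of x y] form_cnj[of "A x" "A y"] cinner_commute[of "A x" y]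
    by simp
  have A_ge: "c * (norm (A x))\<^sup>2 \<le> inner (A x) x" for x
    using form_lower_bound[OF A_D[of x]] A_form[OF A_D[of x], of x]
    by (simp add: inner_eq_Re_cinner A_sym)
  have "bounded_linear A"
  proof (rule bounded_linear_intro[of _ "1 / c"])
    show "A (x + y) = A x + A y" for x y
      by (rule cinner_ext) (simp add: A_sym cinner_add_left)
    show "A (r *\<^sub>R x) = r *\<^sub>R A x" for r x
      by (rule cinner_ext) (simp add: A_sym cinner_scaleR_left)
    show "norm (A x) \<le> norm x * (1 / c)" for x
    proof (cases "A x = 0")
      case False
      have "(c * norm (A x)) * norm (A x) \<le> norm x * norm (A x)"
        using A_ge[of x] norm_cauchy_schwarz[of "A x" x] by (simp add: power2_eq_square mult_ac)
      then have "c * norm (A x) \<le> norm x"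
        using False by (simp add: mult_right_le_imp_le)
      then show ?thesis
        using c_pos by (simp add: field_simps)
    qed (use c_pos in simp)
  qed
  moreover have "0 < inner (A x) x" if "x \<noteq> 0" for x
  proof -
    have "A x \<noteq> 0"
    proof
      assume "A x = 0"
      then have "cinner x g = cinner 0 g" if "g \<in> D" for g
        using A_form[OF that, of x] form_scaleR[of 0 0 g] by simp
      then have "x = 0"
        using dense by (rule cinner_ext_dense)
      then show False
        using that by simp
    qed
    then have "0 < c * (norm (A x))\<^sup>2"
      using c_pos by simp
    then show ?thesis
      using A_ge by (rule less_le_trans)
  qed
  moreover have "frame_operator \<mu> \<phi> = range (\<lambda>h. (A h, h))"
  proof (intro equalityI subsetI)
    fix p assume "p \<in> frame_operator \<mu> \<phi>"
    then obtain f h where p: "p = (f, h)" and f: "f \<in> D" and form: "\<And>g. g \<in> D \<Longrightarrow> \<Omega> f g = cinner h g"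
      by (auto simp: frame_operator_def assoc_operator_def)
    have d: "f - A h \<in> D"
      using f A_D by (rule D_diff)
    have "\<Omega> (f - A h) (f - A h) = 0"
      using form_diff[OF f A_D d] by (simp add: form[OF d] A_form[OF d])
    then have "f = A h"
      using form_lower_bound[OF d] c_pos by (simp add: mult_le_0_iff)
    then show "p \<in> range (\<lambda>h. (A h, h))"
      by (simp add: p)
  qed (auto simp: frame_operator_def assoc_operator_def A_D A_form)
  ultimately show ?thesis
    using that A_sym by blast
qed

definition E :: "real \<Rightarrow> 'h \<Rightarrow> 'h" where
  "E = spectral_family_of (frame_operator \<mu> \<phi>)"

lemma E_spectral_family: "spectral_family E" and frame_operator_eq: "frame_operator \<mu> \<phi> = spec_operator E (\<lambda>t. t)"
proof -
  obtain A where A: "bounded_linear A" "\<And>x y. cinner (A x) y = cinner x (A y)"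
    "\<And>x. x \<noteq> 0 \<Longrightarrow> 0 < inner (A x) x" and T: "frame_operator \<mu> \<phi> = range (\<lambda>h. (A h, h))"
    using frame_operator_inverse by blast
  obtain F where "spectral_family F" "frame_operator \<mu> \<phi> = spec_operator F (\<lambda>t. t)"
    using spectral_theorem_inverse[OF A] unfolding T by blast
  then have "spectral_family F \<and> frame_operator \<mu> \<phi> = spec_operator F (\<lambda>t. t)"
    by blast
  then have "spectral_family E \<and> frame_operator \<mu> \<phi> = spec_operator E (\<lambda>t. t)"
    unfolding E_def spectral_family_of_def
    by (rule someI[where P="\<lambda>E. spectral_family E \<and> frame_operator \<mu> \<phi> = spec_operator E (\<lambda>t. t)"])
  then show "spectral_family E" "frame_operator \<mu> \<phi> = spec_operator E (\<lambda>t. t)"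
    by auto
qed

sublocale spectral_resolution E
  by unfold_locales (rule E_spectral_family)

lemma fcalc_in_D:
  assumes w: "bounded_borel w" and tw: "bounded_borel (\<lambda>t. t * w t)"
  shows "fcalc w f \<in> D" "g \<in> D \<Longrightarrow> \<Omega> (fcalc w f) g = cinner (fcalc (\<lambda>t. t * w t) f) g"
proof -
  have "(fcalc w f, fcalc (\<lambda>t. t * w t) f) \<in> frame_operator \<mu> \<phi>"
    unfolding frame_operator_eq by (rule spec_operator_fcalcI[OF _ w tw]) simp
  then show "fcalc w f \<in> D" "g \<in> D \<Longrightarrow> \<Omega> (fcalc w f) g = cinner (fcalc (\<lambda>t. t * w t) f) g"
    by (auto simp: frame_operator_def assoc_operator_def)
qed

lemma form_fcalc:
  assumes w: "bounded_borel w" and tw: "bounded_borel (\<lambda>t. t * w t)"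
  shows "Re (\<Omega> (fcalc w f) (fcalc w f)) = (\<integral>t. t * (w t)\<^sup>2 \<partial>spec_measure E f)"
proof -
  have "Re (\<Omega> (fcalc w f) (fcalc w f)) = inner (fcalc (\<lambda>t. t * w t) f) (fcalc w f)"
    by (simp add: fcalc_in_D(2)[OF w tw fcalc_in_D(1)[OF w tw]] inner_eq_Re_cinner)
  also have "\<dots> = inner (fcalc (\<lambda>t. w t * (t * w t)) f) f"
    by (simp add: inner_eq_Re_cinner fcalc_csym[OF w, symmetric] fcalc_fcalc[OF w tw])
  also have "\<dots> = (\<integral>t. t * (w t)\<^sup>2 \<partial>spec_measure E f)"
    using fcalc_inner[OF bounded_borel_mult[OF w tw]] by (simp add: power2_eq_square mult_ac)
  finally show ?thesis .
qed

text \<open>A nonzero vector \<open>x\<close> with spectrum in a bounded part of \<open>(-\<infinity>, c)\<close> would satisfy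
  \<open>\<Omega>\<^sub>\<phi>(x, x) < c \<parallel>x\<parallel>\<^sup>2\<close>, against the lower bound of the form.\<close>

lemma AE_ge_lower_bound: "AE t in spec_measure E f. c \<le> t"
proof -
  have "AE t in spec_measure E f. \<not> (- real n \<le> t \<and> t < c)" for n
  proof -
    define w where "w = (indicator {- real n..<c} :: real \<Rightarrow> real)"
    have w: "bounded_borel w"
      unfolding w_def by (intro bounded_borel_indicator) simp
    have tw: "bounded_borel (\<lambda>t. t * w t)"
      using c_pos unfolding w_def
      by (intro bounded_borelI[of _ "real n + c"]) (auto simp: indicator_def)
    have w2: "(w t)\<^sup>2 = w t" for t
      by (simp add: w_def indicator_def)
    have int: "integrable (spec_measure E f) w" "integrable (spec_measure E f) (\<lambda>t. t * w t)"
      using w tw by (auto intro: integrable_bounded_borel finite_borel_spec_measure)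
    have "c * (norm (fcalc w f))\<^sup>2 \<le> Re (\<Omega> (fcalc w f) (fcalc w f))"
      by (rule form_lower_bound[OF fcalc_in_D(1)[OF w tw]])
    then have "(\<integral>t. c * w t - t * w t \<partial>spec_measure E f) \<le> 0"
      using int by (simp add: form_fcalc[OF w tw] norm_fcalc[OF w] w2)
    moreover have nonneg: "0 \<le> c * w t - t * w t" for t
      by (simp add: w_def indicator_def)
    ultimately have "(\<integral>t. c * w t - t * w t \<partial>spec_measure E f) = 0"
      by (intro antisym integral_nonneg_AE) auto
    then have "AE t in spec_measure E f. c * w t - t * w t = 0"
      using int nonneg by (subst (asm) integral_nonneg_eq_0_iff_AE) auto
    then show ?thesis
      by eventually_elim (auto simp: w_def indicator_def)
  qed
  then have "AE t in spec_measure E f. \<forall>n. \<not> (- real n \<le> t \<and> t < c)"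
    by (subst AE_all_countable) blast
  then show ?thesis
  proof eventually_elim
    case (elim t)
    obtain n :: nat where "- t \<le> real n"
      using real_arch_simple by blast
    then show ?case
      using elim by (meson minus_le_iff not_le)
  qed
qed

text \<open>The second representation theorem, \<open>\<Omega>\<^sub>\<phi>(f, f) = \<parallel>T\<^sup>1\<^sup>/\<^sup>2 f\<parallel>\<^sup>2\<close>, including the equality of the domains:
  both sides are limits of their values at the truncations \<open>f\<^sub>n\<close> of \<open>f\<close>, for which they agree.
  One inequality is lower semicontinuity; the other is \<open>0 \<le> \<Omega>\<^sub>\<phi>(f - f\<^sub>n, f - f\<^sub>n)\<close>, because
  \<open>\<Omega>\<^sub>\<phi>(f\<^sub>n, f) = \<Omega>\<^sub>\<phi>(f\<^sub>n, f\<^sub>n)\<close>.\<close>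

theorem energy_eq_spectral_integral: "q f = (\<integral>\<^sup>+t. ennreal t \<partial>spec_measure E f)"
proof -
  define w where "w n = (indicator {t. \<bar>t\<bar> \<le> real n} :: real \<Rightarrow> real)" for n
  define x where "x n = fcalc (w n) f" for n
  have w: "bounded_borel (w n)" for n
    unfolding w_def by (intro bounded_borel_indicator) measurable
  have tw: "bounded_borel (\<lambda>t. t * w n t)" for n
  proof (rule bounded_borelI)
    show "(\<lambda>t. t * w n t) \<in> borel_measurable borel"
      using bounded_borel_measurable[OF w[of n]] by measurable
    show "\<bar>t * w n t\<bar> \<le> real n" for t
      by (simp add: w_def indicator_def)
  qed
  have w2: "(w n t)\<^sup>2 = w n t" for n t
    by (simp add: w_def indicator_def)
  have x_D: "x n \<in> D" for n
    unfolding x_def by (rule fcalc_in_D(1)[OF w tw])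
  define I where "I n = (\<integral>t. t * w n t \<partial>spec_measure E f)" for n
  have Re_x: "Re (\<Omega> (x n) (x n)) = I n" for n
    by (simp add: x_def form_fcalc[OF w tw] w2 I_def)
  have q_x: "q (x n) = ennreal (I n)" for n
    using energy_eq_form(1)[OF x_D] by (simp add: Re_x)
  have I_eq: "ennreal (I n) = (\<integral>\<^sup>+t. ennreal (t * w n t) \<partial>spec_measure E f)" for n
    unfolding I_def
  proof (rule nn_integral_eq_integral[symmetric])
    show "integrable (spec_measure E f) (\<lambda>t. t * w n t)"
      by (rule integrable_bounded_borel[OF finite_borel_spec_measure tw])
    show "AE t in spec_measure E f. 0 \<le> t * w n t"
      using AE_ge_lower_bound[of f] by eventually_elim (use c_pos in \<open>simp add: w_def indicator_def\<close>)
  qed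
  show ?thesis
  proof (rule antisym)
    show "q f \<le> (\<integral>\<^sup>+t. ennreal t \<partial>spec_measure E f)"
    proof (rule energy_le_if_weak_limit)
      show "(\<lambda>n. cinner (x n) g) \<longlonglongrightarrow> cinner f g" for g
        unfolding x_def w_def by (rule tendsto_fcalc_truncation) simp
      show "q (x n) \<le> (\<integral>\<^sup>+t. ennreal t \<partial>spec_measure E f)" for n
        unfolding q_x I_eq
        by (intro nn_integral_mono) (auto simp: w_def indicator_def)
    qed
    show "(\<integral>\<^sup>+t. ennreal t \<partial>spec_measure E f) \<le> q f"
    proof (cases "f \<in> D")
      case False
      then have "q f = \<infinity>"
        using D_iff[of f] top.not_eq_extremum[of "q f"] by auto
      then show ?thesis
        by simp
    next
      case True
      have I_le: "ennreal (I n) \<le> q f" for n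
      proof -
        have cross: "Re (\<Omega> (x n) f) = I n"
          using fcalc_in_D(2)[OF w tw True, of n f] fcalc_inner[OF tw, of n f]
          by (simp add: x_def I_def inner_eq_Re_cinner)
        have d: "f - x n \<in> D"
          using True x_D by (rule D_diff)
        have "\<Omega> (f - x n) (f - x n) = \<Omega> f f - \<Omega> f (x n) - (\<Omega> (x n) f - \<Omega> (x n) (x n))"
          using form_diff[OF True x_D d, of n] form_diff_right[OF True x_D True, of n]
            form_diff_right[OF True x_D x_D, of n n] by simp
        moreover have "Re (\<Omega> f (x n)) = I n"
          using form_cnj[of f "x n"] cross by simp
        ultimately have "I n \<le> Re (\<Omega> f f)"
          using energy_eq_form(2)[OF d] cross Re_x[of n] by simp
        then show ?thesis
          using energy_eq_form(1)[OF True] by (simp add: ennreal_leI)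
      qed
      have "(\<lambda>n. \<integral>\<^sup>+t. ennreal (t * w n t) \<partial>spec_measure E f) \<longlonglongrightarrow> (\<integral>\<^sup>+t. ennreal t \<partial>spec_measure E f)"
      proof (rule nn_integral_LIMSEQ)
        show "incseq (\<lambda>n t. ennreal (t * w n t))"
        proof (rule incseq_SucI, rule le_funI)
          show "ennreal (t * w n t) \<le> ennreal (t * w (Suc n) t)" for n t
            by (cases "0 \<le> t") (auto simp: w_def indicator_def ennreal_neg intro!: ennreal_leI)
        qed
        show "(\<lambda>t. ennreal (t * w n t)) \<in> borel_measurable (spec_measure E f)" for n
          using bounded_borel_measurable[OF tw[of n]] by measurable
        show "(\<lambda>n. ennreal (t * w n t)) \<longlonglongrightarrow> ennreal t" for t
        proof (rule tendsto_eventually)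
          obtain N :: nat where "\<bar>t\<bar> \<le> real N"
            using real_arch_simple by blast
          then show "\<forall>\<^sub>F n in sequentially. ennreal (t * w n t) = ennreal t"
            by (auto simp: eventually_sequentially w_def indicator_def intro!: exI[of _ N])
        qed
      qed
      then show ?thesis
        unfolding I_eq[symmetric] by (rule LIMSEQ_le_const2) (use I_le in blast)
    qed
  qed
qed

section \<open>Powers of the frame operator\<close>

text \<open>\<open>T\<^sup>-\<^sup>a\<close>; the cut at \<open>c\<close> makes the function bounded without changing the operator.\<close>

definition neg_power :: "real \<Rightarrow> real \<Rightarrow> real" where
  "neg_power a t = (if c \<le> t then t powr (- a) else 0)"

abbreviation "R a \<equiv> fcalc (neg_power a)"

lemma neg_power_bounded: "0 \<le> a \<Longrightarrow> bounded_borel (neg_power a)"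
proof (rule bounded_borelI[of _ "c powr (- a)"])
  show "neg_power a \<in> borel_measurable borel"
    unfolding neg_power_def[abs_def] by measurable
  show "\<bar>neg_power a t\<bar> \<le> c powr (- a)" if "0 \<le> a" for t
    using that c_pos by (auto simp: neg_power_def intro: powr_mono2')
qed

lemma R_R: "0 \<le> a \<Longrightarrow> 0 \<le> b \<Longrightarrow> R a (R b f) = R (a + b) f"
proof -
  assume "0 \<le> a" "0 \<le> b"
  moreover have "(\<lambda>t. neg_power a t * neg_power b t) = neg_power (a + b)"
    by (auto simp: neg_power_def fun_eq_iff powr_add[symmetric] add.commute)
  ultimately show ?thesis
    by (simp add: fcalc_fcalc neg_power_bounded)
qed

lemma opower_nonneg:
  assumes "0 \<le> m"
  shows "opower (frame_operator \<mu> \<phi>) m = range (\<lambda>h. (R m h, h))"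
  unfolding opower_def E_def[symmetric]
proof (rule spec_operator_inverse)
  show "AE t in spec_measure E f. t powr m * neg_power m t = 1" for f
    using AE_ge_lower_bound[of f]
    by eventually_elim (use c_pos in \<open>simp add: neg_power_def powr_add[symmetric]\<close>)
qed (use assms neg_power_bounded in auto)

lemma oapply_opower_nonneg:
  assumes "0 \<le> m"
  shows "oapply (opower (frame_operator \<mu> \<phi>) m) (R m h) = h"
  using oapply_spec_operator[of "\<lambda>t. t powr m" "R m h" h] opower_nonneg[OF assms]
  by (auto simp: opower_def E_def[symmetric])

lemma oapply_opower_nonpos:
  assumes "0 \<le> k"
  shows "oapply (opower (frame_operator \<mu> \<phi>) (- k)) f = R k f"
  unfolding opower_def E_def[symmetric]
proof (rule oapply_spec_operator)
  show "(f, R k f) \<in> spec_operator E (\<lambda>t. t powr - k)"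
  proof (rule spec_operator_bounded)
    show "AE t in spec_measure E f. t powr - k = neg_power k t" for f
      using AE_ge_lower_bound[of f] by eventually_elim (simp add: neg_power_def)
  qed (use assms neg_power_bounded in auto)
qed simp

text \<open>\<open>\<parallel>T\<^sup>p\<^sup>/\<^sup>2 g\<parallel>\<^sup>2\<close>, with the value \<open>\<infinity>\<close> outside the domain.\<close>

definition power_energy :: "real \<Rightarrow> 'h \<Rightarrow> ennreal" where
  "power_energy p g = (\<integral>\<^sup>+t. ennreal (t powr p) \<partial>spec_measure E g)"

lemma energy_R:
  assumes "0 \<le> a"
  shows "q (R a g) = power_energy (1 - 2 * a) g"
proof -
  have "q (R a g) = (\<integral>\<^sup>+t. ennreal ((neg_power a t)\<^sup>2) * ennreal t \<partial>spec_measure E g)"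
    unfolding energy_eq_spectral_integral
    by (rule nn_integral_spec_measure_fcalc) (simp_all add: neg_power_bounded assms)
  also have "\<dots> = power_energy (1 - 2 * a) g"
    unfolding power_energy_def
  proof (rule nn_integral_cong_AE)
    show "AE t in spec_measure E g. ennreal ((neg_power a t)\<^sup>2) * ennreal t = ennreal (t powr (1 - 2 * a))"
      using AE_ge_lower_bound[of g]
    proof eventually_elim
      case (elim t)
      then have t: "0 < t" "c \<le> t"
        using c_pos by auto
      have "(t powr (- a))\<^sup>2 * t = t powr (- a) * t powr (- a) * t powr 1"
        using t by (simp add: power2_eq_square)
      also have "\<dots> = t powr (1 - 2 * a)"
        by (simp only: powr_add[symmetric]) simp
      finally show ?case
        using t by (simp add: neg_power_def ennreal_mult'[symmetric])
    qed
  qed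
  finally show ?thesis .
qed

text \<open>With \<open>f = T\<^sup>-\<^sup>m g\<close> one has \<open>\<langle>f, T\<^sup>-\<^sup>k \<phi>\<^sub>x\<rangle>\<^sub>m = \<langle>g, T\<^sup>m\<^sup>-\<^sup>k \<phi>\<^sub>x\<rangle> = \<langle>T\<^sup>m\<^sup>-\<^sup>k g, \<phi>\<^sub>x\<rangle>\<close>, whose square integral is
  \<open>\<parallel>T\<^sup>1\<^sup>/\<^sup>2\<^sup>+\<^sup>m\<^sup>-\<^sup>k g\<parallel>\<^sup>2\<close>.\<close>

context
  fixes m k :: real
  assumes m: "0 \<le> m" and k: "m \<le> k"
begin

lemma carrier_frame_space: "hcarrier (frame_space \<mu> \<phi> m) = range (R m)"
  by (auto simp: power_space_def opower_nonneg[OF m])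

lemma hinner_frame_space: "hinner (frame_space \<mu> \<phi> m) (R m g) (R m h) = cinner g h"
  by (simp add: power_space_def oapply_opower_nonneg[OF m])

lemma hnorm_sq_frame_space: "hnorm_sq (frame_space \<mu> \<phi> m) (R m g) = (norm g)\<^sup>2"
  by (simp add: hnorm_sq_def hinner_frame_space inner_eq_Re_cinner[symmetric] power2_norm_eq_inner)

lemma power_map_eq: "power_map \<mu> \<phi> k x = R m (R (k - m) (\<phi> x))"
  using m k by (simp add: power_map_def oapply_opower_nonpos R_R)

lemma hinner_power_map: "hinner (frame_space \<mu> \<phi> m) (R m g) (power_map \<mu> \<phi> k x) = cinner (R (k - m) g) (\<phi> x)"
  using k by (simp add: power_map_eq hinner_frame_space fcalc_csym neg_power_bounded)

lemma weakly_measurable_power_map: "weakly_measurable \<mu> (frame_space \<mu> \<phi> m) (power_map \<mu> \<phi> k)"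
  unfolding weakly_measurable_def carrier_frame_space
  by (auto simp: hinner_power_map weak_meas) (simp add: power_map_eq)

lemma frame_integral_power_map:
  "frame_integral \<mu> (frame_space \<mu> \<phi> m) (power_map \<mu> \<phi> k) (R m g) = power_energy (1 + 2 * m - 2 * k) g"
  using energy_R[of "k - m" g] k
  by (simp add: frame_integral_ambient) (simp add: frame_integral_def hinner_power_map algebra_simps)

lemma bessel_power_map_iff:
  "bessel_mapping \<mu> (frame_space \<mu> \<phi> m) (power_map \<mu> \<phi> k) \<longleftrightarrow>
    (\<exists>M. \<forall>g. power_energy (1 + 2 * m - 2 * k) g \<le> ennreal (M * (norm g)\<^sup>2))"
  by (simp add: bessel_mapping_def weakly_measurable_power_map carrier_frame_space
      frame_integral_power_map hnorm_sq_frame_space)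

lemma lower_semi_frame_power_map_iff:
  "lower_semi_frame \<mu> (frame_space \<mu> \<phi> m) (power_map \<mu> \<phi> k) \<longleftrightarrow>
    (\<exists>b>0. \<forall>g. ennreal (b * (norm g)\<^sup>2) \<le> power_energy (1 + 2 * m - 2 * k) g)"
  by (simp add: lower_semi_frame_def weakly_measurable_power_map carrier_frame_space
      frame_integral_power_map hnorm_sq_frame_space)

lemma parseval_power_map_iff:
  "parseval_frame \<mu> (frame_space \<mu> \<phi> m) (power_map \<mu> \<phi> k) \<longleftrightarrow>
    (\<forall>g. power_energy (1 + 2 * m - 2 * k) g = ennreal ((norm g)\<^sup>2))"
  by (simp add: parseval_frame_def weakly_measurable_power_map carrier_frame_space
      frame_integral_power_map hnorm_sq_frame_space)

end

section \<open>Boundedness of powers\<close>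

lemma nn_integral_const_spec_measure:
  assumes "0 \<le> b"
  shows "(\<integral>\<^sup>+t. ennreal b \<partial>spec_measure E g) = ennreal (b * (norm g)\<^sup>2)"
  using assms by (simp add: emeasure_spec_measure_UNIV ennreal_mult')

lemma power_energy_upper:
  assumes "p \<le> 0"
  shows "power_energy p g \<le> ennreal (c powr p * (norm g)\<^sup>2)"
proof -
  have "power_energy p g \<le> (\<integral>\<^sup>+t. ennreal (c powr p) \<partial>spec_measure E g)"
    unfolding power_energy_def
    by (intro nn_integral_mono_AE eventually_mono[OF AE_ge_lower_bound])
      (use assms c_pos in \<open>auto intro!: ennreal_leI powr_mono2'\<close>)
  then show ?thesis
    using nn_integral_const_spec_measure[of "c powr p" g] by simp
qed

lemma power_energy_lower:
  assumes "0 \<le> p"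
  shows "ennreal (c powr p * (norm g)\<^sup>2) \<le> power_energy p g"
proof -
  have "(\<integral>\<^sup>+t. ennreal (c powr p) \<partial>spec_measure E g) \<le> power_energy p g"
    unfolding power_energy_def
    by (intro nn_integral_mono_AE eventually_mono[OF AE_ge_lower_bound])
      (use assms c_pos in \<open>auto intro!: ennreal_leI powr_mono2\<close>)
  then show ?thesis
    using nn_integral_const_spec_measure[of "c powr p" g] by simp
qed

lemma power_energy_zero: "power_energy 0 g = ennreal ((norm g)\<^sup>2)"
proof -
  have "power_energy 0 g = (\<integral>\<^sup>+t. ennreal 1 \<partial>spec_measure E g)"
    unfolding power_energy_def
    by (intro nn_integral_cong_AE eventually_mono[OF AE_ge_lower_bound]) (use c_pos in auto)
  then show ?thesis
    using nn_integral_const_spec_measure[of 1] by simp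
qed

lemma bessel_if_spectrum_bounded:
  assumes L: "0 < L" and AE: "\<And>f. AE t in spec_measure E f. t \<le> L"
  shows "bessel_mapping \<mu> ambient \<phi>"
proof -
  have "frame_integral \<mu> ambient \<phi> f \<le> ennreal (L * hnorm_sq ambient f)" for f
  proof -
    have "q f \<le> (\<integral>\<^sup>+t. ennreal L \<partial>spec_measure E f)"
      unfolding energy_eq_spectral_integral
      by (intro nn_integral_mono_AE eventually_mono[OF AE] ennreal_leI)
    also have "\<dots> = ennreal (L * hnorm_sq ambient f)"
      using L nn_integral_const_spec_measure[of L f]
      by (simp add: hnorm_sq_def ambient_def inner_eq_Re_cinner[symmetric] power2_norm_eq_inner)
    finally show ?thesis .
  qed
  then show ?thesis
    by (auto simp: bessel_mapping_def weakly_measurable_def ambient_def weak_meas)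
qed

text \<open>The spectral part of \<open>f\<close> above a large \<open>L\<close> is a vector on which \<open>T\<^sup>p\<^sup>/\<^sup>2\<close> violates a given upper bound
  if \<open>p > 0\<close>, and a given lower bound if \<open>p < 0\<close>, unless that part vanishes.\<close>

lemma power_energy_tail:
  assumes "0 < L"
  obtains g where "(norm g)\<^sup>2 = measure (spec_measure E f) {L<..}"
    "0 \<le> p \<Longrightarrow> ennreal (L powr p * (norm g)\<^sup>2) \<le> power_energy p g"
    "p \<le> 0 \<Longrightarrow> power_energy p g \<le> ennreal (L powr p * (norm g)\<^sup>2)"
proof -
  define w where "w = (indicator {L<..} :: real \<Rightarrow> real)"
  have w: "bounded_borel w"
    unfolding w_def by (rule bounded_borel_indicator) simp
  define g where "g = fcalc w f"
  have w2: "(w t)\<^sup>2 = indicator {L<..} t" for t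
    by (simp add: w_def indicator_def)
  have norm_g: "(norm g)\<^sup>2 = measure (spec_measure E f) {L<..}"
    unfolding g_def norm_fcalc[OF w] w2 by simp
  have energy: "power_energy p g = (\<integral>\<^sup>+t. ennreal (indicator {L<..} t) * ennreal (t powr p) \<partial>spec_measure E f)"
    unfolding power_energy_def g_def by (subst nn_integral_spec_measure_fcalc[OF w]) (simp_all add: w2)
  interpret finite_measure "spec_measure E f"
    using finite_borel_spec_measure by (simp add: finite_borel_def)
  have const: "(\<integral>\<^sup>+t. ennreal (indicator {L<..} t) * ennreal (L powr p) \<partial>spec_measure E f)
      = ennreal (L powr p * (norm g)\<^sup>2)"
    by (simp add: ennreal_indicator mult.commute[of _ "ennreal (L powr p)"] nn_integral_cmult_indicator
        emeasure_eq_measure norm_g ennreal_mult')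
  have lower: "ennreal (L powr p * (norm g)\<^sup>2) \<le> power_energy p g" if "0 \<le> p"
    unfolding const[symmetric] energy
    using that assms by (intro nn_integral_mono) (auto simp: indicator_def intro!: ennreal_leI powr_mono2)
  have upper: "power_energy p g \<le> ennreal (L powr p * (norm g)\<^sup>2)" if "p \<le> 0"
    unfolding const[symmetric] energy
    using that assms by (intro nn_integral_mono) (auto simp: indicator_def intro!: ennreal_leI powr_mono2')
  show ?thesis
    by (rule that[OF norm_g lower upper])
qed

lemma AE_le_if_tail_null:
  assumes "measure (spec_measure E f) {L<..} = 0"
  shows "AE t in spec_measure E f. t \<le> L"
proof -
  interpret finite_measure "spec_measure E f"
    using finite_borel_spec_measure by (simp add: finite_borel_def)
  have "{L<..} \<in> null_sets (spec_measure E f)"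
    using assms by (auto simp: null_sets_def emeasure_eq_measure)
  then have "AE t in spec_measure E f. t \<notin> {L<..}"
    by (rule AE_not_in)
  then show ?thesis
    by (rule eventually_mono) auto
qed

lemma bessel_if_power_bounded_above:
  assumes p: "0 < p" and M: "\<And>g. power_energy p g \<le> ennreal (M * (norm g)\<^sup>2)"
  shows "bessel_mapping \<mu> ambient \<phi>"
proof -
  define L where "L = (\<bar>M\<bar> + 1) powr (1 / p)"
  have L: "0 < L" "L powr p = \<bar>M\<bar> + 1"
    using p by (simp_all add: L_def powr_powr)
  have "AE t in spec_measure E f. t \<le> L" for f
  proof (rule AE_le_if_tail_null)
    obtain g where g: "(norm g)\<^sup>2 = measure (spec_measure E f) {L<..}"
      and "0 \<le> p \<Longrightarrow> ennreal (L powr p * (norm g)\<^sup>2) \<le> power_energy p g"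
      using power_energy_tail[OF L(1)] by metis
    then have "ennreal ((\<bar>M\<bar> + 1) * (norm g)\<^sup>2) \<le> power_energy p g"
      using p L(2) by simp
    also have "\<dots> \<le> ennreal (M * (norm g)\<^sup>2)"
      by (rule M)
    also have "\<dots> \<le> ennreal (\<bar>M\<bar> * (norm g)\<^sup>2)"
      by (intro ennreal_leI mult_right_mono) auto
    finally have "(\<bar>M\<bar> + 1) * (norm g)\<^sup>2 \<le> \<bar>M\<bar> * (norm g)\<^sup>2"
      by (subst (asm) ennreal_le_iff) auto
    then show "measure (spec_measure E f) {L<..} = 0"
      unfolding g[symmetric] by (simp add: algebra_simps)
  qed
  then show ?thesis
    by (rule bessel_if_spectrum_bounded[OF L(1)])
qed

lemma bessel_if_power_bounded_below:
  assumes p: "p < 0" and b: "0 < b" "\<And>g. ennreal (b * (norm g)\<^sup>2) \<le> power_energy p g"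
  shows "bessel_mapping \<mu> ambient \<phi>"
proof -
  define L where "L = (b / 2) powr (1 / p)"
  have L: "0 < L" "L powr p = b / 2"
    using p b by (simp_all add: L_def powr_powr)
  have "AE t in spec_measure E f. t \<le> L" for f
  proof (rule AE_le_if_tail_null)
    obtain g where g: "(norm g)\<^sup>2 = measure (spec_measure E f) {L<..}"
      and "p \<le> 0 \<Longrightarrow> power_energy p g \<le> ennreal (L powr p * (norm g)\<^sup>2)"
      using power_energy_tail[OF L(1)] by metis
    then have "ennreal (b * (norm g)\<^sup>2) \<le> ennreal (b / 2 * (norm g)\<^sup>2)"
      using order_trans[OF b(2)[of g]] p L(2) by simp
    then have "b * (norm g)\<^sup>2 \<le> b / 2 * (norm g)\<^sup>2"
      using b(1) by (subst (asm) ennreal_le_iff) auto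
    then have "b * (norm g)\<^sup>2 \<le> 0"
      by simp
    then show "measure (spec_measure E f) {L<..} = 0"
      unfolding g[symmetric] using b(1) by (simp add: mult_le_0_iff)
  qed
  then show ?thesis
    by (rule bessel_if_spectrum_bounded[OF L(1)])
qed

end

theorem theorem4p1:
  fixes \<mu> :: "'x::t2_space measure"
    and \<phi> :: "'x \<Rightarrow> 'h::chilbert_space"
    and m k :: real
  assumes "locally_compact_space (euclidean :: 'x topology)"
    and "radon_measure \<mu>"
    and "separable_space (euclidean :: 'h topology)"
    and "lower_semi_frame \<mu> ambient \<phi>"
    and "closure (analysis_domain \<mu> \<phi>) = UNIV"
    and "0 \<le> m" and "m \<le> k"
  shows
    "(\<not> bessel_mapping \<mu> ambient \<phi> \<longrightarrow>
       (bessel_mapping \<mu> (frame_space \<mu> \<phi> m) (power_map \<mu> \<phi> k) \<longleftrightarrow> k \<ge> m + 1/2) \<and>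
       (lower_semi_frame \<mu> (frame_space \<mu> \<phi> m) (power_map \<mu> \<phi> k) \<longleftrightarrow> m \<le> k \<and> k \<le> m + 1/2) \<and>
       (cont_frame \<mu> (frame_space \<mu> \<phi> m) (power_map \<mu> \<phi> k) \<longleftrightarrow>
          parseval_frame \<mu> (frame_space \<mu> \<phi> m) (power_map \<mu> \<phi> k)) \<and>
       (parseval_frame \<mu> (frame_space \<mu> \<phi> m) (power_map \<mu> \<phi> k) \<longleftrightarrow> k = m + 1/2)) \<and>
     (k \<ge> m + 1/2 \<longrightarrow> bessel_mapping \<mu> (frame_space \<mu> \<phi> m) (power_map \<mu> \<phi> k)) \<and>
     (m \<le> k \<and> k \<le> m + 1/2 \<longrightarrow>
        lower_semi_frame \<mu> (frame_space \<mu> \<phi> m) (power_map \<mu> \<phi> k)) \<and>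
     (k = m + 1/2 \<longrightarrow> parseval_frame \<mu> (frame_space \<mu> \<phi> m) (power_map \<mu> \<phi> k)) \<and>
     (parseval_frame \<mu> (frame_space \<mu> \<phi> m) (power_map \<mu> \<phi> k) \<longrightarrow>
        cont_frame \<mu> (frame_space \<mu> \<phi> m) (power_map \<mu> \<phi> k))"
proof -
  obtain c where c: "0 < c" and lower: "\<And>f. ennreal (c * hnorm_sq ambient f) \<le> frame_integral \<mu> ambient \<phi> f"
    and meas: "\<And>f. (\<lambda>x. cinner f (\<phi> x)) \<in> borel_measurable \<mu>"
    using assms(4) by (auto simp: lower_semi_frame_def weakly_measurable_def ambient_def)
  interpret dense_lower_semi_frame \<mu> \<phi> c
  proof
    show "ennreal (c * (norm f)\<^sup>2) \<le> frame_integral \<mu> ambient \<phi> f" for f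
      using lower[of f] inner_eq_Re_cinner[of f f]
      by (simp add: hnorm_sq_def ambient_def power2_norm_eq_inner)
  qed (use c meas assms(5) in auto)
  let ?p = "1 + 2 * m - 2 * k"
  note bessel = bessel_power_map_iff[OF assms(6,7)]
    and lsf = lower_semi_frame_power_map_iff[OF assms(6,7)]
    and parseval = parseval_power_map_iff[OF assms(6,7)]
  have bessel_if: "bessel_mapping \<mu> (frame_space \<mu> \<phi> m) (power_map \<mu> \<phi> k)" if "k \<ge> m + 1/2"
    unfolding bessel using power_energy_upper[of ?p] that by auto
  have lsf_if: "lower_semi_frame \<mu> (frame_space \<mu> \<phi> m) (power_map \<mu> \<phi> k)" if "k \<le> m + 1/2"
    unfolding lsf using power_energy_lower[of ?p] that c by (intro exI[of _ "c powr ?p"]) auto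
  have parseval_if: "parseval_frame \<mu> (frame_space \<mu> \<phi> m) (power_map \<mu> \<phi> k)" if "k = m + 1/2"
  proof -
    have "?p = 0"
      using that by simp
    then show ?thesis
      unfolding parseval using power_energy_zero by simp
  qed
  have frame_if: "cont_frame \<mu> (frame_space \<mu> \<phi> m) (power_map \<mu> \<phi> k)"
    if "parseval_frame \<mu> (frame_space \<mu> \<phi> m) (power_map \<mu> \<phi> k)"
    using that unfolding cont_frame_def bessel lsf parseval
    by (auto intro!: exI[of _ "1::real"])
  have only_bessel: "k \<ge> m + 1/2"
    if "\<not> bessel_mapping \<mu> ambient \<phi>" "bessel_mapping \<mu> (frame_space \<mu> \<phi> m) (power_map \<mu> \<phi> k)"
  proof (rule ccontr)
    assume "\<not> m + 1/2 \<le> k"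
    then have "0 < ?p"
      by simp
    then show False
      using that bessel_if_power_bounded_above unfolding bessel by blast
  qed
  have only_lsf: "k \<le> m + 1/2"
    if "\<not> bessel_mapping \<mu> ambient \<phi>" "lower_semi_frame \<mu> (frame_space \<mu> \<phi> m) (power_map \<mu> \<phi> k)"
  proof (rule ccontr)
    assume "\<not> k \<le> m + 1/2"
    then have "?p < 0"
      by simp
    then show False
      using that bessel_if_power_bounded_below unfolding lsf by blast
  qed
  have only_frame: "k = m + 1/2"
    if "\<not> bessel_mapping \<mu> ambient \<phi>" "cont_frame \<mu> (frame_space \<mu> \<phi> m) (power_map \<mu> \<phi> k)"
    using that only_bessel only_lsf by (auto simp: cont_frame_def)
  show ?thesis
    using assms(7) bessel_if lsf_if parseval_if frame_if only_bessel only_lsf only_frame by blast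
qed

end
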